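(* Assume the smoothness assumption, that $R$ is convex, the sparse minimizer assumption and the non-degeneracy assumption (all stated in the context). Then there exist $J_0>J^\star$ and $\kappa_0>0$ such that for all $\nu\in\mathcal M_+(\Theta)$ satisfying $J(\nu)\le J_0$ and all $\alpha,\beta>0$, $$\frac12\|g_\nu\|^2_{L^2(\nu)}\ \ge\ \kappa_0\,\min\{\alpha,\beta\}\,(J(\nu)-J^\star),$$ where $\|g_\nu\|^2_{L^2(\nu)}=\int_\Theta\big(4\alpha|J'_\nu(\theta)|^2+\beta\|\nabla J'_\nu(\theta)\|_\theta^2\big)\,d\nu(\theta)$.
   Context: Smoothness assumption: $\Theta$ is a compact $d$-dimensional Riemannian manifold without boundary, $\mathcal F$ is a Hilbert space, $\lambda>0$; $\phi:\Theta\to\mathcal F$ and $R:\mathcal F\to\mathbb R_+$ are twice Fréchet differentiable with locally Lipschitz second-order derivatives, and $\nabla R$ is bounded on sublevel sets of $R$. $\mathcal M_+(\Theta)$ is the set of finite nonnegative Borel measures on $\Theta$. For $\nu\in\mathcal M_+(\Theta)$, $$J(\nu)=R\Big(\int_\Theta\phi\,d\nu\Big)+\lambda\,\nu(\Theta),\qquad J^\star=\inf_{\mathcal M_+(\Theta)}J,\qquad J'_\nu(\theta)=\Big\langle\phi(\theta),\nabla R\Big(\int_\Theta\phi\,d\nu\Big)\Big\rangle_{\mathcal F}+\lambda .$$ Sparse minimizer assumption: $J$ has a unique minimizer on $\mathcal M_+(\Theta)$, of the form $\nu^\star=\sum_{i=1}^{m^\star}r_i^2\delta_{\theta_i}$ with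 $\nu^\star(\Theta)>0$, $r_i>0$ and the $\theta_i$ distinct. Write $f^\star=\int\phi\,d\nu^\star$. Non-degeneracy assumption: fix normal coordinates around each $\theta_i$. For $\alpha,\beta>0$ (conic metric parameters) put $\bar\nabla\phi=(2\alpha\phi,\beta\nabla\phi)$, with components $\bar\nabla_0\phi=2\alpha\phi$ and $\bar\nabla_j\phi=\beta\,\partial_j\phi$ for $1\le j\le d$. Let $K$ be the matrix indexed by $\{1,\dots,m^\star\}\times\{0,\dots,d\}$, $$K_{(i,j),(i',j')}=\big\langle r_i\bar\nabla_j\phi(\theta_i),\ \nabla^2R(f^\star)\,r_{i'}\bar\nabla_{j'}\phi(\theta_{i'})\big\rangle_{\mathcal F},$$ and $H_i=\beta^2\nabla^2J'_{\nu^\star}(\theta_i)$ (a $d\times d$ matrix in coordinates). With $\sigma_{\min}$ the smallest singular value, assume: $\nabla^2R(f^\star)$ is positive definite; $\sigma_{\min}(K)>0$; $\min_i\sigma_{\min}(H_i)>0$; and the only points where $J'_{\nu^\star}$ vanishes are $\theta_1,\dots,\theta_{m^\star}$. (The validity of these conditions does not depend on the choice of $\alpha,\beta>0$.) *)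

theory Defs
  imports "HOL-Analysis.Analysis"
begin

section \<open>Differentiability in normed spaces\<close>

text \<open>On an open set, \<open>Ck_on k S f\<close> says that \<open>f\<close> is of class \<open>C\<^sup>k\<close> (finite-dimensional domain).\<close>

primrec Ck_on ::
  "nat \<Rightarrow> 'a::real_normed_vector set \<Rightarrow> ('a \<Rightarrow> 'b::real_normed_vector) \<Rightarrow> bool" where
  "Ck_on 0 S f \<longleftrightarrow> continuous_on S f"
| "Ck_on (Suc k) S f \<longleftrightarrow>
     (\<forall>x\<in>S. f differentiable (at x)) \<and>
     (\<forall>v. Ck_on k S (\<lambda>x. frechet_derivative f (at x) v))"

definition smooth_on :: "'a::real_normed_vector set \<Rightarrow> ('a \<Rightarrow> 'b::real_normed_vector) \<Rightarrow> bool" where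
  "smooth_on S f \<longleftrightarrow> (\<forall>k. Ck_on k S f)"

text \<open>Twice Frechet differentiable on the open set \<open>S\<close> with locally Lipschitz second derivative,
  derivatives being taken in the operator norm.\<close>

definition twice_diff_loc_lipschitz_on ::
  "'a::real_normed_vector set \<Rightarrow> ('a \<Rightarrow> 'b::real_normed_vector) \<Rightarrow> bool" where
  "twice_diff_loc_lipschitz_on S f \<longleftrightarrow>
     (\<exists>(f' :: 'a \<Rightarrow> 'a \<Rightarrow>\<^sub>L 'b) (f'' :: 'a \<Rightarrow> 'a \<Rightarrow>\<^sub>L ('a \<Rightarrow>\<^sub>L 'b)).
        (\<forall>x\<in>S. (f has_derivative blinfun_apply (f' x)) (at x)) \<and>
        (\<forall>x\<in>S. (f' has_derivative blinfun_apply (f'' x)) (at x)) \<and>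
        (\<forall>x\<in>S. \<exists>u>0. \<exists>L. L-lipschitz_on (cball x u \<inter> S) f''))"

definition gradient :: "('f::real_inner \<Rightarrow> real) \<Rightarrow> 'f \<Rightarrow> 'f" where
  "gradient R f = (THE D. GDERIV R f :> D)"

definition hessian_op :: "('f::real_inner \<Rightarrow> real) \<Rightarrow> 'f \<Rightarrow> 'f \<Rightarrow> 'f" where
  "hessian_op R f = frechet_derivative (gradient R) (at f)"

definition partial :: "'d::finite \<Rightarrow> (real^'d \<Rightarrow> 'b::real_normed_vector) \<Rightarrow> real^'d \<Rightarrow> 'b" where
  "partial j F u = frechet_derivative F (at u) (axis j 1)"


section \<open>Smooth manifolds and Riemannian metrics\<close>

text \<open>A chart of a \<open>CARD('d)\<close>-dimensional manifold is a pair of its domain and its coordinate map;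
  the values of the coordinate map outside the domain are irrelevant.\<close>

type_synonym ('a, 'd) chart = "'a set \<times> ('a \<Rightarrow> real^'d)"

definition is_chart :: "('a::topological_space, 'd::finite) chart \<Rightarrow> bool" where
  "is_chart c \<longleftrightarrow> open (fst c) \<and> open (snd c ` fst c) \<and>
     homeomorphism (fst c) (snd c ` fst c) (snd c) (inv_into (fst c) (snd c))"

definition in_chart :: "('a, 'd::finite) chart \<Rightarrow> ('a \<Rightarrow> 'b) \<Rightarrow> real^'d \<Rightarrow> 'b" where
  "in_chart c f = f \<circ> inv_into (fst c) (snd c)"

definition compatible :: "('a, 'd::finite) chart \<Rightarrow> ('a, 'd) chart \<Rightarrow> bool" where
  "compatible c c' \<longleftrightarrow>
     smooth_on (snd c ` (fst c \<inter> fst c')) (in_chart c (snd c')) \<and>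
     smooth_on (snd c' ` (fst c \<inter> fst c')) (in_chart c' (snd c))"

text \<open>A smooth structure is a maximal smooth atlas. The charts map onto open subsets of
  \<open>\<real>\<^sup>d\<close>, so there is no boundary.\<close>

definition smooth_structure :: "('a::topological_space, 'd::finite) chart set \<Rightarrow> bool" where
  "smooth_structure A \<longleftrightarrow>
     (\<forall>c\<in>A. is_chart c) \<and> (\<Union>c\<in>A. fst c) = UNIV \<and>
     (\<forall>c\<in>A. \<forall>c'\<in>A. compatible c c') \<and>
     (\<forall>c. is_chart c \<and> (\<forall>c'\<in>A. compatible c c') \<longrightarrow> c \<in> A)"

text \<open>A metric is given by its Gram matrices: \<open>G c p\<close> is the matrix of the inner product on the
  tangent space at \<open>p\<close> with respect to the coordinate frame of the chart \<open>c\<close>. The last clause is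
  the change-of-chart rule for covariant 2-tensors.\<close>

definition riemannian_metric ::
  "('a, 'd::finite) chart set \<Rightarrow> (('a, 'd) chart \<Rightarrow> 'a \<Rightarrow> real^'d^'d) \<Rightarrow> bool" where
  "riemannian_metric A G \<longleftrightarrow>
     (\<forall>c\<in>A. smooth_on (snd c ` fst c) (in_chart c (G c))) \<and>
     (\<forall>c\<in>A. \<forall>p\<in>fst c. transpose (G c p) = G c p \<and> (\<forall>v. v \<noteq> 0 \<longrightarrow> v \<bullet> (G c p *v v) > 0)) \<and>
     (\<forall>c\<in>A. \<forall>c'\<in>A. \<forall>p \<in> fst c \<inter> fst c'.
        let D = matrix (frechet_derivative (in_chart c (snd c')) (at (snd c p)))
        in G c p = transpose D ** G c' p ** D)"

definition riemannian_manifold ::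
  "('a::topological_space, 'd::finite) chart set \<Rightarrow> (('a, 'd) chart \<Rightarrow> 'a \<Rightarrow> real^'d^'d) \<Rightarrow> bool" where
  "riemannian_manifold A G \<longleftrightarrow> smooth_structure A \<and> riemannian_metric A G"

text \<open>Coordinates, in the frame of \<open>c\<close>, of the Riemannian gradient of \<open>f\<close> at \<open>p\<close>.\<close>

definition riem_grad ::
  "(('a, 'd::finite) chart \<Rightarrow> 'a \<Rightarrow> real^'d^'d) \<Rightarrow> ('a, 'd) chart \<Rightarrow> ('a \<Rightarrow> real) \<Rightarrow> 'a \<Rightarrow> real^'d" where
  "riem_grad G c f p = matrix_inv (G c p) *v (\<chi> j. partial j (in_chart c f) (snd c p))"

text \<open>The squared norm of the gradient in the metric at \<open>p\<close>; it does not depend on the chart chosen.\<close>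

definition riem_grad_norm_sq ::
  "('a, 'd::finite) chart set \<Rightarrow> (('a, 'd) chart \<Rightarrow> 'a \<Rightarrow> real^'d^'d) \<Rightarrow> ('a \<Rightarrow> real) \<Rightarrow> 'a \<Rightarrow> real" where
  "riem_grad_norm_sq A G f p =
     (let c = (SOME c. c \<in> A \<and> p \<in> fst c)
      in riem_grad G c f p \<bullet> (G c p *v riem_grad G c f p))"

text \<open>\<open>christoffel G c u k i j\<close> is $\Gamma^k_{ij}$ at the point with coordinates \<open>u\<close>.\<close>

definition christoffel ::
  "(('a, 'd::finite) chart \<Rightarrow> 'a \<Rightarrow> real^'d^'d) \<Rightarrow> ('a, 'd) chart \<Rightarrow> real^'d \<Rightarrow> 'd \<Rightarrow> 'd \<Rightarrow> 'd \<Rightarrow> real" where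
  "christoffel G c u k i j =
     (let g = in_chart c (G c) in
      (\<Sum>l\<in>UNIV. matrix_inv (g u) $ k $ l *
         (partial i (\<lambda>w. g w $ j $ l) u + partial j (\<lambda>w. g w $ i $ l) u
          - partial l (\<lambda>w. g w $ i $ j) u)) / 2)"

definition geodesic ::
  "('a::topological_space, 'd::finite) chart set \<Rightarrow> (('a, 'd) chart \<Rightarrow> 'a \<Rightarrow> real^'d^'d)
     \<Rightarrow> real set \<Rightarrow> (real \<Rightarrow> 'a) \<Rightarrow> bool" where
  "geodesic A G I \<gamma> \<longleftrightarrow> open I \<and> is_interval I \<and> continuous_on I \<gamma> \<and>
     (\<forall>c\<in>A. \<exists>v a. \<forall>t\<in>I. \<gamma> t \<in> fst c \<longrightarrow>
        ((\<lambda>s. snd c (\<gamma> s)) has_vector_derivative v t) (at t) \<and>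
        (v has_vector_derivative a t) (at t) \<and>
        (\<forall>k. a t $ k + (\<Sum>i\<in>UNIV. \<Sum>j\<in>UNIV.
             christoffel G c (snd c (\<gamma> t)) k i j * v t $ i * v t $ j) = 0))"

text \<open>Normal coordinates: the frame at \<open>p\<close> is orthonormal and the point with coordinates \<open>v\<close> is
  $\exp_p(\sum_j v_j e_j)$, that is, the curve \<open>t \<mapsto> x\<^sup>-\<^sup>1(t v)\<close>, which has initial velocity
  $\sum_j v_j e_j$, is a geodesic.\<close>

definition normal_coordinates ::
  "('a::topological_space, 'd::finite) chart set \<Rightarrow> (('a, 'd) chart \<Rightarrow> 'a \<Rightarrow> real^'d^'d)
     \<Rightarrow> 'a \<Rightarrow> ('a, 'd) chart \<Rightarrow> bool" where
  "normal_coordinates A G p c \<longleftrightarrow>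
     c \<in> A \<and> p \<in> fst c \<and> snd c p = 0 \<and> G c p = mat 1 \<and>
     (\<exists>\<rho>>0. snd c ` fst c = ball 0 \<rho> \<and>
        (\<forall>v. geodesic A G {t. t *\<^sub>R v \<in> ball 0 \<rho>} (\<lambda>t. inv_into (fst c) (snd c) (t *\<^sub>R v))))"


section \<open>Measures and the objective\<close>

definition finite_borel_measures :: "'a::topological_space measure set" where
  "finite_borel_measures = {\<nu>. sets \<nu> = sets borel \<and> finite_measure \<nu>}"

text \<open>The Bochner integral. The library's \<open>has_bochner_integral\<close> has the same defining clause but
  is restricted to separable spaces.\<close>

definition has_vec_integral ::
  "'a measure \<Rightarrow> ('a \<Rightarrow> 'f::real_normed_vector) \<Rightarrow> 'f \<Rightarrow> bool" where
  "has_vec_integral M f y \<longleftrightarrow> f \<in> borel_measurable M \<and>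
     (\<exists>s. (\<forall>i::nat. Bochner_Integration.simple_bochner_integrable M (s i)) \<and>
          (\<lambda>i. \<integral>\<^sup>+x. ennreal (norm (f x - s i x)) \<partial>M) \<longlonglongrightarrow> 0 \<and>
          (\<lambda>i. Bochner_Integration.simple_bochner_integral M (s i)) \<longlonglongrightarrow> y)"

definition vec_integral :: "'a measure \<Rightarrow> ('a \<Rightarrow> 'f::real_normed_vector) \<Rightarrow> 'f" where
  "vec_integral M f = (THE y. has_vec_integral M f y)"

definition objective ::
  "('a \<Rightarrow> 'f::real_inner) \<Rightarrow> ('f \<Rightarrow> real) \<Rightarrow> real \<Rightarrow> 'a measure \<Rightarrow> real" where
  "objective \<phi> R lam \<nu> = R (vec_integral \<nu> \<phi>) + lam * measure \<nu> UNIV"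

definition objective_inf ::
  "('a::topological_space \<Rightarrow> 'f::real_inner) \<Rightarrow> ('f \<Rightarrow> real) \<Rightarrow> real \<Rightarrow> real" where
  "objective_inf \<phi> R lam = (INF \<nu>\<in>finite_borel_measures. objective \<phi> R lam \<nu>)"

definition objective_deriv ::
  "('a \<Rightarrow> 'f::real_inner) \<Rightarrow> ('f \<Rightarrow> real) \<Rightarrow> real \<Rightarrow> 'a measure \<Rightarrow> 'a \<Rightarrow> real" where
  "objective_deriv \<phi> R lam \<nu> p = \<phi> p \<bullet> gradient R (vec_integral \<nu> \<phi>) + lam"

definition unique_minimizer_on :: "('b \<Rightarrow> real) \<Rightarrow> 'b set \<Rightarrow> 'b \<Rightarrow> bool" where
  "unique_minimizer_on F S x \<longleftrightarrow> x \<in> S \<and> (\<forall>y\<in>S. F x \<le> F y) \<and>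
     (\<forall>y\<in>S. (\<forall>z\<in>S. F y \<le> F z) \<longrightarrow> y = x)"

definition sparse_measure :: "('m::finite \<Rightarrow> real) \<Rightarrow> ('m \<Rightarrow> 'a::topological_space) \<Rightarrow> 'a measure" where
  "sparse_measure r p =
     measure_of UNIV (sets borel) (\<lambda>B. \<Sum>i\<in>UNIV. ennreal ((r i)\<^sup>2) * indicator B (p i))"

definition grad_norm_sq ::
  "('a, 'd::finite) chart set \<Rightarrow> (('a, 'd) chart \<Rightarrow> 'a \<Rightarrow> real^'d^'d) \<Rightarrow>
   ('a \<Rightarrow> 'f::real_inner) \<Rightarrow> ('f \<Rightarrow> real) \<Rightarrow> real \<Rightarrow> real \<Rightarrow> real \<Rightarrow> 'a measure \<Rightarrow> real" where
  "grad_norm_sq A G \<phi> R lam \<alpha> \<beta> \<nu> =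
     (\<integral>p. 4 * \<alpha> * \<bar>objective_deriv \<phi> R lam \<nu> p\<bar>\<^sup>2
        + \<beta> * riem_grad_norm_sq A G (objective_deriv \<phi> R lam \<nu>) p \<partial>\<nu>)"


section \<open>Non-degeneracy\<close>

definition singular_values :: "real^'k^'k \<Rightarrow> real set" where
  "singular_values B = {s. s \<ge> 0 \<and> (\<exists>v. v \<noteq> 0 \<and> (transpose B ** B) *v v = s\<^sup>2 *\<^sub>R v)}"

definition sigma_min :: "real^'k^'k \<Rightarrow> real" where
  "sigma_min B = Inf (singular_values B)"

text \<open>The component indices \<open>0, 1, \<dots>, d\<close> of the conic gradient are \<open>None\<close> for \<open>0\<close> and \<open>Some j\<close>
  for the coordinate directions \<open>j\<close>.\<close>

definition conic_gradient ::
  "real \<Rightarrow> real \<Rightarrow> ('a, 'd::finite) chart \<Rightarrow> ('a \<Rightarrow> 'f::real_normed_vector) \<Rightarrow> 'a \<Rightarrow> 'd option \<Rightarrow> 'f" where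
  "conic_gradient \<alpha> \<beta> c \<phi> p j =
     (case j of None \<Rightarrow> (2 * \<alpha>) *\<^sub>R \<phi> p
      | Some k \<Rightarrow> \<beta> *\<^sub>R partial k (in_chart c \<phi>) (snd c p))"

definition kernel_matrix ::
  "real \<Rightarrow> real \<Rightarrow> ('m::finite \<Rightarrow> ('a, 'd::finite) chart) \<Rightarrow> ('a \<Rightarrow> 'f::real_inner) \<Rightarrow> ('f \<Rightarrow> real) \<Rightarrow>
   'f \<Rightarrow> ('m \<Rightarrow> real) \<Rightarrow> ('m \<Rightarrow> 'a) \<Rightarrow> real^('m \<times> 'd option)^('m \<times> 'd option)" where
  "kernel_matrix \<alpha> \<beta> c \<phi> R f r p =
     (\<chi> k l. case (k, l) of ((i, j), (i', j')) \<Rightarrow>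
        (r i *\<^sub>R conic_gradient \<alpha> \<beta> (c i) \<phi> (p i) j) \<bullet>
        hessian_op R f (r i' *\<^sub>R conic_gradient \<alpha> \<beta> (c i') \<phi> (p i') j'))"

definition hessian_matrix ::
  "('a, 'd::finite) chart \<Rightarrow> ('a \<Rightarrow> real) \<Rightarrow> 'a \<Rightarrow> real^'d^'d" where
  "hessian_matrix c f p = (\<chi> j k. partial j (partial k (in_chart c f)) (snd c p))"

definition nondegenerate ::
  "real \<Rightarrow> real \<Rightarrow> ('m::finite \<Rightarrow> ('a::topological_space, 'd::finite) chart) \<Rightarrow> ('a \<Rightarrow> 'f::real_inner) \<Rightarrow>
   ('f \<Rightarrow> real) \<Rightarrow> real \<Rightarrow> ('m \<Rightarrow> real) \<Rightarrow> ('m \<Rightarrow> 'a) \<Rightarrow> bool" where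
  "nondegenerate \<alpha> \<beta> c \<phi> R lam r p \<longleftrightarrow>
     (let \<nu> = sparse_measure r p; f = vec_integral \<nu> \<phi>; J' = objective_deriv \<phi> R lam \<nu> in
      (\<forall>h. h \<noteq> 0 \<longrightarrow> h \<bullet> hessian_op R f h > 0) \<and>
      sigma_min (kernel_matrix \<alpha> \<beta> c \<phi> R f r p) > 0 \<and>
      (MIN i. sigma_min (\<beta>\<^sup>2 *\<^sub>R hessian_matrix (c i) J' (p i))) > 0 \<and>
      {q. J' q = 0} = range p)"

end

theory Submission
  imports Defs
begin

text \<open>
  Write \<open>f\<^sub>\<nu>\<close> for the integral of \<open>\<phi>\<close>, \<open>f\<^sup>*\<close> for its value at the minimizer, \<open>h = f\<^sub>\<nu> - f\<^sup>*\<close>,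
  \<open>w = \<nabla>R(f\<^sub>\<nu>) - \<nabla>R(f\<^sup>*)\<close> and \<open>D = J'\<close> at the minimizer; \<open>D\<close> is nonnegative and grows quadratically
  around each \<open>\<theta>\<^sub>i\<close>. In charts \<open>u\<close> around the \<open>\<theta>\<^sub>i\<close>, \<open>\<nu>\<close> is described by the mass defects
  \<open>a\<^sub>i = \<nu>(N\<^sub>i) - r\<^sub>i\<^sup>2\<close>, the first moments \<open>b\<^sub>i\<close> of \<open>u\<close> on \<open>N\<^sub>i\<close>, and the bulk: second moments plus the mass
  away from the \<open>N\<^sub>i\<close>. Up to an error bounded by the bulk, \<open>h\<close> is \<open>V(a, b) = \<Sum>\<^sub>i a\<^sub>i \<phi>(\<theta>\<^sub>i) + d\<phi>(\<theta>\<^sub>i) b\<^sub>i\<close>.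
  The gap \<open>J(\<nu>) - J\<^sup>*\<close> is \<open>\<integral> D d\<nu>\<close> plus a Bregman divergence of \<open>R\<close>. By convexity it is at most
  \<open>\<integral> D d\<nu> + \<langle>w, h\<rangle>\<close>, hence at most a multiple of the bulk plus \<open>|(a, b)|\<^sup>2\<close>, and a small gap forces the bulk and
  \<open>(a, b)\<close> to be small. Conversely, testing \<open>(J'\<^sub>\<nu>, \<nabla>J'\<^sub>\<nu>)\<close> against the field \<open>(a\<^sub>i / \<nu>(N\<^sub>i), u)\<close> on \<open>N\<^sub>i\<close> gives
  \<open>\<langle>V(a, b), w\<rangle>\<close> plus a multiple of the second moments up to small errors. The kernel matrix being
  invertible makes \<open>V\<close> injective, so \<open>\<langle>V(a, b), w\<rangle>\<close> dominates \<open>|(a, b)|\<^sup>2\<close>, and the squared gradient norm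
  dominates the same quantity as the gap.
\<close>

section \<open>Riesz representation and vector integrals\<close>

text \<open>The gap is compared with bulk + \<open>|(a, b)|\<^sup>2\<close>: the bulk counts at
  first order, the coefficients only at second order. An error bounded by the bulk is therefore
  harmless whenever it meets a small factor such as \<open>w\<close> or \<open>(a, b)\<close>. The
  scalar part of the test field is \<open>a_i / \<nu>(N_i)\<close> because its integral over
  \<open>N_i\<close> is exactly \<open>a_i\<close>; the vector part \<open>u\<close> has integral
  \<open>b_i\<close> and, through the radial growth of \<open>D\<close>, also produces the second
  moments. One field thus gives both quantities. The pairing is linear in the gradient, so Young's
  inequality with a large parameter turns it into the squared gradient norm and leaves a small
  multiple of the squared norm of the field, which is absorbed. Positivity of the Hessian of
  \<open>R\<close> is only pointwise, which is weaker than coercivity in infinite dimension; it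
  becomes uniform on the finite-dimensional range of \<open>V\<close>. The estimate is carried out
  for \<alpha> = \<beta> = 1; both terms of the squared norm are nonnegative, so the factor min
  {\<alpha>, \<beta>} comes out at the end.\<close>

lemma quadratic_nonneg_imp_zero:
  fixes a b :: real
  assumes "\<And>t. 0 \<le> t\<^sup>2 * a + 2 * t * b"
  shows "b = 0"
proof (rule ccontr)
  assume "b \<noteq> 0"
  \<comment> \<open>The denominator is positive and exceeds \<open>a\<close> whatever its sign, so a
    step of this length against \<open>b\<close> makes the quadratic negative.\<close>
  define t where "t = - b / (\<bar>a\<bar> + 1)"
  have b: "b = - t * (\<bar>a\<bar> + 1)" unfolding t_def by simp
  have "t\<^sup>2 * a + 2 * t * b = - (t\<^sup>2 * (2 * \<bar>a\<bar> + 2 - a))"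
    by (subst b) (simp add: algebra_simps power2_eq_square)
  moreover have "t\<^sup>2 * (2 * \<bar>a\<bar> + 2 - a) > 0"
    using \<open>b \<noteq> 0\<close> b by (intro mult_pos_pos) auto
  ultimately show False using assms[of t] by linarith
qed

text \<open>The representing vector minimizes \<open>Q\<close>, which is bounded below because
  \<open>l\<close> is bounded. The parallelogram identity \<open>par\<close> makes a minimizing
  sequence Cauchy, and the first variation of \<open>Q\<close> at the minimum is a multiple of
  \<open>x \<bullet> y - l x\<close>.\<close>

lemma riesz_representation:
  fixes l :: "'f::{real_inner,complete_space} \<Rightarrow> real"
  assumes "bounded_linear l"
  obtains y where "\<And>x. l x = x \<bullet> y"
proof -
  interpret bounded_linear l by fact
  define Q where "Q x = x \<bullet> x - 2 * l x" for x
  obtain K where K: "\<And>x. norm (l x) \<le> norm x * K" "K > 0" using pos_bounded by blast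
  have lb: "Q x \<ge> - K\<^sup>2" for x
  proof -
    have "0 \<le> (norm x - K)\<^sup>2" by simp
    then have "0 \<le> x \<bullet> x + K\<^sup>2 - 2 * (norm x * K)"
      by (simp add: power2_diff power2_norm_eq_inner)
    moreover have "l x \<le> norm x * K" using K(1)[of x] by simp
    ultimately show ?thesis unfolding Q_def by linarith
  qed
  define m where "m = Inf (range Q)"
  have bdd: "bdd_below (range Q)" using lb by (auto intro!: bdd_belowI)
  have m: "m \<le> Q x" for x unfolding m_def by (rule cInf_lower) (use bdd in auto)
  have par: "dist x y ^ 2 = 2 * (Q x + Q y - 2 * Q ((1/2) *\<^sub>R (x + y)))" for x y
    unfolding Q_def dist_norm power2_norm_eq_inner scaleR add
    by (simp add: algebra_simps inner_commute)
  have "\<exists>x. Q x < m + inverse (real (Suc n))" for n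
    using cInf_lessD[of "range Q" "m + inverse (real (Suc n))"] by (auto simp: m_def)
  then obtain X where X: "\<And>n. Q (X n) < m + inverse (real (Suc n))" by metis
  have "Cauchy X"
  proof (rule metric_CauchyI)
    fix e :: real assume e: "e > 0"
    then obtain N where N: "inverse (real (Suc N)) < e\<^sup>2 / 4"
      using reals_Archimedean[of "e\<^sup>2/4"] by auto
    have "dist (X a) (X b) < e" if "a \<ge> N" "b \<ge> N" for a b
    proof -
      have le: "Q (X i) < m + e\<^sup>2/4" if "i \<ge> N" for i
      proof -
        have "inverse (real (Suc i)) \<le> inverse (real (Suc N))"
          using that by (intro le_imp_inverse_le) auto
        then show ?thesis using N X[of i] by linarith
      qed
      have aux: "d < 4 * k" if "d = 2 * (a + b - 2 * c)" "a < m + k" "b < m + k" "m \<le> c" for a b c d k :: real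
      proof -
        have "a + b < 2 * m + 2 * k" using that by linarith
        moreover have "2 * m \<le> 2 * c" using that by linarith
        ultimately have "a + b - 2 * c < 2 * k" by linarith
        then show ?thesis unfolding that(1) by simp
      qed
      have "dist (X a) (X b) ^ 2 < e\<^sup>2"
        using aux[where k="e\<^sup>2/4", OF par[of "X a" "X b"] le[OF that(1)] le[OF that(2)] m] by simp
      then show ?thesis using e power2_less_imp_less by force
    qed
    then show "\<exists>M. \<forall>a\<ge>M. \<forall>b\<ge>M. dist (X a) (X b) < e" by blast
  qed
  then obtain y where y: "X \<longlonglongrightarrow> y" by (meson Cauchy_convergent convergent_def)
  have "(\<lambda>n. Q (X n)) \<longlonglongrightarrow> Q y" unfolding Q_def
    by (intro tendsto_intros tendsto y)
  moreover have "(\<lambda>n. m + inverse (real (Suc n))) \<longlonglongrightarrow> m + 0"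
    by (intro tendsto_intros LIMSEQ_inverse_real_of_nat)
  ultimately have Qy: "Q y \<le> m" using X by (intro LIMSEQ_le) (auto intro: less_imp_le)
  have "l x = x \<bullet> y" for x
  proof -
    have "x \<bullet> y - l x = 0"
    proof (rule quadratic_nonneg_imp_zero)
      fix t
      have "Q (y + t *\<^sub>R x) = Q y + (t\<^sup>2 * (x \<bullet> x) + 2 * t * (x \<bullet> y - l x))"
        unfolding Q_def add scaleR by (simp add: algebra_simps inner_commute power2_eq_square)
      then show "0 \<le> t\<^sup>2 * (x \<bullet> x) + 2 * t * (x \<bullet> y - l x)"
        using m[of "y + t *\<^sub>R x"] Qy by linarith
    qed
    then show ?thesis by simp
  qed
  then show ?thesis by (rule that)
qed

lemma gderiv_unique:
  fixes D E :: "'f::real_inner"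
  assumes "GDERIV R x :> D" "GDERIV R x :> E"
  shows "D = E"
proof -
  have "(\<lambda>h. h \<bullet> D) = (\<lambda>h. h \<bullet> E)"
    using assms unfolding gderiv_def by (rule has_derivative_unique)
  then have "(D - E) \<bullet> D = (D - E) \<bullet> E" by metis
  then have "(D - E) \<bullet> (D - E) = 0" by (simp add: inner_diff_right)
  then show ?thesis by simp
qed

lemma gradient_eqI:
  assumes "GDERIV R x :> D"
  shows "gradient R x = D"
  unfolding gradient_def using assms gderiv_unique by (intro the_equality) blast+

text \<open>The assumed derivatives live in the dual space. The Riesz map \<open>z\<close> is
  bounded and linear, so it carries the first derivative to the gradient and the second one to the
  derivative of the gradient.\<close>

lemma twice_diff_gradient:
  fixes R :: "'f::{real_inner,complete_space} \<Rightarrow> real"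
  assumes "twice_diff_loc_lipschitz_on UNIV R"
  shows "GDERIV R x :> gradient R x"
    and "(gradient R has_derivative hessian_op R x) (at x)"
proof -
  obtain R' :: "'f \<Rightarrow> 'f \<Rightarrow>\<^sub>L real" and R'' where
    R': "\<And>x. (R has_derivative blinfun_apply (R' x)) (at x)"
    and R'': "\<And>x. (R' has_derivative blinfun_apply (R'' x)) (at x)"
    using assms unfolding twice_diff_loc_lipschitz_on_def by blast
  have "\<exists>y. \<forall>x. blinfun_apply l x = x \<bullet> y" for l :: "'f \<Rightarrow>\<^sub>L real"
    by (metis riesz_representation[OF blinfun.bounded_linear_right])
  then obtain z :: "('f \<Rightarrow>\<^sub>L real) \<Rightarrow> 'f" where z: "\<And>l x. blinfun_apply l x = x \<bullet> z l" by metis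
  have z_eq: "z l = y" if "\<And>x. blinfun_apply l x = x \<bullet> y" for l y
  proof -
    have "(z l - y) \<bullet> z l = (z l - y) \<bullet> y" using z[of l "z l - y"] that[of "z l - y"] by simp
    then have "(z l - y) \<bullet> (z l - y) = 0" by (simp add: inner_diff_right)
    then show ?thesis by simp
  qed
  have gd: "GDERIV R x :> z (R' x)" for x
  proof -
    have "blinfun_apply (R' x) = (\<lambda>h. h \<bullet> z (R' x))" by (rule ext) (rule z)
    then show ?thesis unfolding gderiv_def using R'[of x] by simp
  qed
  then have gr: "gradient R = (\<lambda>x. z (R' x))" using gradient_eqI by blast
  show "GDERIV R x :> gradient R x" using gd gr by simp
  have "bounded_linear z"
  proof (rule bounded_linear_intro[where K=1])
    show "z (a + b) = z a + z b" for a b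
      by (rule z_eq) (simp only: blinfun.add_left inner_add_right z[symmetric])
    show "z (s *\<^sub>R a) = s *\<^sub>R z a" for s a
      by (rule z_eq) (simp only: blinfun.scaleR_left inner_scaleR_right z[symmetric] real_scaleR_def)
    show "norm (z a) \<le> norm a * 1" for a
    proof (cases "z a = 0")
      case False
      have "norm (z a) * norm (z a) = blinfun_apply a (z a)"
        by (simp add: z power2_norm_eq_inner[symmetric] power2_eq_square)
      also have "\<dots> \<le> norm a * norm (z a)" using norm_blinfun[of a "z a"] by simp
      finally show ?thesis using False by simp
    qed simp
  qed
  then have "(gradient R has_derivative (\<lambda>h. z (R'' x h))) (at x)"
    unfolding gr using bounded_linear.has_derivative R'' by blast
  then show "(gradient R has_derivative hessian_op R x) (at x)"
    unfolding hessian_op_def using frechet_derivative_at by metis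
qed

text \<open>The simple approximants converge in L1, hence so do their pairings with
  \<open>k\<close>. This determines the integral weakly without any separability of the target
  space.\<close>

lemma has_vec_integral_inner:
  fixes f :: "'a \<Rightarrow> 'f::real_inner"
  assumes "has_vec_integral M f y" and int: "integrable M (\<lambda>x. f x \<bullet> k)"
  shows "y \<bullet> k = (\<integral>x. f x \<bullet> k \<partial>M)"
proof -
  obtain s where s: "\<And>i. Bochner_Integration.simple_bochner_integrable M (s i)"
      "(\<lambda>i. \<integral>\<^sup>+x. ennreal (norm (f x - s i x)) \<partial>M) \<longlonglongrightarrow> 0"
      "(\<lambda>i. Bochner_Integration.simple_bochner_integral M (s i)) \<longlonglongrightarrow> y"
    using assms(1) unfolding has_vec_integral_def by blast
  have si: "Bochner_Integration.simple_bochner_integrable M (\<lambda>x. s i x \<bullet> k)" for i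
    using Bochner_Integration.simple_bochner_integrable_compose2[of "\<lambda>x y. x \<bullet> k", OF _ s(1) s(1)] by simp
  have eq: "Bochner_Integration.simple_bochner_integral M (s i) \<bullet> k = (\<integral>x. s i x \<bullet> k \<partial>M)" for i
    using Bochner_Integration.simple_bochner_integral_linear[of "\<lambda>x. x \<bullet> k", OF _ s(1)]
      Bochner_Integration.simple_bochner_integrable_eq_integral[OF si]
    by (metis bounded_linear.linear bounded_linear_inner_left)
  have sint: "integrable M (\<lambda>x. s i x \<bullet> k)" for i
    using Bochner_Integration.has_bochner_integral_simple_bochner_integrable[OF si] by (rule integrable.intros)
  have "(\<lambda>i. \<integral>x. s i x \<bullet> k \<partial>M) \<longlonglongrightarrow> (\<integral>x. f x \<bullet> k \<partial>M)"
  proof (rule tendsto_L1_int[OF sint int])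
    have "(\<lambda>i. ennreal (norm k) * (\<integral>\<^sup>+x. ennreal (norm (f x - s i x)) \<partial>M)) \<longlonglongrightarrow> ennreal (norm k) * 0"
      by (rule tendsto_mult_ennreal[OF tendsto_const s(2)]) simp
    moreover have "(\<integral>\<^sup>+x. ennreal (norm (s i x \<bullet> k - f x \<bullet> k)) \<partial>M)
        \<le> ennreal (norm k) * (\<integral>\<^sup>+x. ennreal (norm (f x - s i x)) \<partial>M)" for i
    proof -
      have "(\<lambda>x. ennreal (norm (f x - s i x))) \<in> borel_measurable M"
      proof -
        have 1: "f \<in> borel_measurable M" using assms(1) unfolding has_vec_integral_def by blast
        have sf: "simple_function M (s i)" using s(1) by (auto elim: Bochner_Integration.simple_bochner_integrable.cases)
        have "(\<lambda>x. norm (f x - s i x)) \<in> borel_measurable M"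
        proof (rule borel_measurable_iff_less[THEN iffD2], rule allI)
          fix a
          \<comment> \<open>In a non-separable space a difference of measurable maps need not be
            measurable. Here \<open>s i\<close> has finitely many values, so the set splits into
            finitely many pieces on which \<open>s i\<close> is constant.\<close>
          have "{w \<in> space M. norm (f w - s i w) < a} =
              (\<Union>y\<in>s i ` space M. (f -` ball y a \<inter> space M) \<inter> (s i -` {y} \<inter> space M))"
            by (auto simp: dist_norm norm_minus_commute)
          also have "\<dots> \<in> sets M"
          proof (rule sets.finite_UN)
            show "finite (s i ` space M)" using sf by (simp add: simple_function_def)
            fix y assume "y \<in> s i ` space M"
            then have "s i -` {y} \<inter> space M \<in> sets M" using sf by (auto simp: simple_function_def)
            moreover have "f -` ball y a \<inter> space M \<in> sets M"
              using 1 by (rule measurable_sets) simp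
            ultimately show "f -` ball y a \<inter> space M \<inter> (s i -` {y} \<inter> space M) \<in> sets M" by blast
          qed
          finally show "{w \<in> space M. norm (f w - s i w) < a} \<in> sets M" .
        qed
        then show ?thesis by measurable
      qed
      then have "ennreal (norm k) * (\<integral>\<^sup>+x. ennreal (norm (f x - s i x)) \<partial>M)
        = (\<integral>\<^sup>+x. ennreal (norm k) * ennreal (norm (f x - s i x)) \<partial>M)"
        by (rule nn_integral_cmult[symmetric])
      moreover have "(\<integral>\<^sup>+x. ennreal (norm (s i x \<bullet> k - f x \<bullet> k)) \<partial>M) \<le>
          (\<integral>\<^sup>+x. ennreal (norm k) * ennreal (norm (f x - s i x)) \<partial>M)"
        by (intro nn_integral_mono)
           (use Cauchy_Schwarz_ineq2[of "s i _ - f _" k] in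
             \<open>auto simp: ennreal_mult[symmetric] inner_diff_left[symmetric] norm_minus_commute mult.commute intro!: ennreal_leI\<close>)
      ultimately show ?thesis by simp
    qed
    ultimately show "(\<lambda>i. \<integral>\<^sup>+x. ennreal (norm (s i x \<bullet> k - f x \<bullet> k)) \<partial>M) \<longlonglongrightarrow> 0"
      using tendsto_sandwich[OF _ _ tendsto_const, of 0 "\<lambda>i. \<integral>\<^sup>+x. ennreal (norm (s i x \<bullet> k - f x \<bullet> k)) \<partial>M" sequentially
        "\<lambda>i. ennreal (norm k) * (\<integral>\<^sup>+x. ennreal (norm (f x - s i x)) \<partial>M)"] by simp
  qed
  moreover have "(\<lambda>i. \<integral>x. s i x \<bullet> k \<partial>M) \<longlonglongrightarrow> y \<bullet> k"
    using tendsto_inner[OF s(3) tendsto_const, of k] by (simp add: eq)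
  ultimately show ?thesis using LIMSEQ_unique by blast
qed

lemma finite_borel_measuresD:
  assumes "\<nu> \<in> finite_borel_measures"
  shows "finite_measure \<nu>" "sets \<nu> = sets borel" "space \<nu> = UNIV"
  using assms sets_eq_imp_space_eq[of \<nu> borel] unfolding finite_borel_measures_def by auto

lemma integrable_continuous_compact:
  fixes f :: "'a::topological_space \<Rightarrow> real"
  assumes "compact (UNIV :: 'a set)" "\<nu> \<in> finite_borel_measures" "continuous_on UNIV f"
  shows "integrable \<nu> f"
proof -
  interpret finite_measure \<nu> using finite_borel_measuresD[OF assms(2)] by simp
  have "bounded (range f)" using assms compact_continuous_image compact_imp_bounded by blast
  then obtain B where "\<And>x. norm (f x) \<le> B" by (auto simp: bounded_iff)
  moreover have "f \<in> borel_measurable \<nu>"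
    using borel_measurable_continuous_onI[OF assms(3)] finite_borel_measuresD[OF assms(2)]
      measurable_cong_sets by blast
  ultimately show ?thesis by (intro integrable_const_bound) auto
qed

text \<open>\<open>vec_integral\<close> is a definite description, so existence must be shown. Riesz
  applied to the scalar integrals gives a candidate \<open>y\<close>; total boundedness of the
  compact range gives uniformly close simple functions, and their integrals converge to
  \<open>y\<close> in norm.\<close>

lemma vec_integral_inner:
  fixes f :: "'a::topological_space \<Rightarrow> 'f::{real_inner,complete_space}"
  assumes cpt: "compact (UNIV :: 'a set)" and nu: "\<nu> \<in> finite_borel_measures"
    and cont: "continuous_on UNIV f"
  shows "vec_integral \<nu> f \<bullet> k = (\<integral>x. f x \<bullet> k \<partial>\<nu>)"
proof -
  note fb = finite_borel_measuresD[OF nu]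
  interpret finite_measure \<nu> by fact
  have int: "integrable \<nu> (\<lambda>x. f x \<bullet> k)" for k
    by (intro integrable_continuous_compact[OF cpt nu] continuous_intros cont)
  have "bounded (range f)" using assms compact_continuous_image compact_imp_bounded by blast
  then obtain B where B: "\<And>x. norm (f x) \<le> B" by (auto simp: bounded_iff)
  have "bounded_linear (\<lambda>k. \<integral>x. f x \<bullet> k \<partial>\<nu>)"
  proof (rule bounded_linear_intro[where K="B * measure \<nu> UNIV"])
    fix k
    have "\<bar>\<integral>x. f x \<bullet> k \<partial>\<nu>\<bar> \<le> (\<integral>x. \<bar>f x \<bullet> k\<bar> \<partial>\<nu>)" by (rule integral_abs_bound)
    also have "\<dots> \<le> (\<integral>x. B * norm k \<partial>\<nu>)"
      by (intro integral_mono integrable_abs int integrable_const)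
         (meson Cauchy_Schwarz_ineq2 B mult_right_mono norm_ge_zero order_trans)
    finally show "norm (\<integral>x. f x \<bullet> k \<partial>\<nu>) \<le> norm k * (B * measure \<nu> UNIV)"
      using fb by (simp add: algebra_simps)
  qed (simp_all add: inner_add_right int)
  then obtain y where y: "\<And>k. (\<integral>x. f x \<bullet> k \<partial>\<nu>) = k \<bullet> y" using riesz_representation by blast
  have meas: "f \<in> borel_measurable \<nu>"
    using borel_measurable_continuous_onI[OF cont] fb measurable_cong_sets by blast
  have "\<exists>s. Bochner_Integration.simple_bochner_integrable \<nu> s \<and> (\<forall>x. norm (f x - s x) \<le> e)" if "e > 0" for e
  proof -
    have "compact (range f)" using cpt cont compact_continuous_image by blast
    then obtain C where C: "finite C" "range f \<subseteq> (\<Union>c\<in>C. ball c e)"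
      using \<open>e > 0\<close> unfolding compact_eq_totally_bounded by blast
    then obtain cs where cs: "set cs = C" using finite_list by blast
    \<comment> \<open>The least index of a ball containing \<open>f x\<close> is a measurable choice
      of a centre.\<close>
    define I where "I x = (LEAST i. f x \<in> ball (cs ! i) e)" for x
    have ex: "\<exists>i<length cs. f x \<in> ball (cs ! i) e" for x
    proof -
      have "f x \<in> (\<Union>c\<in>C. ball c e)" using C(2) by blast
      then show ?thesis unfolding cs[symmetric] by (auto simp: in_set_conv_nth)
    qed
    then have I: "f x \<in> ball (cs ! I x) e" for x unfolding I_def 
      using LeastI_ex[of "\<lambda>i. f x \<in> ball (cs ! i) e"] ex[of x] by blast
    have Il: "I x < length cs" for x
      using ex[of x] unfolding I_def by (meson Least_le le_less_trans)
    have [measurable]: "I \<in> measurable \<nu> (count_space UNIV)"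
      unfolding I_def
    proof (rule measurable_Least)
      fix i
      have "{x \<in> space \<nu>. f x \<in> ball (cs ! i) e} \<in> sets \<nu>"
        using measurable_sets[OF meas, of "ball (cs ! i) e"]
        by (simp add: vimage_def Collect_conj_eq Int_commute)
      then show "Measurable.pred \<nu> (\<lambda>x. f x \<in> ball (cs ! i) e)" by (simp add: pred_def)
    qed
    have "simple_function \<nu> I"
      using Il by (auto simp: simple_function_def intro!: finite_subset[of "I ` space \<nu>" "{..<length cs}"])
    then have sf: "simple_function \<nu> (\<lambda>x. cs ! I x)" by (rule simple_function_compose1)
    have "Bochner_Integration.simple_bochner_integrable \<nu> (\<lambda>x. cs ! I x)"
      by (rule Bochner_Integration.simple_bochner_integrable.intros[OF sf]) (simp add: emeasure_eq_measure)
    moreover have "norm (f x - cs ! I x) \<le> e" for x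
      using I[of x] by (simp add: dist_norm norm_minus_commute)
    ultimately show ?thesis by blast
  qed
  then have "\<forall>n. \<exists>s. Bochner_Integration.simple_bochner_integrable \<nu> s \<and> (\<forall>x. norm (f x - s x) \<le> inverse (real (Suc n)))"
    by simp
  then obtain s where s: "\<And>n. Bochner_Integration.simple_bochner_integrable \<nu> (s n)"
      "\<And>n x. norm (f x - s n x) \<le> inverse (real (Suc n))" by metis
  have lim1: "(\<lambda>i. \<integral>\<^sup>+x. ennreal (norm (f x - s i x)) \<partial>\<nu>) \<longlonglongrightarrow> 0"
  proof -
    have "(\<integral>\<^sup>+x. ennreal (norm (f x - s i x)) \<partial>\<nu>) \<le> ennreal (inverse (real (Suc i)) * measure \<nu> UNIV)" for i
    proof -
      have "(\<integral>\<^sup>+x. ennreal (norm (f x - s i x)) \<partial>\<nu>) \<le> (\<integral>\<^sup>+x. ennreal (inverse (real (Suc i))) \<partial>\<nu>)"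
        by (intro nn_integral_mono ennreal_leI s)
      then show ?thesis by (simp add: emeasure_eq_measure fb ennreal_mult)
    qed
    moreover have "(\<lambda>i. ennreal (inverse (real (Suc i)) * measure \<nu> UNIV)) \<longlonglongrightarrow> ennreal (0 * measure \<nu> UNIV)"
      by (intro tendsto_ennrealI tendsto_intros LIMSEQ_inverse_real_of_nat)
    ultimately show ?thesis
      using tendsto_sandwich[OF _ _ tendsto_const, of 0 "\<lambda>i. \<integral>\<^sup>+x. ennreal (norm (f x - s i x)) \<partial>\<nu>" sequentially
        "\<lambda>i. ennreal (inverse (real (Suc i)) * measure \<nu> UNIV)"] by simp
  qed
  have lim2: "(\<lambda>i. Bochner_Integration.simple_bochner_integral \<nu> (s i)) \<longlonglongrightarrow> y"
  proof -
    have "norm (Bochner_Integration.simple_bochner_integral \<nu> (s i) - y) \<le> inverse (real (Suc i)) * measure \<nu> UNIV" for i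
    proof -
      \<comment> \<open>Pairing with the difference \<open>d\<close> itself turns the weak
        identities into a norm bound.\<close>
      define d where "d = Bochner_Integration.simple_bochner_integral \<nu> (s i) - y"
      have si: "Bochner_Integration.simple_bochner_integrable \<nu> (\<lambda>x. s i x \<bullet> d)"
        using Bochner_Integration.simple_bochner_integrable_compose2[of "\<lambda>x y. x \<bullet> d", OF _ s(1) s(1)] by simp
      have "Bochner_Integration.simple_bochner_integral \<nu> (s i) \<bullet> d = (\<integral>x. s i x \<bullet> d \<partial>\<nu>)"
        using Bochner_Integration.simple_bochner_integral_linear[of "\<lambda>x. x \<bullet> d", OF _ s(1)]
          Bochner_Integration.simple_bochner_integrable_eq_integral[OF si]
        by (metis bounded_linear.linear bounded_linear_inner_left)
      moreover have sint: "integrable \<nu> (\<lambda>x. s i x \<bullet> d)"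
        using Bochner_Integration.has_bochner_integral_simple_bochner_integrable[OF si] by (rule integrable.intros)
      ultimately have "(\<integral>x. s i x \<bullet> d - f x \<bullet> d \<partial>\<nu>) =
          Bochner_Integration.simple_bochner_integral \<nu> (s i) \<bullet> d - d \<bullet> y"
        using y[of d] Bochner_Integration.integral_diff[OF sint int[of d]] by metis
      then have "d \<bullet> d = (\<integral>x. s i x \<bullet> d - f x \<bullet> d \<partial>\<nu>)"
        by (metis d_def inner_commute inner_diff_left)
      also have "\<dots> \<le> (\<integral>x. inverse (real (Suc i)) * norm d \<partial>\<nu>)"
      proof (rule integral_mono)
        show "integrable \<nu> (\<lambda>x. s i x \<bullet> d - f x \<bullet> d)" using sint int by simp
        show "integrable \<nu> (\<lambda>x. inverse (real (Suc i)) * norm d)" by (rule integrable_const)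
        fix x
        have "s i x \<bullet> d - f x \<bullet> d \<le> norm (s i x - f x) * norm d"
          by (simp add: inner_diff_left[symmetric] norm_cauchy_schwarz)
        also have "\<dots> \<le> inverse (real (Suc i)) * norm d"
          using s(2)[of x i] by (intro mult_right_mono) (simp_all add: norm_minus_commute)
        finally show "s i x \<bullet> d - f x \<bullet> d \<le> inverse (real (Suc i)) * norm d" .
      qed
      also have "\<dots> = (inverse (real (Suc i)) * measure \<nu> UNIV) * norm d" using fb by simp
      finally have "norm d * norm d \<le> (inverse (real (Suc i)) * measure \<nu> UNIV) * norm d"
        by (simp add: power2_norm_eq_inner[symmetric] power2_eq_square)
      then show ?thesis unfolding d_def[symmetric]
        by (cases "norm d = 0") (auto simp: mult_le_cancel_right)
    qed
    moreover have "(\<lambda>i. inverse (real (Suc i)) * measure \<nu> UNIV) \<longlonglongrightarrow> 0 * measure \<nu> UNIV"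
      by (intro tendsto_intros LIMSEQ_inverse_real_of_nat)
    ultimately have "(\<lambda>i. Bochner_Integration.simple_bochner_integral \<nu> (s i) - y) \<longlonglongrightarrow> 0"
      using Lim_null_comparison[where g="\<lambda>i. inverse (real (Suc i)) * measure \<nu> UNIV" and net=sequentially
         and f="\<lambda>i. Bochner_Integration.simple_bochner_integral \<nu> (s i) - y"] by simp
    then show ?thesis by (simp add: LIM_zero_iff)
  qed
  have has: "has_vec_integral \<nu> f y"
    unfolding has_vec_integral_def using meas s(1) lim1 lim2 by blast
  have "z = y" if "has_vec_integral \<nu> f z" for z
  proof -
    have "z \<bullet> (z - y) = y \<bullet> (z - y)"
      using has_vec_integral_inner[OF that int] has_vec_integral_inner[OF has int] by metis
    then have "(z - y) \<bullet> (z - y) = 0" by (simp add: inner_diff_left)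
    then show ?thesis by simp
  qed
  then have "vec_integral \<nu> f = y" unfolding vec_integral_def by (rule the_equality[where P="has_vec_integral \<nu> f", OF has])
  then show ?thesis using y by (simp add: inner_commute)
qed

text \<open>\<open>measure_of\<close> returns the intended values only for a countably additive set
  function. As the image of a weighted point measure it is one, and integrals become finite
  sums.\<close>

lemma sparse_measure_eq_distr:
  "sparse_measure r p = distr (point_measure UNIV (\<lambda>i. ennreal ((r i)\<^sup>2))) borel (p :: 'm::finite \<Rightarrow> 'a::topological_space)"
proof -
  have "(\<Sum>i\<in>UNIV. ennreal ((r i)\<^sup>2) * indicator B (p i)) =
      emeasure (point_measure UNIV (\<lambda>i. ennreal ((r i)\<^sup>2))) (p -` B \<inter> space (point_measure UNIV (\<lambda>i. ennreal ((r i)\<^sup>2))))" for B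
  proof -
    have "(\<Sum>i\<in>UNIV. ennreal ((r i)\<^sup>2) * indicator B (p i)) = (\<Sum>i\<in>UNIV. if i \<in> p -` B then ennreal ((r i)\<^sup>2) else 0)"
      by (intro sum.cong) (auto simp: indicator_def)
    also have "\<dots> = (\<Sum>i\<in>p -` B. ennreal ((r i)\<^sup>2))"
      using sum.inter_restrict[of UNIV "\<lambda>i. ennreal ((r i)\<^sup>2)" "p -` B"] by simp
    finally show ?thesis by (simp add: emeasure_point_measure_finite space_point_measure)
  qed
  then show ?thesis unfolding sparse_measure_def distr_def by simp
qed

lemma sparse_measure:
  fixes p :: "'m::finite \<Rightarrow> 'a::topological_space" and g :: "'a \<Rightarrow> real"
  shows "sparse_measure r p \<in> finite_borel_measures"
    and "measure (sparse_measure r p) UNIV = (\<Sum>i\<in>UNIV. (r i)\<^sup>2)"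
    and "continuous_on UNIV g \<Longrightarrow> (\<integral>x. g x \<partial>sparse_measure r p) = (\<Sum>i\<in>UNIV. (r i)\<^sup>2 * g (p i))"
proof -
  have m: "p \<in> measurable (point_measure UNIV (\<lambda>i. ennreal ((r i)\<^sup>2))) borel"
    by (simp add: measurable_point_measure_eq1)
  have e: "emeasure (sparse_measure r p) UNIV = ennreal (\<Sum>i\<in>UNIV. (r i)\<^sup>2)"
    unfolding sparse_measure_eq_distr using m
    by (simp add: emeasure_distr space_point_measure emeasure_point_measure_finite sum_ennreal)
  have sp: "sets (sparse_measure r p) = sets borel" "space (sparse_measure r p) = UNIV"
    unfolding sparse_measure_eq_distr by simp_all
  show "sparse_measure r p \<in> finite_borel_measures"
    unfolding finite_borel_measures_def using sp e by (auto intro!: finite_measureI)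
  show "measure (sparse_measure r p) UNIV = (\<Sum>i\<in>UNIV. (r i)\<^sup>2)"
    using e by (simp add: measure_def sum_nonneg)
  show "(\<integral>x. g x \<partial>sparse_measure r p) = (\<Sum>i\<in>UNIV. (r i)\<^sup>2 * g (p i))" if "continuous_on UNIV g"
  proof -
    have "(\<integral>x. g x \<partial>sparse_measure r p) = (\<integral>i. g (p i) \<partial>point_measure UNIV (\<lambda>i. ennreal ((r i)\<^sup>2)))"
      unfolding sparse_measure_eq_distr
      by (rule integral_distr[OF m borel_measurable_continuous_onI[OF that]])
    also have "\<dots> = (\<Sum>i\<in>UNIV. (r i)\<^sup>2 * g (p i))"
      by (subst lebesgue_integral_point_measure_finite) auto
    finally show ?thesis .
  qed
qed

section \<open>Gradient domination near a sparse minimizer\<close>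

text \<open>Convexity bounds the difference quotients along the segment from \<open>x\<close> to
  \<open>y\<close> by \<open>R y - R x\<close>; the directional derivative is their limit from the
  right.\<close>

lemma convex_gderiv_tangent:
  fixes R :: "'f::real_inner \<Rightarrow> real"
  assumes "convex_on UNIV R" "GDERIV R x :> D"
  shows "R y \<ge> R x + D \<bullet> (y - x)"
proof -
  define g where "g t = R (x + t *\<^sub>R (y - x))" for t
  have "((\<lambda>t. x + t *\<^sub>R (y - x)) has_derivative (\<lambda>t. t *\<^sub>R (y - x))) (at 0)"
    by (auto intro!: derivative_eq_intros)
  then have "((R \<circ> (\<lambda>t. x + t *\<^sub>R (y - x))) has_derivative ((\<lambda>h. h \<bullet> D) \<circ> (\<lambda>t. t *\<^sub>R (y - x)))) (at 0)"
    by (rule diff_chain_at) (use assms(2) in \<open>simp add: gderiv_def\<close>)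
  then have "(g has_real_derivative (D \<bullet> (y - x))) (at 0)"
    
    unfolding g_def has_field_derivative_def comp_def
    by (simp add: inner_commute mult_commute_abs )
  then have lim: "((\<lambda>t. (g t - g 0) / t) \<longlongrightarrow> D \<bullet> (y - x)) (at_right 0)"
    unfolding has_field_derivative_iff by (auto intro: tendsto_mono at_le)
  have "g t \<le> (1 - t) * R x + t * R y" if "0 \<le> t" "t \<le> 1" for t
  proof -
    have "x + t *\<^sub>R (y - x) = (1 - t) *\<^sub>R x + t *\<^sub>R y" by (simp add: algebra_simps)
    then show ?thesis unfolding g_def using convex_onD[OF assms(1), of t x y] that by simp
  qed
  then have "(g t - g 0) / t \<le> R y - R x" if "0 < t" "t < 1" for t
    using that by (simp add: field_simps) (simp add: g_def algebra_simps)
  then have "eventually (\<lambda>t. (g t - g 0) / t \<le> R y - R x) (at_right 0)"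
    unfolding eventually_at_right_field by (intro exI[of _ 1]) auto
  then have "D \<bullet> (y - x) \<le> R y - R x"
    by (intro tendsto_upperbound[OF lim]) auto
  then show ?thesis by simp
qed

text \<open>Pointwise positivity of \<open>H\<close> alone gives no uniform bound in infinite
  dimension. Composed with the injective \<open>V\<close> it is a positive continuous function on a
  compact unit sphere, and its minimum there scales quadratically.\<close>

lemma quadratic_form_coercive:
  fixes V :: "'x::euclidean_space \<Rightarrow> 'f::real_inner"
  assumes V: "linear V" and inj: "\<And>x. V x = 0 \<Longrightarrow> x = 0"
    and H: "bounded_linear H" and pos: "\<And>h. h \<noteq> 0 \<Longrightarrow> h \<bullet> H h > 0"
  obtains k where "k > 0" "\<And>x. k * (norm x)\<^sup>2 \<le> V x \<bullet> H (V x)"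
proof -
  interpret V: bounded_linear V using V by (simp add: linear_conv_bounded_linear)
  interpret H: bounded_linear H by fact
  let ?S = "sphere (0::'x) 1"
  have "continuous_on ?S (\<lambda>x. V x \<bullet> H (V x))"
    by (intro continuous_intros V.continuous_on H.continuous_on)
  moreover have "?S \<noteq> {}"
    by simp
  ultimately have "\<exists>z\<in>?S. \<forall>x\<in>?S. V z \<bullet> H (V z) \<le> V x \<bullet> H (V x)"
    by (intro continuous_attains_inf) auto
  then obtain z where z: "z \<in> ?S" "\<And>x. x \<in> ?S \<Longrightarrow> V z \<bullet> H (V z) \<le> V x \<bullet> H (V x)"
    by blast
  have "z \<noteq> 0" using z(1) by auto
  then have p: "V z \<bullet> H (V z) > 0" using inj pos by blast
  have "V z \<bullet> H (V z) * (norm x)\<^sup>2 \<le> V x \<bullet> H (V x)" for x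
  proof (cases "x = 0")
    case False
    define y where "y = (1 / norm x) *\<^sub>R x"
    have "y \<in> ?S" using False by (simp add: y_def)
    moreover have "x = norm x *\<^sub>R y" using False by (simp add: y_def)
    then have "V x \<bullet> H (V x) = (V y \<bullet> H (V y)) * (norm x)\<^sup>2"
      by (metis (no_types, lifting) V.scaleR H.scaleR inner_scaleR_left inner_scaleR_right mult.assoc mult.commute power2_eq_square)
    ultimately show ?thesis using z(2) by (simp add: mult_right_mono)
  qed (simp add: V.zero H.zero)
  then show ?thesis using that p by blast
qed

lemma has_derivative_approx:
  fixes f' :: "'f::real_normed_vector \<Rightarrow> 'g::real_normed_vector"
  assumes "(f' has_derivative H) (at x)" "\<eta> > 0"
  obtains \<delta> where "\<delta> > 0" "\<And>h. norm h \<le> \<delta> \<Longrightarrow> norm (f' (x + h) - f' x - H h) \<le> \<eta> * norm h"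
proof -
  obtain d where d: "d > 0" "\<And>y. norm (y - x) < d \<Longrightarrow> norm (f' y - f' x - H (y - x)) \<le> \<eta> * norm (y - x)"
    using assms unfolding has_derivative_at_alt by blast
  have "norm (f' (x + h) - f' x - H h) \<le> \<eta> * norm h" if "norm h \<le> d / 2" for h
    using d(2)[of "x + h"] that d(1) by simp
  then show ?thesis using that[of "d/2"] d(1) by simp
qed

text \<open>
  Near the \<open>i\<close>-th atom, \<open>u i\<close> is the chart on \<open>N i\<close>, \<open>P i\<close> and \<open>L i\<close> are the value and the differential of
  \<open>\<phi>\<close> there, and \<open>\<zeta> i p\<close> is the radial derivative of \<open>\<phi>\<close> at \<open>p\<close>, that is, the differential at \<open>p\<close> applied
  to \<open>u i p\<close>. \<open>S g p\<close> stands for the squared norm of the gradient of \<open>\<langle>\<phi>, g\<rangle> + lam\<close> at \<open>p\<close>; all that is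
  used of it is the Young inequality \<open>S_near\<close> for the pairing with the radial field.
\<close>

locale sparse_landscape =
  fixes \<phi> :: "'a::topological_space \<Rightarrow> 'f::{real_inner,complete_space}"
    and R :: "'f \<Rightarrow> real" and R' :: "'f \<Rightarrow> 'f" and H :: "'f \<Rightarrow> 'f" and lam :: real
    and r :: "'m::finite \<Rightarrow> real"
    and N :: "'m \<Rightarrow> 'a set" and u :: "'m \<Rightarrow> 'a \<Rightarrow> 'e::euclidean_space"
    and P :: "'m \<Rightarrow> 'f" and L :: "'m \<Rightarrow> 'e \<Rightarrow> 'f" and \<zeta> :: "'m \<Rightarrow> 'a \<Rightarrow> 'f"
    and S :: "'f \<Rightarrow> 'a \<Rightarrow> real" and C c \<Lambda> :: real and fs :: 'f
  assumes cpt: "compact (UNIV :: 'a set)" and cont_\<phi>: "continuous_on UNIV \<phi>"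
    and r_pos: "\<And>i. r i > 0"
    and C: "C > 0" and c: "c > 0" and \<Lambda>: "\<Lambda> > 0"
    and N_borel: "\<And>i. N i \<in> sets borel" and N_disj: "\<And>i j. i \<noteq> j \<Longrightarrow> N i \<inter> N j = {}"
    and u_meas: "\<And>i. (\<lambda>p. indicator (N i) p *\<^sub>R u i p) \<in> borel_measurable borel"
    and u_le: "\<And>i p. p \<in> N i \<Longrightarrow> norm (u i p) \<le> 1"
    and L: "\<And>i. linear (L i)"
    and \<phi>_bound: "\<And>p. norm (\<phi> p) \<le> C"
    and \<phi>_lip: "\<And>i p. p \<in> N i \<Longrightarrow> norm (\<phi> p - P i) \<le> C * norm (u i p)"
    and \<phi>_taylor: "\<And>i p. p \<in> N i \<Longrightarrow> norm (\<phi> p - P i - L i (u i p)) \<le> C * (norm (u i p))\<^sup>2"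
    and \<zeta>_taylor: "\<And>i p. p \<in> N i \<Longrightarrow> norm (\<zeta> i p - L i (u i p)) \<le> C * (norm (u i p))\<^sup>2"
    and fs: "fs = (\<Sum>i\<in>UNIV. (r i)\<^sup>2 *\<^sub>R P i)"
    and R': "\<And>x. GDERIV R x :> R' x" and conv: "convex_on UNIV R"
    and H: "(R' has_derivative H) (at fs)" and H_pos: "\<And>h. h \<noteq> 0 \<Longrightarrow> h \<bullet> H h > 0"
    and indep: "\<And>a b. (\<Sum>i\<in>UNIV. a i *\<^sub>R P i + L i (b i)) = 0 \<Longrightarrow> \<forall>i. a i = 0 \<and> b i = 0"
    and P_opt: "\<And>i. P i \<bullet> R' fs + lam = 0"
    and D_far: "\<And>p. p \<notin> (\<Union>i. N i) \<Longrightarrow> \<phi> p \<bullet> R' fs + lam \<ge> c"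
    and D_upper: "\<And>p. \<phi> p \<bullet> R' fs + lam \<le> C"
    and D_near: "\<And>i p. p \<in> N i \<Longrightarrow> \<phi> p \<bullet> R' fs + lam \<ge> c * (norm (u i p))\<^sup>2"
    and D_near_upper: "\<And>i p. p \<in> N i \<Longrightarrow> \<phi> p \<bullet> R' fs + lam \<le> C * (norm (u i p))\<^sup>2"
    and \<zeta>_near: "\<And>i p. p \<in> N i \<Longrightarrow> \<zeta> i p \<bullet> R' fs \<ge> c * (norm (u i p))\<^sup>2"
    and S_nonneg: "\<And>g p. S g p \<ge> 0" and S_cont: "\<And>g. continuous_on UNIV (S g)"
    and S_near: "\<And>i p g M. p \<in> N i \<Longrightarrow> M > 0 \<Longrightarrow>
        \<zeta> i p \<bullet> g \<le> (M / 2) * S g p + \<Lambda> / (2 * M) * (norm (u i p))\<^sup>2"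
begin

definition "far = - (\<Union>i. N i)"
definition "D p = \<phi> p \<bullet> R' fs + lam"
definition V :: "(real \<times> 'e)^'m \<Rightarrow> 'f" where "V x = (\<Sum>i\<in>UNIV. fst (x $ i) *\<^sub>R P i + L i (snd (x $ i)))"
definition coef :: "'a measure \<Rightarrow> (real \<times> 'e)^'m" where
  "coef \<nu> = (\<chi> i. (measure \<nu> (N i) - (r i)\<^sup>2, \<integral>p. indicator (N i) p *\<^sub>R u i p \<partial>\<nu>))"
definition "spread \<nu> = (\<Sum>i\<in>UNIV. \<integral>p. indicator (N i) p * (norm (u i p))\<^sup>2 \<partial>\<nu>)"
definition "hh \<nu> = vec_integral \<nu> \<phi> - fs"
definition "w \<nu> = R' (vec_integral \<nu> \<phi>) - R' fs"
definition "gap \<nu> = objective \<phi> R lam \<nu> - (R fs + lam * (\<Sum>i\<in>UNIV. (r i)\<^sup>2))"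
text \<open>The squared gradient norm for \<alpha> = \<beta> = 1, once \<open>S\<close> is
  instantiated with the squared norm of the Riemannian gradient.\<close>

definition "energy \<nu> = (\<integral>p. 4 * \<bar>objective_deriv \<phi> R lam \<nu> p\<bar>\<^sup>2 + S (R' (vec_integral \<nu> \<phi>)) p \<partial>\<nu>)"
definition "bulk \<nu> = spread \<nu> + measure \<nu> far"

lemma linear_V: "linear V"
proof (rule linearI)
  show "V (x + y) = V x + V y" for x y
    unfolding V_def by (simp add: linear_add[OF L] scaleR_add_left sum.distrib)
  show "V (s *\<^sub>R x) = s *\<^sub>R V x" for s x
    unfolding V_def by (simp add: linear_scale[OF L] scaleR_sum_right scaleR_add_right)
qed

lemma V_inj: "V x = 0 \<Longrightarrow> x = 0"
  unfolding V_def by (drule indep) (simp add: vec_eq_iff prod_eq_iff)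

lemma sum_near: "p \<in> N i \<Longrightarrow> (\<Sum>j\<in>UNIV. indicator (N j) p * g j) = (g i :: real)"
proof -
  assume p: "p \<in> N i"
  have "(\<Sum>j\<in>UNIV. indicator (N j) p * g j) = (\<Sum>j\<in>UNIV. if j = i then g i else 0)"
    using p N_disj by (intro sum.cong) (auto simp: indicator_def)
  then show ?thesis by simp
qed

lemma sum_far: "p \<in> far \<Longrightarrow> (\<Sum>j\<in>UNIV. indicator (N j) p * g j) = (0 :: real)"
  by (intro sum.neutral) (auto simp: far_def)

lemma cases_near_far [case_names near far]:
  assumes "\<And>i. p \<in> N i \<Longrightarrow> p \<notin> far \<Longrightarrow> thesis" "p \<in> far \<Longrightarrow> thesis"
  shows thesis
  using assms unfolding far_def by blast

lemma far_borel: "far \<in> sets borel"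
  unfolding far_def using N_borel by auto

context
  fixes \<nu> :: "'a measure" assumes nu: "\<nu> \<in> finite_borel_measures"
begin

interpretation finite_measure \<nu> using finite_borel_measuresD[OF nu] by simp

lemma sets_nu [measurable_cong, simp]: "sets \<nu> = sets borel" and space_nu [simp]: "space \<nu> = UNIV"
  using finite_borel_measuresD[OF nu] by auto

lemma integrable_u: "integrable \<nu> (\<lambda>p. indicator (N i) p *\<^sub>R u i p)"
proof (rule integrable_const_bound[where B=1])
  show "(\<lambda>p. indicator (N i) p *\<^sub>R u i p) \<in> borel_measurable \<nu>"
    using u_meas[of i] measurable_cong_sets[OF sets_nu refl] by blast
qed (use u_le in \<open>auto simp: indicator_def\<close>)

lemma integrable_u2: "integrable \<nu> (\<lambda>p. indicator (N i) p * (norm (u i p))\<^sup>2)"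
proof (rule integrable_const_bound[where B=1])
  have 1: "(\<lambda>p. indicator (N i) p *\<^sub>R u i p) \<in> borel_measurable \<nu>"
    using integrable_u by (rule borel_measurable_integrable)
  have "(\<lambda>p. (norm (indicator (N i) p *\<^sub>R u i p))\<^sup>2) \<in> borel_measurable \<nu>"
    using 1 by measurable
  moreover have "(\<lambda>p. (norm (indicator (N i) p *\<^sub>R u i p))\<^sup>2) = (\<lambda>p. indicator (N i) p * (norm (u i p))\<^sup>2)"
    by (auto simp: indicator_def)
  ultimately show "(\<lambda>p. indicator (N i) p * (norm (u i p))\<^sup>2) \<in> borel_measurable \<nu>" by simp
qed (use u_le in \<open>auto simp: indicator_def abs_square_le_1\<close>)

text \<open>All comparison functions below have this shape: a quadratic model in \<open>u i\<close>
  on each \<open>N i\<close> and a constant on \<open>far\<close>. Such a function sees \<nu> only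
  through the masses, the first moments, \<open>spread\<close> and the far mass.\<close>

lemma split_integral:
  fixes \<alpha> :: "'m \<Rightarrow> real" and k :: 'f and \<gamma> d :: real
  defines "W \<equiv> \<lambda>p. (\<Sum>i\<in>UNIV. indicator (N i) p * (\<alpha> i + L i (u i p) \<bullet> k + \<gamma> * (norm (u i p))\<^sup>2)) + d * indicator far p"
  shows "integrable \<nu> W"
    and "integral\<^sup>L \<nu> W = (\<Sum>i\<in>UNIV. \<alpha> i * measure \<nu> (N i)) + (\<Sum>i\<in>UNIV. L i (snd (coef \<nu> $ i))) \<bullet> k
          + \<gamma> * spread \<nu> + d * measure \<nu> far"
proof -
  have bl: "bounded_linear (\<lambda>x. L i x \<bullet> k)" for i
    using L[of i] bounded_linear_compose[OF bounded_linear_inner_left, of "L i"]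
    by (simp add: linear_conv_bounded_linear)
  have N: "N i \<in> sets \<nu>" for i using N_borel by simp
  have h1: "has_bochner_integral \<nu> (\<lambda>p. indicator (N i) p * \<alpha> i) (\<alpha> i * measure \<nu> (N i))" for i
    using has_bochner_integral_mult_right[OF has_bochner_integral_real_indicator[OF N[of i]], of "\<alpha> i"]
    by (simp add: mult.commute emeasure_eq_measure)
  have h2: "has_bochner_integral \<nu> (\<lambda>p. indicator (N i) p * (L i (u i p) \<bullet> k)) (L i (snd (coef \<nu> $ i)) \<bullet> k)" for i
  proof -
    have "has_bochner_integral \<nu> (\<lambda>p. L i (indicator (N i) p *\<^sub>R u i p) \<bullet> k) (L i (snd (coef \<nu> $ i)) \<bullet> k)"
      using has_bochner_integral_bounded_linear[OF bl has_bochner_integral_integrable[OF integrable_u[of i]], of i]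
      by (simp add: coef_def)
    then show ?thesis by (simp add: linear_scale[OF L])
  qed
  have h3: "has_bochner_integral \<nu> (\<lambda>p. indicator (N i) p * (\<gamma> * (norm (u i p))\<^sup>2))
      (\<gamma> * (\<integral>p. indicator (N i) p * (norm (u i p))\<^sup>2 \<partial>\<nu>))" for i
    using has_bochner_integral_mult_right[OF has_bochner_integral_integrable[OF integrable_u2[of i]], of \<gamma>]
    by (simp add: algebra_simps)
  have h4: "has_bochner_integral \<nu> (\<lambda>p. d * indicator far p) (d * measure \<nu> far)"
    using has_bochner_integral_mult_right[OF has_bochner_integral_real_indicator[of far \<nu>], of d] far_borel
    by (simp add: emeasure_eq_measure)
  have "has_bochner_integral \<nu> W ((\<Sum>i\<in>UNIV. \<alpha> i * measure \<nu> (N i) + L i (snd (coef \<nu> $ i)) \<bullet> k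
      + \<gamma> * (\<integral>p. indicator (N i) p * (norm (u i p))\<^sup>2 \<partial>\<nu>)) + d * measure \<nu> far)"
    unfolding W_def distrib_left
    by (intro has_bochner_integral_add has_bochner_integral_sum h1 h2 h3 h4)
  then show "integrable \<nu> W" "integral\<^sup>L \<nu> W = (\<Sum>i\<in>UNIV. \<alpha> i * measure \<nu> (N i)) + (\<Sum>i\<in>UNIV. L i (snd (coef \<nu> $ i))) \<bullet> k
          + \<gamma> * spread \<nu> + d * measure \<nu> far"
    unfolding has_bochner_integral_iff spread_def
    by (simp_all add: sum.distrib inner_sum_left sum_distrib_left)
qed

lemma spread_nonneg: "spread \<nu> \<ge> 0" unfolding spread_def
  by (intro sum_nonneg Bochner_Integration.integral_nonneg) (auto simp: indicator_def)

lemma int_\<phi>: "integrable \<nu> (\<lambda>p. \<phi> p \<bullet> k)" "(\<integral>p. \<phi> p \<bullet> k \<partial>\<nu>) = vec_integral \<nu> \<phi> \<bullet> k"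
  using vec_integral_inner[OF cpt nu cont_\<phi>]
  by (auto intro!: integrable_continuous_compact[OF cpt nu] continuous_intros cont_\<phi>)

lemma V_coef_inner:
  "V (coef \<nu>) \<bullet> k = (\<Sum>i\<in>UNIV. (measure \<nu> (N i) - (r i)\<^sup>2) * (P i \<bullet> k)) + (\<Sum>i\<in>UNIV. L i (snd (coef \<nu> $ i))) \<bullet> k"
  unfolding V_def by (simp add: coef_def inner_sum_left inner_add_left sum.distrib)

text \<open>Since \<open>vec_integral\<close> is only accessible through inner products, the remainder is paired with itself.\<close>

lemma remainder_bound: "norm (hh \<nu> - V (coef \<nu>)) \<le> C * bulk \<nu>"
proof -
  define e where "e = hh \<nu> - V (coef \<nu>)"
  have "vec_integral \<nu> \<phi> \<bullet> e = (\<integral>p. \<phi> p \<bullet> e \<partial>\<nu>)" using int_\<phi> by simp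
  also have "\<dots> \<le> (\<integral>p. (\<Sum>i\<in>UNIV. indicator (N i) p * (P i \<bullet> e + L i (u i p) \<bullet> e + (C * norm e) * (norm (u i p))\<^sup>2))
      + (C * norm e) * indicator far p \<partial>\<nu>)"
  proof (rule integral_mono[OF int_\<phi>(1) split_integral(1)])
    fix p
    show "\<phi> p \<bullet> e \<le> (\<Sum>i\<in>UNIV. indicator (N i) p * (P i \<bullet> e + L i (u i p) \<bullet> e + (C * norm e) * (norm (u i p))\<^sup>2))
      + (C * norm e) * indicator far p"
    proof (cases p rule: cases_near_far)
      case (near i)
      have "\<phi> p \<bullet> e - P i \<bullet> e - L i (u i p) \<bullet> e = (\<phi> p - P i - L i (u i p)) \<bullet> e"
        by (simp add: inner_diff_left)
      also have "\<dots> \<le> norm (\<phi> p - P i - L i (u i p)) * norm e" by (rule norm_cauchy_schwarz)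
      also have "\<dots> \<le> C * (norm (u i p))\<^sup>2 * norm e" using \<phi>_taylor[OF near(1)] by (intro mult_right_mono) auto
      finally show ?thesis unfolding sum_near[OF near(1)] using near(2) by (simp add: algebra_simps)
    next
      case far
      have "\<phi> p \<bullet> e \<le> norm (\<phi> p) * norm e" by (rule norm_cauchy_schwarz)
      also have "\<dots> \<le> C * norm e" using \<phi>_bound by (intro mult_right_mono) auto
      finally show ?thesis unfolding sum_far[OF far] using far by simp
    qed
  qed
  also have "\<dots> = (\<Sum>i\<in>UNIV. (P i \<bullet> e) * measure \<nu> (N i)) + (\<Sum>i\<in>UNIV. L i (snd (coef \<nu> $ i))) \<bullet> e + C * norm e * bulk \<nu>"
    unfolding split_integral(2) bulk_def by (simp add: algebra_simps)
  \<comment> \<open>Writing the mass of \<open>N i\<close> as its defect plus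
    \<open>(r i)\<^sup>2\<close> splits the constant terms into the part of \<open>V\<close> and the
    part of \<open>fs\<close>.\<close>
  also have "\<dots> = V (coef \<nu>) \<bullet> e + fs \<bullet> e + C * norm e * bulk \<nu>"
    unfolding V_coef_inner fs by (simp add: inner_sum_left sum.distrib[symmetric] algebra_simps)
  finally have "e \<bullet> e \<le> C * norm e * bulk \<nu>"
    by (simp add: e_def hh_def inner_diff_left)
  then have "norm e * norm e \<le> (C * bulk \<nu>) * norm e"
    by (simp add: power2_norm_eq_inner[symmetric] power2_eq_square mult_ac)
  moreover have "C * bulk \<nu> \<ge> 0" using C spread_nonneg by (simp add: bulk_def)
  ultimately show ?thesis unfolding e_def[symmetric]
    by (cases "norm e = 0") (auto simp: mult_le_cancel_right)
qed

lemma int_D: "integrable \<nu> D" "integral\<^sup>L \<nu> D = vec_integral \<nu> \<phi> \<bullet> R' fs + lam * measure \<nu> UNIV"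
  unfolding D_def using int_\<phi> by simp_all

lemma int_D_lower: "c * bulk \<nu> \<le> integral\<^sup>L \<nu> D"
proof -
  \<comment> \<open>The vanishing terms only give the integrand the shape required by
    \<open>split_integral\<close>.\<close>
  have "c * bulk \<nu> = (\<integral>p. (\<Sum>i\<in>UNIV. indicator (N i) p * (0 + L i (u i p) \<bullet> 0 + c * (norm (u i p))\<^sup>2)) + c * indicator far p \<partial>\<nu>)"
    unfolding split_integral(2) bulk_def by (simp add: algebra_simps)
  also have "\<dots> \<le> integral\<^sup>L \<nu> D"
  proof (rule integral_mono[OF split_integral(1) int_D(1)])
    fix p show "(\<Sum>i\<in>UNIV. indicator (N i) p * (0 + L i (u i p) \<bullet> 0 + c * (norm (u i p))\<^sup>2)) + c * indicator far p \<le> D p"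
    proof (cases p rule: cases_near_far)
      case (near i)
      then show ?thesis unfolding sum_near[OF near(1)] using D_near[OF near(1)] by (simp add: D_def)
    next
      case far
      then show ?thesis unfolding sum_far[OF far] using D_far[of p] by (simp add: D_def) (simp add: far_def)
    qed
  qed
  finally show ?thesis .
qed

lemma int_D_upper: "integral\<^sup>L \<nu> D \<le> C * bulk \<nu>"
proof -
  have "integral\<^sup>L \<nu> D \<le> (\<integral>p. (\<Sum>i\<in>UNIV. indicator (N i) p * (0 + L i (u i p) \<bullet> 0 + C * (norm (u i p))\<^sup>2)) + C * indicator far p \<partial>\<nu>)"
  proof (rule integral_mono[OF int_D(1) split_integral(1)])
    fix p show "D p \<le> (\<Sum>i\<in>UNIV. indicator (N i) p * (0 + L i (u i p) \<bullet> 0 + C * (norm (u i p))\<^sup>2)) + C * indicator far p"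
    proof (cases p rule: cases_near_far)
      case (near i)
      then show ?thesis unfolding sum_near[OF near(1)] using D_near_upper[OF near(1)] by (simp add: D_def)
    next
      case far
      then show ?thesis unfolding sum_far[OF far] using D_upper[of p] by (simp add: D_def)
    qed
  qed
  also have "\<dots> = C * bulk \<nu>"
    unfolding split_integral(2) bulk_def by (simp add: algebra_simps)
  finally show ?thesis .
qed

text \<open>By \<open>P_opt\<close>, pairing \<open>R' fs\<close> with \<open>fs\<close> gives minus
  \<open>lam\<close> times the mass of the atoms, so the first-order part of the gap is exactly the
  integral of \<open>D\<close> and the rest is the Bregman divergence.\<close>

lemma gap_eq: "gap \<nu> = (R (fs + hh \<nu>) - R fs - R' fs \<bullet> hh \<nu>) + integral\<^sup>L \<nu> D"
proof -
  have "fs \<bullet> R' fs = (\<Sum>i\<in>UNIV. (r i)\<^sup>2 * (- lam))"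
  proof -
    have "P i \<bullet> R' fs = - lam" for i using P_opt[of i] by simp
    moreover have "fs \<bullet> R' fs = (\<Sum>i\<in>UNIV. (r i)\<^sup>2 * (P i \<bullet> R' fs))"
      by (subst (1) fs) (simp add: inner_sum_left)
    ultimately show ?thesis by simp
  qed
  then have "fs \<bullet> R' fs + lam * (\<Sum>i\<in>UNIV. (r i)\<^sup>2) = 0" by (simp add: sum_distrib_left sum_negf mult.commute)
  then show ?thesis unfolding gap_def int_D(2) objective_def
    by (simp add: hh_def inner_diff_right inner_commute[of "R' fs"] algebra_simps)
qed

lemma bulk_nonneg: "bulk \<nu> \<ge> 0"
  using spread_nonneg by (simp add: bulk_def)

text \<open>The tangent of \<open>R\<close> at a point \<open>fs + z\<close> with \<open>z\<close> small will show that a small gap forces small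
  coefficients, so no compactness of measures is needed.\<close>

lemma gap_lower: "c * bulk \<nu> + (R' (fs + z) - R' fs) \<bullet> (hh \<nu> - z) \<le> gap \<nu>"
proof -
  have "R (fs + hh \<nu>) \<ge> R (fs + z) + R' (fs + z) \<bullet> (hh \<nu> - z)"
    using convex_gderiv_tangent[OF conv R', of "fs + z" "fs + hh \<nu>"] by simp
  moreover have "R (fs + z) \<ge> R fs + R' fs \<bullet> z"
    using convex_gderiv_tangent[OF conv R', of fs "fs + z"] by simp
  ultimately show ?thesis using int_D_lower unfolding gap_eq
    by (simp add: inner_diff_left inner_diff_right)
qed

lemma gap_lower0: "c * bulk \<nu> \<le> gap \<nu>"
  using gap_lower[of 0] by simp

lemma gap_upper: "gap \<nu> \<le> C * bulk \<nu> + w \<nu> \<bullet> hh \<nu>"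
proof -
  have e: "fs + hh \<nu> = vec_integral \<nu> \<phi>" by (simp add: hh_def)
  have "R fs \<ge> R (fs + hh \<nu>) + R' (fs + hh \<nu>) \<bullet> (- hh \<nu>)"
    using convex_gderiv_tangent[OF conv R', of "fs + hh \<nu>" fs] by simp
  then show ?thesis using int_D_upper unfolding gap_eq w_def e by (simp add: inner_diff_left)
qed

text \<open>The test field is \<open>(A i, u i p)\<close> on \<open>N i\<close>; \<open>M\<close> is the parameter of Young's inequality.\<close>

lemma energy_lower:
  assumes M: "M > 0"
    and m: "\<And>i. measure \<nu> (N i) \<ge> (r i)\<^sup>2 / 2"
    and a_small: "\<And>i. C * \<bar>fst (coef \<nu> $ i)\<bar> \<le> c / 8 * measure \<nu> (N i)"
    and w_small: "C * norm (w \<nu>) \<le> c / 8"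
    and K: "\<And>i. 2 / (r i)\<^sup>2 \<le> K"
  shows "V (coef \<nu>) \<bullet> w \<nu> + (c / 2 - \<Lambda> / (2 * M)) * spread \<nu>
      - (C\<^sup>2 / c * (norm (w \<nu>))\<^sup>2 + 1 / (2 * M)) * K * (norm (coef \<nu>))\<^sup>2 + M * c\<^sup>2 / 8 * measure \<nu> far
      \<le> M / 2 * energy \<nu>"
proof -
  define a where "a i = fst (coef \<nu> $ i)" for i
  define m' where "m' i = measure \<nu> (N i)" for i
  \<comment> \<open>Constant on \<open>N i\<close> with integral \<open>a i\<close>, so that the
    pairing reproduces the coefficients of \<open>V\<close> exactly.\<close>
  define A where "A i = a i / m' i" for i
  \<comment> \<open>The price of \<open>(A i)\<^sup>2\<close>: the first term comes from completing
    the square in \<open>t5\<close>, the second from Young's inequality in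
    \<open>t1\<close>.\<close>
  define q where "q = C\<^sup>2 / c * (norm (w \<nu>))\<^sup>2 + 1 / (2 * M)"
  define J where "J p = objective_deriv \<phi> R lam \<nu> p" for p
  define g where "g = R' (vec_integral \<nu> \<phi>)"
  have grad: "gradient R x = R' x" for x using gradient_eqI[OF R'] .
  have J: "J p = \<phi> p \<bullet> g + lam" for p unfolding J_def objective_deriv_def grad g_def ..
  have g: "g = R' fs + w \<nu>" unfolding w_def g_def by simp
  have mpos: "m' i > 0" for i using m[of i] r_pos[of i] unfolding m'_def
    by (smt (verit) half_gt_zero zero_less_power)
  have CA: "C * \<bar>A i\<bar> \<le> c / 8" for i
    using a_small[of i] mpos[of i] unfolding A_def a_def m'_def by (simp add: field_simps abs_mult)
  have cont_J: "continuous_on UNIV J" unfolding J by (intro continuous_intros cont_\<phi>)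
  have int_E: "integrable \<nu> (\<lambda>p. M / 2 * (4 * \<bar>J p\<bar>\<^sup>2 + S g p))"
    by (intro integrable_continuous_compact[OF cpt nu] continuous_intros cont_J S_cont)
  let ?W = "\<lambda>p. (\<Sum>i\<in>UNIV. indicator (N i) p * ((A i * (P i \<bullet> w \<nu>) - q * (A i)\<^sup>2) + L i (u i p) \<bullet> w \<nu> + (c / 2 - \<Lambda> / (2 * M)) * (norm (u i p))\<^sup>2))
      + (M * c\<^sup>2 / 8) * indicator far p"
  have "integral\<^sup>L \<nu> ?W \<le> (\<integral>p. M / 2 * (4 * \<bar>J p\<bar>\<^sup>2 + S g p) \<partial>\<nu>)"
  proof (rule integral_mono[OF split_integral(1) int_E])
    fix p
    show "?W p \<le> M / 2 * (4 * \<bar>J p\<bar>\<^sup>2 + S g p)"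
    proof (cases p rule: cases_near_far)
      case (near i)
      define n where "n = norm (u i p)"
      define W where "W = norm (w \<nu>)"
      have n: "0 \<le> n" and W: "0 \<le> W" by (auto simp: n_def W_def)
      have t1: "A i * J p \<le> M / 2 * (J p)\<^sup>2 + (A i)\<^sup>2 / (2 * M)"
      proof -
        have "0 \<le> (M * J p - A i)\<^sup>2 / (2 * M)" using M by simp
        then show ?thesis using M by (simp add: power2_eq_square field_simps)
      qed
      have t2: "\<zeta> i p \<bullet> g \<le> (M / 2) * S g p + \<Lambda> / (2 * M) * n\<^sup>2"
        unfolding n_def by (rule S_near[OF near(1) M])
      \<comment> \<open>Budget for \<open>n\<^sup>2\<close>: \<open>\<zeta>_near\<close> supplies
        \<open>c\<close>; the losses are \<open>c / 8\<close> here, \<open>c / 8\<close> in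
        \<open>t4\<close> and \<open>c / 4\<close> in \<open>t5\<close>, which leaves
        \<open>c / 2\<close>.\<close>
      have t3: "A i * J p \<ge> A i * (P i \<bullet> w \<nu>) - (c / 8) * n\<^sup>2 - C * \<bar>A i\<bar> * n * W"
      proof -
        have "A i * J p = A i * (P i \<bullet> w \<nu>) + A i * D p + A i * ((\<phi> p - P i) \<bullet> w \<nu>)"
          unfolding J g D_def by (simp add: inner_add_right inner_diff_left algebra_simps)
        moreover have "\<bar>A i * D p\<bar> \<le> c / 8 * n\<^sup>2"
        proof -
          have "0 \<le> c * (norm (u i p))\<^sup>2" using c by simp
          then have "\<bar>D p\<bar> \<le> C * n\<^sup>2"
            using D_near[OF near(1)] D_near_upper[OF near(1)] unfolding D_def n_def by linarith
          then have "\<bar>A i * D p\<bar> \<le> \<bar>A i\<bar> * (C * n\<^sup>2)" unfolding abs_mult by (intro mult_left_mono) auto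
          also have "\<dots> \<le> c / 8 * n\<^sup>2" using mult_right_mono[OF CA[of i], of "n\<^sup>2"] by (simp add: mult_ac)
          finally show ?thesis .
        qed
        moreover have "\<bar>A i * ((\<phi> p - P i) \<bullet> w \<nu>)\<bar> \<le> \<bar>A i\<bar> * (C * n * W)"
        proof -
          have "\<bar>(\<phi> p - P i) \<bullet> w \<nu>\<bar> \<le> norm (\<phi> p - P i) * W" unfolding W_def by (rule Cauchy_Schwarz_ineq2)
          also have "\<dots> \<le> C * n * W" using \<phi>_lip[OF near(1)] W unfolding n_def by (intro mult_right_mono) auto
          finally show ?thesis unfolding abs_mult by (intro mult_left_mono) auto
        qed
        moreover have "\<bar>A i\<bar> * (C * n * W) = C * \<bar>A i\<bar> * n * W" by simp
        ultimately show ?thesis by linarith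
      qed
      have t4: "\<zeta> i p \<bullet> g \<ge> c * n\<^sup>2 + L i (u i p) \<bullet> w \<nu> - (c / 8) * n\<^sup>2"
      proof -
        have "\<zeta> i p \<bullet> g = \<zeta> i p \<bullet> R' fs + L i (u i p) \<bullet> w \<nu> + (\<zeta> i p - L i (u i p)) \<bullet> w \<nu>"
          unfolding g by (simp add: inner_add_right inner_diff_left)
        moreover have "\<bar>(\<zeta> i p - L i (u i p)) \<bullet> w \<nu>\<bar> \<le> (c / 8) * n\<^sup>2"
        proof -
          have "\<bar>(\<zeta> i p - L i (u i p)) \<bullet> w \<nu>\<bar> \<le> norm (\<zeta> i p - L i (u i p)) * W"
            unfolding W_def by (rule Cauchy_Schwarz_ineq2)
          also have "\<dots> \<le> (C * n\<^sup>2) * W"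
            using \<zeta>_taylor[OF near(1)] W unfolding n_def by (intro mult_right_mono) auto
          also have "\<dots> = (C * W) * n\<^sup>2" by simp
          also have "\<dots> \<le> (c / 8) * n\<^sup>2" using w_small unfolding W_def by (intro mult_right_mono) auto
          finally show ?thesis .
        qed
        ultimately show ?thesis using \<zeta>_near[OF near(1)] unfolding n_def by linarith
      qed
      have t5: "C * \<bar>A i\<bar> * n * W \<le> (c / 4) * n\<^sup>2 + C\<^sup>2 / c * W\<^sup>2 * (A i)\<^sup>2"
      proof -
        have "0 \<le> (c / 2 * n - C * \<bar>A i\<bar> * W)\<^sup>2 / c" using c by simp
        also have "\<dots> = (c / 4) * n\<^sup>2 + C\<^sup>2 / c * W\<^sup>2 * (A i)\<^sup>2 - C * \<bar>A i\<bar> * n * W"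
          using c by (simp add: power2_eq_square field_simps)
        finally show ?thesis by simp
      qed
      have "?W p = (A i * (P i \<bullet> w \<nu>) - q * (A i)\<^sup>2) + L i (u i p) \<bullet> w \<nu> + (c / 2 - \<Lambda> / (2 * M)) * n\<^sup>2"
        unfolding sum_near[OF near(1)] n_def using near(2) by simp
      also have "\<dots> = A i * (P i \<bullet> w \<nu>) + L i (u i p) \<bullet> w \<nu> + c / 2 * n\<^sup>2 - \<Lambda> / (2 * M) * n\<^sup>2
          - C\<^sup>2 / c * W\<^sup>2 * (A i)\<^sup>2 - (A i)\<^sup>2 / (2 * M)"
        unfolding q_def W_def by (simp add: algebra_simps)
      also have "\<dots> \<le> M / 2 * (J p)\<^sup>2 + (M / 2) * S g p"
        using t1 t2 t3 t4 t5 by linarith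
      also have "\<dots> \<le> M / 2 * (4 * \<bar>J p\<bar>\<^sup>2 + S g p)"
        using M by (simp add: algebra_simps)
      finally show ?thesis .
    next
      case far
      \<comment> \<open>Off the neighbourhoods \<open>D\<close> is at least \<open>c\<close> and
        \<open>w\<close> changes it by at most \<open>c / 8\<close>, so the value term of the energy
        alone suffices.\<close>
      have "\<bar>\<phi> p \<bullet> w \<nu>\<bar> \<le> norm (\<phi> p) * norm (w \<nu>)" by (rule Cauchy_Schwarz_ineq2)
      also have "\<dots> \<le> C * norm (w \<nu>)" using \<phi>_bound by (intro mult_right_mono) auto
      also have "\<dots> \<le> c / 8" by (rule w_small)
      finally have "J p \<ge> c / 2"
        using D_far[of p] far c unfolding J g far_def by (simp add: inner_add_right)
      then have "(c / 2)\<^sup>2 \<le> (J p)\<^sup>2" using c by (intro power_mono) auto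
      then have "c\<^sup>2 / 4 \<le> (J p)\<^sup>2" by (simp add: power_divide)
      then have "c\<^sup>2 / 4 \<le> 4 * \<bar>J p\<bar>\<^sup>2 + S g p"
        using S_nonneg[of g p] zero_le_power2[of "J p"] unfolding power2_abs by linarith
      then have "M / 2 * (c\<^sup>2 / 4) \<le> M / 2 * (4 * \<bar>J p\<bar>\<^sup>2 + S g p)"
        using M by (intro mult_left_mono) auto
      then show ?thesis unfolding sum_far[OF far] using far by simp
    qed
  qed
  also have "\<dots> = M / 2 * energy \<nu>"
    unfolding energy_def J_def g_def by simp
  finally have main: "(\<Sum>i\<in>UNIV. (A i * (P i \<bullet> w \<nu>) - q * (A i)\<^sup>2) * m' i) + (\<Sum>i\<in>UNIV. L i (snd (coef \<nu> $ i))) \<bullet> w \<nu>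
      + (c / 2 - \<Lambda> / (2 * M)) * spread \<nu> + M * c\<^sup>2 / 8 * measure \<nu> far \<le> M / 2 * energy \<nu>"
    unfolding split_integral(2) m'_def .
  \<comment> \<open>Integration over \<open>N i\<close> multiplies by its mass: \<open>A i\<close>
    becomes \<open>a i\<close> and \<open>(A i)\<^sup>2\<close> becomes
    \<open>(a i)\<^sup>2 / m' i\<close>.\<close>
  have "(\<Sum>i\<in>UNIV. (A i * (P i \<bullet> w \<nu>) - q * (A i)\<^sup>2) * m' i)
      = (\<Sum>i\<in>UNIV. a i * (P i \<bullet> w \<nu>)) - q * (\<Sum>i\<in>UNIV. (a i)\<^sup>2 / m' i)"
    unfolding sum_distrib_left sum_subtractf[symmetric]
    by (intro sum.cong refl) (use less_imp_neq[OF mpos] in \<open>simp add: A_def field_simps power2_eq_square\<close>)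
  moreover have "V (coef \<nu>) \<bullet> w \<nu> = (\<Sum>i\<in>UNIV. a i * (P i \<bullet> w \<nu>)) + (\<Sum>i\<in>UNIV. L i (snd (coef \<nu> $ i))) \<bullet> w \<nu>"
  proof -
    have "a i = measure \<nu> (N i) - (r i)\<^sup>2" for i by (simp add: a_def coef_def)
    then show ?thesis unfolding V_coef_inner by simp
  qed
  moreover have "(\<Sum>i\<in>UNIV. (a i)\<^sup>2 / m' i) \<le> K * (norm (coef \<nu>))\<^sup>2"
  proof -
    have "(\<Sum>i\<in>UNIV. (a i)\<^sup>2 / m' i) \<le> (\<Sum>i\<in>UNIV. K * (norm (coef \<nu> $ i))\<^sup>2)"
    proof (rule sum_mono)
      fix i
      have 1: "1 / m' i \<le> K"
      proof -
        have "1 / m' i \<le> 1 / ((r i)\<^sup>2 / 2)" using m[of i] r_pos[of i] mpos[of i] unfolding m'_def by (intro divide_left_mono) auto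
        then show ?thesis using K[of i] by simp
      qed
      have K0: "K \<ge> 0" by (rule order_trans[OF _ 1]) (use mpos[of i] in simp)
      have "(a i)\<^sup>2 \<le> (norm (coef \<nu> $ i))\<^sup>2" 
      proof -
        have "\<bar>a i\<bar> \<le> norm (coef \<nu> $ i)"
          unfolding a_def using norm_fst_le[of "fst (coef \<nu> $ i)" "snd (coef \<nu> $ i)"] by simp
        then have "\<bar>a i\<bar>\<^sup>2 \<le> (norm (coef \<nu> $ i))\<^sup>2" by (rule power_mono) simp
        then show ?thesis by simp
      qed
      then have "(a i)\<^sup>2 * (1 / m' i) \<le> (norm (coef \<nu> $ i))\<^sup>2 * K"
        using 1 mpos[of i] by (intro mult_mono) auto
      then show "(a i)\<^sup>2 / m' i \<le> K * (norm (coef \<nu> $ i))\<^sup>2" by (simp add: mult.commute)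
    qed
    also have "\<dots> = K * (norm (coef \<nu>))\<^sup>2"
      unfolding norm_vec_def L2_set_def by (simp add: sum_distrib_left[symmetric] sum_nonneg)
    finally show ?thesis .
  qed
  then have "q * (\<Sum>i\<in>UNIV. (a i)\<^sup>2 / m' i) \<le> q * (K * (norm (coef \<nu>))\<^sup>2)"
    unfolding q_def using M c by (intro mult_left_mono add_nonneg_nonneg) auto
  ultimately show ?thesis using main unfolding q_def[symmetric] by (simp add: mult.assoc)
qed

end

end

lemma eventually_mult_le_at_right:
  fixes A B :: real
  assumes "B > 0"
  shows "eventually (\<lambda>\<epsilon>. A * \<epsilon> \<le> B) (at_right 0)"
proof -
  have "((\<lambda>\<epsilon>. A * \<epsilon>) \<longlongrightarrow> A * 0) (at_right 0)" by (intro tendsto_intros)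
  then have "eventually (\<lambda>\<epsilon>. A * \<epsilon> < B) (at_right 0)"
    using assms by (intro order_tendstoD(2)[of _ "A * 0"]) auto
  then show ?thesis by eventually_elim simp
qed

section \<open>Choice of the constants and the domination inequality\<close>

context sparse_landscape begin

text \<open>Both sides are compared with \<open>b + (norm x)\<^sup>2\<close>, for \<open>b\<close>
  the bulk and \<open>x\<close> the coefficients. A small gap first makes \<open>b\<close> and
  \<open>x\<close> small; then a multiple of this quantity bounds the gap from above and another one
  bounds the energy from below.\<close>

theorem gradient_domination:
  "\<exists>\<delta> \<kappa>. \<delta> > 0 \<and> \<kappa> > 0 \<and> (\<forall>\<nu>\<in>finite_borel_measures. gap \<nu> \<le> \<delta> \<longrightarrow> \<kappa> * gap \<nu> \<le> energy \<nu>)"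
proof -
  have H_bl: "bounded_linear H" using H has_derivative_bounded_linear by blast
  obtain k where k: "k > 0" "\<And>x. k * (norm x)\<^sup>2 \<le> V x \<bullet> H (V x)"
    using quadratic_form_coercive[OF linear_V V_inj H_bl H_pos] by blast
  have V_bl: "bounded_linear V" using linear_V by (simp add: linear_conv_bounded_linear)
  obtain CV where CV: "CV > 0" "\<And>x. norm (V x) \<le> norm x * CV"
    using bounded_linear.pos_bounded[OF V_bl] by blast
  obtain KH where KH: "KH > 0" "\<And>h. norm (H h) \<le> norm h * KH"
    using bounded_linear.pos_bounded[OF H_bl] by blast
  define KW where "KW = KH + 1"
  \<comment> \<open>A common bound for all \<open>2 / (r i)\<^sup>2\<close>; its reciprocal is a
    common lower bound for all \<open>(r i)\<^sup>2 / 2\<close>.\<close>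
  define Kr where "Kr = (\<Sum>i\<in>UNIV. 2 / (r i)\<^sup>2)"
  have Kr: "2 / (r i)\<^sup>2 \<le> Kr" for i unfolding Kr_def by (rule member_le_sum) auto
  have Kr_pos: "Kr > 0" unfolding Kr_def using r_pos by (intro sum_pos) (auto simp: less_imp_neq[symmetric])
  \<comment> \<open>Small enough that linearizing the gradient at \<open>fs\<close> costs at most
    \<open>k / 4\<close> of the coercivity after pairing with \<open>V x\<close>; the cap 1 gives
    the Lipschitz bound \<open>KW\<close>.\<close>
  define \<eta> where "\<eta> = min 1 (k / (4 * CV\<^sup>2))"
  have \<eta>: "\<eta> > 0" "\<eta> \<le> 1" unfolding \<eta>_def using k CV by auto
  have \<eta>k: "\<eta> * CV\<^sup>2 \<le> k / 4"
  proof -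
    have "\<eta> * CV\<^sup>2 \<le> (k / (4 * CV\<^sup>2)) * CV\<^sup>2" unfolding \<eta>_def by (intro mult_right_mono) auto
    then show ?thesis using CV by simp
  qed
  obtain \<delta>1 where \<delta>1: "\<delta>1 > 0" "\<And>h. norm h \<le> \<delta>1 \<Longrightarrow> norm (R' (fs + h) - R' fs - H h) \<le> \<eta> * norm h"
    using has_derivative_approx[OF H \<eta>(1)] by blast
  have w_bound: "norm (R' (fs + h) - R' fs) \<le> KW * norm h" if "norm h \<le> \<delta>1" for h
  proof -
    have "norm (R' (fs + h) - R' fs) \<le> norm (R' (fs + h) - R' fs - H h) + norm (H h)"
      using norm_triangle_ineq[of "R' (fs + h) - R' fs - H h" "H h"] by simp
    also have "\<dots> \<le> \<eta> * norm h + norm h * KH" using \<delta>1(2)[OF that] KH(2)[of h] by linarith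
    also have "\<dots> \<le> 1 * norm h + norm h * KH" using \<eta>(2) by (intro add_right_mono mult_right_mono) auto
    finally show ?thesis unfolding KW_def by (simp add: algebra_simps)
  qed
  have pairing: "V x \<bullet> (R' (fs + (V x + e)) - R' fs) \<ge> 3 * k / 4 * (norm x)\<^sup>2 - KW * CV * norm x * norm e"
    if "norm (V x + e) \<le> \<delta>1" for x e
  proof -
    let ?d = "R' (fs + (V x + e)) - R' fs - H (V x + e)"
    have "V x \<bullet> (R' (fs + (V x + e)) - R' fs) = V x \<bullet> ?d + V x \<bullet> H (V x) + V x \<bullet> H e"
      by (simp add: inner_diff_right linear_add[OF bounded_linear.linear[OF H_bl]] inner_add_right)
    moreover have "\<bar>V x \<bullet> ?d\<bar> \<le> k / 4 * (norm x)\<^sup>2 + CV * norm x * norm e"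
    proof -
      have "\<bar>V x \<bullet> ?d\<bar> \<le> norm (V x) * norm ?d" by (rule Cauchy_Schwarz_ineq2)
      also have "\<dots> \<le> (norm x * CV) * (\<eta> * norm (V x + e))"
        using CV \<delta>1(2)[OF that] by (intro mult_mono) auto
      also have "\<dots> \<le> (norm x * CV) * (\<eta> * (norm x * CV + norm e))"
        using CV \<eta> norm_triangle_ineq[of "V x" e] by (intro mult_left_mono) (auto intro: order_trans)
      also have "\<dots> = (\<eta> * CV\<^sup>2) * (norm x)\<^sup>2 + \<eta> * (CV * norm x * norm e)"
        by (simp add: algebra_simps power2_eq_square)
      also have "\<dots> \<le> k / 4 * (norm x)\<^sup>2 + 1 * (CV * norm x * norm e)"
        using \<eta>k \<eta>(2) CV by (intro add_mono mult_right_mono) auto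
      finally show ?thesis by simp
    qed
    moreover have "\<bar>V x \<bullet> H e\<bar> \<le> KH * CV * norm x * norm e"
    proof -
      have "\<bar>V x \<bullet> H e\<bar> \<le> norm (V x) * norm (H e)" by (rule Cauchy_Schwarz_ineq2)
      also have "\<dots> \<le> (norm x * CV) * (norm e * KH)" using CV KH by (intro mult_mono) auto
      finally show ?thesis by (simp add: mult_ac)
    qed
    ultimately show ?thesis using k(2)[of x] unfolding KW_def distrib_right by linarith
  qed
  \<comment> \<open>The two summands make the Young losses small: at most \<open>c / 4\<close> in
    front of \<open>spread\<close> (\<open>M1\<close>) and \<open>k / 8\<close> in front of
    \<open>(norm x)\<^sup>2\<close> (\<open>M2\<close>).\<close>
  define M where "M = 2 * \<Lambda> / c + 4 * Kr / k"
  have M: "M > 0" unfolding M_def using \<Lambda> c Kr_pos k(1) by (intro add_pos_pos divide_pos_pos) auto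
  have M1: "\<Lambda> / (2 * M) \<le> c / 4"
  proof -
    have "2 * \<Lambda> / c \<le> M" unfolding M_def using Kr_pos k(1) by simp
    then have "2 * \<Lambda> \<le> c * M" using c by (simp add: field_simps)
    then show ?thesis using M by (simp add: field_simps)
  qed
  have M2: "Kr / (2 * M) \<le> k / 8"
  proof -
    have "4 * Kr / k \<le> M" unfolding M_def using \<Lambda> c by simp
    then have "4 * Kr \<le> k * M" using k(1) by (simp add: field_simps)
    then show ?thesis using M by (simp add: field_simps)
  qed
  define D' where "D' = CV + C"
  \<comment> \<open>Half of the coefficients \<open>c / 4\<close> of \<open>spread\<close> and
    \<open>M * c\<^sup>2 / 8\<close> of the far mass that remain in \<open>energy_lower\<close>; the
    other half pays for the remainder \<open>e\<close> in \<open>V_w\<close>.\<close>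
  define c2 where "c2 = min (c / 8) (M * c\<^sup>2 / 16)"
  have c2: "c2 > 0" unfolding c2_def using c M by simp
  \<comment> \<open>All smallness conditions are linear in \<open>\<epsilon>\<close>, so finitely
    many of them hold together near 0. Quadratic terms are reduced to linear ones by
    \<open>\<epsilon> \<le> 1\<close>.\<close>
  have "eventually (\<lambda>\<epsilon>. D' * \<epsilon> \<le> \<delta>1 \<and> (C * KW * D') * \<epsilon> \<le> c / 8 \<and> 1 * \<epsilon> \<le> 1 / Kr \<and> C * \<epsilon> \<le> c / 8 * (1 / Kr)
      \<and> (C\<^sup>2 / c * KW\<^sup>2 * D'\<^sup>2 * Kr) * \<epsilon> \<le> k / 8 \<and> (KW * CV * C) * \<epsilon> \<le> c2 \<and> 1 * \<epsilon> \<le> 1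
      \<and> CV * \<epsilon> \<le> \<delta>1 \<and> (KW * CV * C) * \<epsilon> \<le> c \<and> \<epsilon> > 0) (at_right (0::real))"
    using \<delta>1(1) c Kr_pos k(1) c2
    by (intro eventually_conj eventually_mult_le_at_right eventually_at_right_less) auto
  then obtain \<epsilon> where \<epsilon>: "D' * \<epsilon> \<le> \<delta>1" "C * KW * D' * \<epsilon> \<le> c / 8" "\<epsilon> \<le> 1 / Kr" "C * \<epsilon> \<le> c / 8 * (1 / Kr)"
      "C\<^sup>2 / c * KW\<^sup>2 * D'\<^sup>2 * Kr * \<epsilon> \<le> k / 8" "KW * CV * C * \<epsilon> \<le> c2" "\<epsilon> \<le> 1"
      "CV * \<epsilon> \<le> \<delta>1" "KW * CV * C * \<epsilon> \<le> c" "\<epsilon> > 0"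
    using eventually_happens'[OF trivial_limit_at_right_real] unfolding mult_1 by blast
  \<comment> \<open>If \<open>norm x\<close> exceeds \<open>2 * \<epsilon>1\<close>, rescaling
    \<open>x\<close> to norm \<open>\<epsilon>1\<close> leaves a factor
    \<open>norm x / \<epsilon>1 - 1\<close> of at least 1.\<close>
  define \<epsilon>1 where "\<epsilon>1 = \<epsilon> / 2"
  have \<epsilon>1: "\<epsilon>1 > 0" "\<epsilon> = 2 * \<epsilon>1" using \<epsilon>(10) by (auto simp: \<epsilon>1_def)
  have KW: "KW > 0" unfolding KW_def using KH by simp
  \<comment> \<open>The first bound lies below the growth
    \<open>3 * k / 4 * \<epsilon>1\<^sup>2\<close> that large coefficients would force; the second
    makes the bulk at most \<open>\<epsilon>\<close>.\<close>
  define \<delta> where "\<delta> = min (k / 2 * \<epsilon>1\<^sup>2) (c * \<epsilon>)"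
  have \<delta>: "\<delta> > 0" unfolding \<delta>_def using k(1) \<epsilon>1 c by simp
  define c3 where "c3 = min (k / 2) c2"
  define c4 where "c4 = C + 2 * KW * C\<^sup>2 + 2 * KW * CV\<^sup>2"
  have c3: "c3 > 0" unfolding c3_def using k(1) c2 by simp
  have c4: "c4 > 0" unfolding c4_def using C KW CV(1) by (intro add_pos_nonneg) auto
  define \<kappa> where "\<kappa> = 2 * c3 / (M * c4)"
  have \<kappa>: "\<kappa> > 0" unfolding \<kappa>_def using c3 c4 M by simp
  have "\<kappa> * gap \<nu> \<le> energy \<nu>" if nu: "\<nu> \<in> finite_borel_measures" and gap: "gap \<nu> \<le> \<delta>" for \<nu>
  proof -
    define x where "x = coef \<nu>"
    define e where "e = hh \<nu> - V x"
    define b where "b = bulk \<nu>"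
    have h: "hh \<nu> = V x + e" by (simp add: e_def)
    have b0: "b \<ge> 0" unfolding b_def by (rule bulk_nonneg[OF nu])
    have e: "norm e \<le> C * b" unfolding e_def x_def b_def by (rule remainder_bound[OF nu])
    have b_le: "b \<le> \<epsilon>"
    proof -
      have "c * b \<le> c * \<epsilon>" using gap_lower0[OF nu] gap unfolding b_def \<delta>_def by simp
      then show ?thesis using c by simp
    qed
    \<comment> \<open>The integral of \<phi> might still be far from \<open>fs\<close>, where the
      linearization of \<open>R'\<close> says nothing. The tangent is therefore taken at
      \<open>fs + V y\<close>, with \<open>y\<close> a short multiple of \<open>x\<close>, and
      convexity extends the growth along the ray.\<close>
    have x_le: "norm x \<le> \<epsilon>"
    proof (rule ccontr)
      assume "\<not> norm x \<le> \<epsilon>"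
      then have nx: "norm x > 2 * \<epsilon>1" using \<epsilon>1 by simp
      then have nx0: "norm x > 0" using \<epsilon>1 by linarith
      define y where "y = (\<epsilon>1 / norm x) *\<^sub>R x"
      have ny: "norm y = \<epsilon>1" using nx0 \<epsilon>1(1) by (simp add: y_def)
      have xy: "V x = (norm x / \<epsilon>1) *\<^sub>R V y" unfolding y_def linear_scale[OF linear_V] using nx0 \<epsilon>1(1) by simp
      have Vy: "norm (V y) \<le> CV * \<epsilon>1" using CV(2)[of y] ny by (simp add: mult.commute)
      also have "\<dots> \<le> \<delta>1" using \<epsilon>(8) \<epsilon>1 CV(1) by (smt (verit) mult_left_mono)
      finally have Vy1: "norm (V y) \<le> \<delta>1" .
      define W where "W = R' (fs + V y) - R' fs"
      have WVy: "V y \<bullet> W \<ge> 3 * k / 4 * \<epsilon>1\<^sup>2"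
        using pairing[of y 0] Vy1 ny unfolding W_def by simp
      \<comment> \<open>The remainder \<open>e\<close> is bounded by the bulk and \<open>W\<close>
        is small, so the term \<open>c * b\<close> in \<open>gap_lower\<close> absorbs this
        pairing.\<close>
      have We: "\<bar>W \<bullet> e\<bar> \<le> c * b"
      proof -
        have "\<bar>W \<bullet> e\<bar> \<le> norm W * norm e" by (rule Cauchy_Schwarz_ineq2)
        also have "\<dots> \<le> (KW * (CV * \<epsilon>1)) * (C * b)"
          using order_trans[OF w_bound[OF Vy1] mult_left_mono[OF Vy]] KW e CV(1) \<epsilon>1(1) unfolding W_def
          by (intro mult_mono) auto
        also have "\<dots> = (KW * CV * C * \<epsilon>1) * b" by simp
        also have "\<dots> \<le> c * b"
        proof -
          have "KW * CV * C * \<epsilon>1 \<le> KW * CV * C * \<epsilon>" using \<epsilon>1 KW CV(1) C by (intro mult_left_mono) auto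
          then show ?thesis using \<epsilon>(9) b0 by (intro mult_right_mono) auto
        qed
        finally show ?thesis .
      qed
      have "hh \<nu> - V y = (norm x / \<epsilon>1 - 1) *\<^sub>R V y + e"
        unfolding h xy by (simp add: algebra_simps)
      then have "W \<bullet> (hh \<nu> - V y) = (norm x / \<epsilon>1 - 1) * (V y \<bullet> W) + W \<bullet> e"
        by (simp add: inner_add_right inner_commute)
      moreover have "(norm x / \<epsilon>1 - 1) * (V y \<bullet> W) \<ge> 1 * (3 * k / 4 * \<epsilon>1\<^sup>2)"
      proof (rule mult_mono)
        show "1 \<le> norm x / \<epsilon>1 - 1" using nx \<epsilon>1(1) by (simp add: field_simps)
      qed (use WVy nx \<epsilon>1(1) k(1) in \<open>auto simp: field_simps\<close>)
      moreover have "c * b + W \<bullet> (hh \<nu> - V y) \<le> gap \<nu>"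
        using gap_lower[OF nu, of "V y"] unfolding W_def b_def .
      ultimately have "3 * k / 4 * \<epsilon>1\<^sup>2 \<le> gap \<nu>" using We by linarith
      moreover have "gap \<nu> \<le> k / 2 * \<epsilon>1\<^sup>2" using gap unfolding \<delta>_def by simp
      moreover have "k * \<epsilon>1\<^sup>2 > 0" using k(1) \<epsilon>1(1) by simp
      ultimately show False by linarith
    qed
    have hn: "norm (hh \<nu>) \<le> CV * norm x + C * b"
      using norm_triangle_ineq[of "V x" e] CV(2)[of x] e unfolding h by (simp add: mult.commute)
    also have "\<dots> \<le> CV * \<epsilon> + C * \<epsilon>" using x_le b_le CV(1) C by (intro add_mono mult_left_mono) auto
    finally have hD: "norm (hh \<nu>) \<le> D' * \<epsilon>" unfolding D'_def by (simp add: distrib_right)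
    have hd: "norm (hh \<nu>) \<le> \<delta>1" using hD \<epsilon>(1) by linarith
    have w_eq: "w \<nu> = R' (fs + hh \<nu>) - R' fs" unfolding w_def hh_def by simp
    have wh: "norm (w \<nu>) \<le> KW * norm (hh \<nu>)" unfolding w_eq by (rule w_bound[OF hd])
    also have "\<dots> \<le> KW * (D' * \<epsilon>)" using hD KW by (intro mult_left_mono) auto
    finally have wD: "norm (w \<nu>) \<le> KW * D' * \<epsilon>" by simp
    have a_le: "\<bar>fst (x $ i)\<bar> \<le> \<epsilon>" for i
    proof -
      have "\<bar>fst (x $ i)\<bar> \<le> norm (x $ i)" using norm_fst_le[of "fst (x $ i)" "snd (x $ i)"] by simp
      also have "\<dots> \<le> norm x" by (rule Finite_Cartesian_Product.norm_nth_le)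
      finally show ?thesis using x_le by simp
    qed
    have rK: "1 / Kr \<le> (r i)\<^sup>2 / 2" for i
      using Kr[of i] Kr_pos r_pos[of i] by (simp add: field_simps)
    have m_ge: "measure \<nu> (N i) \<ge> (r i)\<^sup>2 / 2" for i
    proof -
      have "measure \<nu> (N i) = (r i)\<^sup>2 + fst (x $ i)" by (simp add: x_def coef_def)
      then show ?thesis using a_le[of i] rK[of i] \<epsilon>(3) by (auto simp: abs_le_iff)
    qed
    have a_small: "C * \<bar>fst (coef \<nu> $ i)\<bar> \<le> c / 8 * measure \<nu> (N i)" for i
    proof -
      have "C * \<bar>fst (coef \<nu> $ i)\<bar> \<le> C * \<epsilon>" using a_le[of i] C unfolding x_def by simp
      also have "\<dots> \<le> c / 8 * (1 / Kr)" by (rule \<epsilon>(4))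
      also have "\<dots> \<le> c / 8 * measure \<nu> (N i)" using rK[of i] m_ge[of i] c by (intro mult_left_mono) auto
      finally show ?thesis .
    qed
    have w_small: "C * norm (w \<nu>) \<le> c / 8"
    proof -
      have "C * norm (w \<nu>) \<le> C * (KW * D' * \<epsilon>)" using wD C by (intro mult_left_mono) auto
      then show ?thesis using \<epsilon>(2) by (simp add: mult_ac)
    qed
    have coefx: "(C\<^sup>2 / c * (norm (w \<nu>))\<^sup>2 + 1 / (2 * M)) * Kr \<le> k / 4"
    proof -
      have D'0: "D' \<ge> 0" unfolding D'_def using CV(1) C by simp
      have "(norm (w \<nu>))\<^sup>2 \<le> (KW * D' * \<epsilon>)\<^sup>2" using wD by (intro power_mono) auto
      also have "\<dots> = KW\<^sup>2 * D'\<^sup>2 * (\<epsilon> * \<epsilon>)" by (simp add: power2_eq_square)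
      also have "\<dots> \<le> KW\<^sup>2 * D'\<^sup>2 * (\<epsilon> * 1)" using \<epsilon>(7,10) by (intro mult_left_mono) auto
      finally have "C\<^sup>2 / c * (norm (w \<nu>))\<^sup>2 * Kr \<le> C\<^sup>2 / c * (KW\<^sup>2 * D'\<^sup>2 * (\<epsilon> * 1)) * Kr"
        using c Kr_pos by (intro mult_right_mono mult_left_mono) auto
      also have "\<dots> = C\<^sup>2 / c * KW\<^sup>2 * D'\<^sup>2 * Kr * \<epsilon>" by simp
      also have "\<dots> \<le> k / 8" by (rule \<epsilon>(5))
      finally have "C\<^sup>2 / c * (norm (w \<nu>))\<^sup>2 * Kr + Kr / (2 * M) \<le> k / 8 + k / 8"
        using M2 by (rule add_mono)
      moreover have "(C\<^sup>2 / c * (norm (w \<nu>))\<^sup>2 + 1 / (2 * M)) * Kr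
          = C\<^sup>2 / c * (norm (w \<nu>))\<^sup>2 * Kr + Kr / (2 * M)"
        by (simp add: distrib_right)
      ultimately show ?thesis by linarith
    qed
    have V_w: "V x \<bullet> w \<nu> \<ge> 3 * k / 4 * (norm x)\<^sup>2 - c2 * b"
    proof -
      have "KW * CV * norm x * norm e \<le> KW * CV * \<epsilon> * (C * b)"
        using x_le e KW CV(1) \<epsilon>(10) by (intro mult_mono mult_left_mono) auto
      also have "\<dots> = (KW * CV * C * \<epsilon>) * b" by simp
      also have "\<dots> \<le> c2 * b" using \<epsilon>(6) b0 by (intro mult_right_mono) auto
      finally show ?thesis using pairing[of x e] hd unfolding w_eq h by linarith
    qed
    have main: "c3 * (b + (norm x)\<^sup>2) \<le> M / 2 * energy \<nu>"
    proof -
      have s0: "spread \<nu> \<ge> 0" by (rule spread_nonneg[OF nu])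
      have f0: "measure \<nu> far \<ge> 0" by simp
      have 1: "(c / 2 - \<Lambda> / (2 * M)) * spread \<nu> \<ge> (2 * c2) * spread \<nu>"
        using M1 s0 unfolding c2_def by (intro mult_right_mono) auto
      have 2: "M * c\<^sup>2 / 8 * measure \<nu> far \<ge> (2 * c2) * measure \<nu> far"
        using f0 unfolding c2_def by (intro mult_right_mono) auto
      have 3: "(C\<^sup>2 / c * (norm (w \<nu>))\<^sup>2 + 1 / (2 * M)) * Kr * (norm x)\<^sup>2 \<le> k / 4 * (norm x)\<^sup>2"
        by (intro mult_right_mono coefx) auto
      \<comment> \<open>For \<open>(norm x)\<^sup>2\<close> the balance is
        \<open>3 * k / 4 - k / 4\<close>, for the bulk it is \<open>2 * c2 - c2\<close>.\<close>
      have "k / 2 * (norm x)\<^sup>2 + c2 * b \<le> M / 2 * energy \<nu>"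
      proof -
        have "c2 * b = c2 * spread \<nu> + c2 * measure \<nu> far"
          unfolding b_def bulk_def by (rule distrib_left)
        then show ?thesis
          using energy_lower[OF nu M m_ge a_small w_small Kr, folded x_def] V_w 1 2 3 by linarith
      qed
      moreover have "c3 * (norm x)\<^sup>2 \<le> k / 2 * (norm x)\<^sup>2" "c3 * b \<le> c2 * b"
        using b0 unfolding c3_def by (intro mult_right_mono; simp)+
      ultimately show ?thesis by (simp add: distrib_left)
    qed
    have "gap \<nu> \<le> C * b + w \<nu> \<bullet> hh \<nu>" unfolding b_def by (rule gap_upper[OF nu])
    also have "w \<nu> \<bullet> hh \<nu> \<le> norm (w \<nu>) * norm (hh \<nu>)" by (rule norm_cauchy_schwarz)
    also have "\<dots> \<le> (KW * norm (hh \<nu>)) * norm (hh \<nu>)" using wh by (intro mult_right_mono) auto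
    also have "\<dots> = KW * (norm (hh \<nu>))\<^sup>2" by (simp add: power2_eq_square)
    also have "\<dots> \<le> KW * (2 * CV\<^sup>2 * (norm x)\<^sup>2 + 2 * C\<^sup>2 * b)"
    proof (rule mult_left_mono)
      have "(norm (hh \<nu>))\<^sup>2 \<le> (CV * norm x + C * b)\<^sup>2" using hn by (intro power_mono) auto
      also have "\<dots> \<le> 2 * (CV * norm x)\<^sup>2 + 2 * (C * b)\<^sup>2"
        using zero_le_power2[of "CV * norm x - C * b"] by (simp add: power2_eq_square algebra_simps)
      also have "\<dots> = 2 * CV\<^sup>2 * (norm x)\<^sup>2 + 2 * C\<^sup>2 * (b * b)"
        by (simp add: power2_eq_square)
      \<comment> \<open>Since \<open>b \<le> \<epsilon> \<le> 1\<close>, the square of the bulk is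
        bounded by the bulk.\<close>
      also have "\<dots> \<le> 2 * CV\<^sup>2 * (norm x)\<^sup>2 + 2 * C\<^sup>2 * (1 * b)"
        using b0 b_le \<epsilon>(7) by (intro add_left_mono mult_left_mono mult_right_mono) auto
      finally show "(norm (hh \<nu>))\<^sup>2 \<le> 2 * CV\<^sup>2 * (norm x)\<^sup>2 + 2 * C\<^sup>2 * b" by simp
    qed (use KW in simp)
    finally have "gap \<nu> \<le> (C + 2 * KW * C\<^sup>2) * b + (2 * KW * CV\<^sup>2) * (norm x)\<^sup>2"
      by (simp add: algebra_simps)
    also have "\<dots> \<le> c4 * b + c4 * (norm x)\<^sup>2"
    proof -
      have "C + 2 * KW * C\<^sup>2 \<le> c4" "2 * KW * CV\<^sup>2 \<le> c4" unfolding c4_def using KW C by auto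
      then show ?thesis using b0 by (meson add_mono mult_right_mono zero_le_power2)
    qed
    finally have g4: "gap \<nu> \<le> c4 * (b + (norm x)\<^sup>2)" by (simp add: distrib_left)
    have "\<kappa> * gap \<nu> \<le> \<kappa> * (c4 * (b + (norm x)\<^sup>2))" using g4 \<kappa> by (intro mult_left_mono) auto
    also have "\<dots> = 2 / M * (c3 * (b + (norm x)\<^sup>2))" unfolding \<kappa>_def using c4 by simp
    also have "\<dots> \<le> 2 / M * (M / 2 * energy \<nu>)" using main M by (intro mult_left_mono) auto
    also have "\<dots> = energy \<nu>" using M by simp
    finally show ?thesis .
  qed
  then show ?thesis using \<delta> \<kappa> by blast
qed

end

section \<open>Second-order expansions\<close>

text \<open>The mean value theorem along \<open>u\<close>, applied to a difference along
  \<open>v\<close>, leaves a difference of \<open>f'\<close> at two points of size of order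
  \<open>t\<close>; differentiability of \<open>f'\<close> at 0 alone then suffices.\<close>

lemma second_difference_approx:
  fixes f :: "'e::real_normed_vector \<Rightarrow> real" and f' :: "'e \<Rightarrow> 'e \<Rightarrow>\<^sub>L real"
  assumes \<rho>: "\<rho> > 0" and f': "\<And>x. norm x < \<rho> \<Longrightarrow> (f has_derivative blinfun_apply (f' x)) (at x)"
    and f'': "(f' has_derivative f'') (at 0)" and \<epsilon>: "\<epsilon> > 0"
  obtains \<tau> where "\<tau> > 0"
    "\<And>t. 0 < t \<Longrightarrow> t \<le> \<tau> \<Longrightarrow>
      \<bar>f (t *\<^sub>R u + t *\<^sub>R v) - f (t *\<^sub>R u) - f (t *\<^sub>R v) + f 0 - t\<^sup>2 * f'' v u\<bar> \<le> \<epsilon> * t\<^sup>2"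
proof -
  interpret f'': bounded_linear f'' using f'' has_derivative_bounded_linear by blast
  define K where "K = norm u + norm v + 1"
  have K: "K > 0" "norm u \<le> K" unfolding K_def by (auto intro: add_nonneg_pos)
  \<comment> \<open>One factor \<open>K\<close> bounds the point, the other the direction
    \<open>u\<close>; the 2 shares \<open>\<epsilon>\<close> between the two points of the
    difference.\<close>
  define \<eta> where "\<eta> = \<epsilon> / (2 * K\<^sup>2)"
  have \<eta>: "\<eta> > 0" unfolding \<eta>_def using \<epsilon> K by simp
  obtain \<delta> where \<delta>: "\<delta> > 0" "\<And>h. norm h \<le> \<delta> \<Longrightarrow> norm (f' (0 + h) - f' 0 - f'' h) \<le> \<eta> * norm h"
    using has_derivative_approx[OF f'' \<eta>] by blast
  define \<tau> where "\<tau> = min (\<delta> / K) (\<rho> / (2 * K))"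
  have "\<tau> > 0" unfolding \<tau>_def using \<delta>(1) \<rho> K by simp
  moreover have "\<bar>f (t *\<^sub>R u + t *\<^sub>R v) - f (t *\<^sub>R u) - f (t *\<^sub>R v) + f 0 - t\<^sup>2 * f'' v u\<bar> \<le> \<epsilon> * t\<^sup>2"
    if t: "0 < t" "t \<le> \<tau>" for t
  proof -
    have tK: "t * K \<le> \<delta>" "t * K < \<rho>"
    proof -
      have "t \<le> \<delta> / K" "t \<le> \<rho> / (2 * K)" using t unfolding \<tau>_def by auto
      then show "t * K \<le> \<delta>" "t * K < \<rho>" using K \<rho> by (auto simp: field_simps)
    qed
    have nb: "norm (s *\<^sub>R u + q *\<^sub>R v) \<le> t * K" if "0 \<le> s" "s \<le> t" "0 \<le> q" "q \<le> t" for s q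
    proof -
      have "norm (s *\<^sub>R u + q *\<^sub>R v) \<le> s * norm u + q * norm v"
        using norm_triangle_ineq[of "s *\<^sub>R u" "q *\<^sub>R v"] that by simp
      also have "\<dots> \<le> t * norm u + t * norm v" using that by (intro add_mono mult_right_mono) auto
      also have "\<dots> \<le> t * K" unfolding K_def using t by (simp add: distrib_left)
      finally show ?thesis .
    qed
    \<comment> \<open>The summand \<open>0 *\<^sub>R v\<close> is kept so that \<open>d\<close> and
      \<open>nb\<close> cover both points.\<close>
    define g where "g s = f (s *\<^sub>R u + t *\<^sub>R v) - f (s *\<^sub>R u + 0 *\<^sub>R v)" for s
    have d: "((\<lambda>s. f (s *\<^sub>R u + q *\<^sub>R v)) has_real_derivative (f' (s *\<^sub>R u + q *\<^sub>R v) u)) (at s)"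
      if "0 \<le> s" "s \<le> t" "0 \<le> q" "q \<le> t" for s q
    proof -
      have "((\<lambda>s. s *\<^sub>R u + q *\<^sub>R v) has_derivative (\<lambda>h. h *\<^sub>R u)) (at s)"
        by (auto intro!: derivative_eq_intros)
      from diff_chain_at[OF this f'[OF le_less_trans[OF nb[OF that] tK(2)]]]
      show ?thesis unfolding has_field_derivative_def comp_def
        by (simp add: blinfun.scaleR_right mult_commute_abs)
    qed
    have "\<exists>z. 0 < z \<and> z < t \<and> g t - g 0 = (t - 0) * (f' (z *\<^sub>R u + t *\<^sub>R v) u - f' (z *\<^sub>R u + 0 *\<^sub>R v) u)"
      unfolding g_def using t by (intro MVT2 DERIV_diff d) auto
    then obtain z where z: "0 < z" "z < t" "g t - g 0 = t * (f' (z *\<^sub>R u + t *\<^sub>R v) u - f' (z *\<^sub>R u + 0 *\<^sub>R v) u)"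
      by auto
    have E: "\<bar>(f' x - f' 0 - f'' x) u\<bar> \<le> (\<epsilon> / 2) * t" if "norm x \<le> t * K" for x
    proof -
      have "\<bar>(f' x - f' 0 - f'' x) u\<bar> \<le> norm (f' x - f' 0 - f'' x) * norm u"
        using norm_blinfun[of "f' x - f' 0 - f'' x" u] by simp
      also have "\<dots> \<le> (\<eta> * (t * K)) * K"
      proof (rule mult_mono[OF _ K(2)])
        have "norm (f' x - f' 0 - f'' x) \<le> \<eta> * norm x" using \<delta>(2)[of x] that tK(1) by simp
        also have "\<dots> \<le> \<eta> * (t * K)" using that \<eta> by simp
        finally show "norm (f' x - f' 0 - f'' x) \<le> \<eta> * (t * K)" .
      qed (use \<eta> t K in auto)
      also have "\<dots> = (\<epsilon> / 2) * t" unfolding \<eta>_def using K(1) by (simp add: power2_eq_square)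
      finally show ?thesis .
    qed
    have "f'' (z *\<^sub>R u + t *\<^sub>R v) - f'' (z *\<^sub>R u + 0 *\<^sub>R v) = t *\<^sub>R f'' v"
      by (simp add: f''.add f''.scaleR)
    then have "f'' (z *\<^sub>R u + t *\<^sub>R v) u - f'' (z *\<^sub>R u + 0 *\<^sub>R v) u = t * f'' v u"
      by (metis blinfun.diff_left blinfun.scaleR_left real_scaleR_def)
    then have "f' (z *\<^sub>R u + t *\<^sub>R v) u - f' (z *\<^sub>R u + 0 *\<^sub>R v) u - t * f'' v u
       = (f' (z *\<^sub>R u + t *\<^sub>R v) - f' 0 - f'' (z *\<^sub>R u + t *\<^sub>R v)) u - (f' (z *\<^sub>R u + 0 *\<^sub>R v) - f' 0 - f'' (z *\<^sub>R u + 0 *\<^sub>R v)) u"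
      by (simp only: blinfun.diff_left)
    moreover have "\<bar>\<dots>\<bar> \<le> \<epsilon> * t"
      using E[OF nb[of z t]] E[OF nb[of z 0]] z t by (simp del: scaleR_zero_left)
    ultimately have "\<bar>f' (z *\<^sub>R u + t *\<^sub>R v) u - f' (z *\<^sub>R u + 0 *\<^sub>R v) u - t * f'' v u\<bar> \<le> \<epsilon> * t" by simp
    then have "t * \<bar>f' (z *\<^sub>R u + t *\<^sub>R v) u - f' (z *\<^sub>R u + 0 *\<^sub>R v) u - t * f'' v u\<bar> \<le> t * (\<epsilon> * t)"
      using t by (intro mult_left_mono) auto
    also have "t * \<bar>f' (z *\<^sub>R u + t *\<^sub>R v) u - f' (z *\<^sub>R u + 0 *\<^sub>R v) u - t * f'' v u\<bar>
        = \<bar>t * (f' (z *\<^sub>R u + t *\<^sub>R v) u - f' (z *\<^sub>R u + 0 *\<^sub>R v) u) - t\<^sup>2 * f'' v u\<bar>"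
      using t(1) abs_mult[of t "f' (z *\<^sub>R u + t *\<^sub>R v) u - f' (z *\<^sub>R u + 0 *\<^sub>R v) u - t * f'' v u"]
      by (simp add: right_diff_distrib power2_eq_square mult.assoc)
    also have "\<dots> = \<bar>g t - g 0 - t\<^sup>2 * f'' v u\<bar>" using z(3) by simp
    finally show ?thesis unfolding g_def by (simp add: power2_eq_square mult_ac algebra_simps)
  qed
  ultimately show ?thesis by (rule that)
qed

text \<open>The second difference is symmetric in \<open>u\<close> and \<open>v\<close>, and it
  approximates both values up to \<open>\<epsilon> * t\<^sup>2\<close>; with
  \<open>\<epsilon>\<close> a third of their distance this is a contradiction.\<close>

lemma second_derivative_symmetric:
  fixes f :: "'e::real_normed_vector \<Rightarrow> real" and f' :: "'e \<Rightarrow> 'e \<Rightarrow>\<^sub>L real"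
  assumes "\<rho> > 0" and "\<And>x. norm x < \<rho> \<Longrightarrow> (f has_derivative blinfun_apply (f' x)) (at x)"
    and "(f' has_derivative f'') (at 0)"
  shows "f'' u v = f'' v u"
proof (rule ccontr)
  assume ne: "f'' u v \<noteq> f'' v u"
  define \<epsilon> where "\<epsilon> = \<bar>f'' u v - f'' v u\<bar> / 3"
  have \<epsilon>: "\<epsilon> > 0" using ne by (simp add: \<epsilon>_def)
  obtain \<tau>1 where \<tau>1: "\<tau>1 > 0" "\<And>t. 0 < t \<Longrightarrow> t \<le> \<tau>1 \<Longrightarrow>
      \<bar>f (t *\<^sub>R u + t *\<^sub>R v) - f (t *\<^sub>R u) - f (t *\<^sub>R v) + f 0 - t\<^sup>2 * f'' v u\<bar> \<le> \<epsilon> * t\<^sup>2"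
    using second_difference_approx[OF assms \<epsilon>] by blast
  obtain \<tau>2 where \<tau>2: "\<tau>2 > 0" "\<And>t. 0 < t \<Longrightarrow> t \<le> \<tau>2 \<Longrightarrow>
      \<bar>f (t *\<^sub>R v + t *\<^sub>R u) - f (t *\<^sub>R v) - f (t *\<^sub>R u) + f 0 - t\<^sup>2 * f'' u v\<bar> \<le> \<epsilon> * t\<^sup>2"
    using second_difference_approx[OF assms \<epsilon>] by blast
  define t where "t = min \<tau>1 \<tau>2"
  have t: "t > 0" "t \<le> \<tau>1" "t \<le> \<tau>2" using \<tau>1 \<tau>2 by (auto simp: t_def)
  have "\<bar>t\<^sup>2 * f'' u v - t\<^sup>2 * f'' v u\<bar> \<le> 2 * (\<epsilon> * t\<^sup>2)"
    using \<tau>1(2)[OF t(1,2)] \<tau>2(2)[OF t(1,3)] by (simp add: add.commute[of "t *\<^sub>R v"])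
  then have "t\<^sup>2 * \<bar>f'' u v - f'' v u\<bar> \<le> t\<^sup>2 * (2 * \<epsilon>)"
    by (metis abs_mult abs_power2 right_diff_distrib mult.assoc mult.commute)
  then have "\<bar>f'' u v - f'' v u\<bar> \<le> 2 * \<epsilon>" using t(1) by simp
  then show False using \<epsilon> unfolding \<epsilon>_def by simp
qed

text \<open>Differentiating \<open>f u - f'' u u / 2\<close> gives \<open>f' u - f'' u\<close> because \<open>f''\<close> is symmetric.\<close>

lemma second_order_approx:
  fixes f :: "'e::real_normed_vector \<Rightarrow> real" and f' :: "'e \<Rightarrow> 'e \<Rightarrow>\<^sub>L real"
  assumes \<rho>: "\<rho> > 0" and f': "\<And>x. norm x < \<rho> \<Longrightarrow> (f has_derivative blinfun_apply (f' x)) (at x)"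
    and f'': "(f' has_derivative f'') (at 0)" and 0: "f' 0 = 0" and \<epsilon>: "\<epsilon> > 0"
  obtains \<delta> where "\<delta> > 0" "\<delta> \<le> \<rho>"
    "\<And>u. norm u < \<delta> \<Longrightarrow> norm (f' u - f'' u) \<le> \<epsilon> * norm u"
    "\<And>u. norm u < \<delta> \<Longrightarrow> \<bar>f u - f 0 - f'' u u / 2\<bar> \<le> \<epsilon> * (norm u)\<^sup>2"
proof -
  have bl: "bounded_linear f''" using f'' has_derivative_bounded_linear by blast
  interpret f'': bounded_linear f'' by (fact bl)
  obtain d where d: "d > 0" "\<And>h. norm h \<le> d \<Longrightarrow> norm (f' (0 + h) - f' 0 - f'' h) \<le> \<epsilon> * norm h"
    using has_derivative_approx[OF f'' \<epsilon>] by blast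
  define \<delta> where "\<delta> = min d \<rho>"
  have 1: "norm (f' u - f'' u) \<le> \<epsilon> * norm u" if "norm u < \<delta>" for u
    using d(2)[of u] that 0 by (simp add: \<delta>_def)
  have "\<bar>f u - f 0 - f'' u u / 2\<bar> \<le> \<epsilon> * (norm u)\<^sup>2" if u: "norm u < \<delta>" for u
  proof -
    define h where "h x = f x - f'' x x / 2" for x
    have "norm (h u - h 0) \<le> (\<epsilon> * norm u) * norm (u - 0)"
    proof (rule differentiable_bound)
      show "convex (cball (0::'e) (norm u))" by simp
      fix x :: 'e assume x: "x \<in> cball 0 (norm u)"
      have nx: "norm x < \<delta>" using x u by simp
      have "(h has_derivative (\<lambda>v. f' x v - (f'' x v + f'' v x) / 2)) (at x)"
        unfolding h_def
        using f'[of x] nx unfolding \<delta>_def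
        by (auto intro!: derivative_eq_intros bounded_linear.has_derivative[OF bl] simp: algebra_simps)
      also have "(\<lambda>v. f' x v - (f'' x v + f'' v x) / 2) = blinfun_apply (f' x - f'' x)"
        using second_derivative_symmetric[OF \<rho> f' f'', of _ x] by (auto simp: blinfun.diff_left)
      finally show "(h has_derivative blinfun_apply (f' x - f'' x)) (at x within cball 0 (norm u))"
        by (rule has_derivative_at_withinI)
      have "norm (f' x - f'' x) \<le> \<epsilon> * norm x" by (rule 1[OF nx])
      also have "\<dots> \<le> \<epsilon> * norm u" using x \<epsilon> by simp
      finally show "onorm (blinfun_apply (f' x - f'' x)) \<le> \<epsilon> * norm u" by (simp add: norm_blinfun.rep_eq)
    qed auto
    then show ?thesis by (simp add: h_def f''.zero power2_eq_square algebra_simps)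
  qed
  then show ?thesis using that[of \<delta>] d \<rho> 1 by (simp add: \<delta>_def)
qed

text \<open>Minimality makes the Hessian semidefinite, and a semidefinite form is definite as soon
  as its operator is injective. With \<open>k\<close> its minimum on the unit sphere, an
  approximation error of \<open>k / 4\<close> leaves \<open>k / 4\<close> in both bounds.\<close>

lemma nondegenerate_minimum:
  fixes f :: "'e::euclidean_space \<Rightarrow> real" and f' :: "'e \<Rightarrow> 'e \<Rightarrow>\<^sub>L real"
  assumes \<rho>: "\<rho> > 0" and f': "\<And>x. norm x < \<rho> \<Longrightarrow> (f has_derivative blinfun_apply (f' x)) (at x)"
    and f'': "(f' has_derivative f'') (at 0)"
    and min: "f 0 = 0" "\<And>x. norm x < \<rho> \<Longrightarrow> f x \<ge> 0"
    and inj: "\<And>u. u \<noteq> 0 \<Longrightarrow> f'' u \<noteq> 0"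
  obtains c \<delta> where "c > 0" "\<delta> > 0" "\<delta> \<le> \<rho>" "f' 0 = 0"
    "\<And>u. norm u < \<delta> \<Longrightarrow> f u \<ge> c * (norm u)\<^sup>2"
    "\<And>u. norm u < \<delta> \<Longrightarrow> f' u u \<ge> c * (norm u)\<^sup>2"
proof -
  have bl: "bounded_linear f''" using f'' has_derivative_bounded_linear by blast
  interpret f'': bounded_linear f'' by (fact bl)
  have "blinfun_apply (f' 0) = (\<lambda>v. 0)"
  proof (rule differential_zero_maxmin[of 0 "ball 0 \<rho>" f])
    show "(f has_derivative blinfun_apply (f' 0)) (at 0)" using f'[of 0] \<rho> by simp
  qed (use \<rho> min in auto)
  then have f'0: "f' 0 = 0" by (simp add: blinfun_eqI)
  note approx = second_order_approx[OF \<rho> f' f'' f'0]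
  have nonneg: "f'' u u \<ge> 0" for u
  proof (rule ccontr)
    assume neg: "\<not> f'' u u \<ge> 0"
    then have u: "norm u > 0" by (auto simp: f''.zero)
    \<comment> \<open>With this error the expansion would give
      \<open>f (t *\<^sub>R u) \<le> t\<^sup>2 * f'' u u / 4 < 0\<close> for small
      \<open>t\<close>.\<close>
    define \<epsilon> where "\<epsilon> = - f'' u u / (4 * (norm u)\<^sup>2)"
    have \<epsilon>: "\<epsilon> > 0" unfolding \<epsilon>_def using neg u by (intro divide_pos_pos) auto
    obtain \<delta> where \<delta>: "\<delta> > 0" "\<delta> \<le> \<rho>" "\<And>u. norm u < \<delta> \<Longrightarrow> \<bar>f u - f 0 - f'' u u / 2\<bar> \<le> \<epsilon> * (norm u)\<^sup>2"
      using approx[OF _ \<epsilon>] by (metis (no_types, lifting))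
    define t where "t = \<delta> / (2 * norm u)"
    have t: "t > 0" "norm (t *\<^sub>R u) < \<delta>" using u \<delta>(1) by (auto simp: t_def)
    have "f (t *\<^sub>R u) \<ge> 0" using t \<delta>(2) by (intro min) auto
    then have "t\<^sup>2 * (- f'' u u / 2) \<le> \<epsilon> * (t\<^sup>2 * (norm u)\<^sup>2)"
      using \<delta>(3)[OF t(2)] min(1)
      by (simp add: f''.scaleR blinfun.scaleR_left blinfun.scaleR_right power2_eq_square mult_ac)
    also have "\<dots> = t\<^sup>2 * (- f'' u u / 4)" unfolding \<epsilon>_def using u by simp
    finally have "t\<^sup>2 * (- f'' u u / 2) \<le> t\<^sup>2 * (- f'' u u / 4)" .
    then have "- f'' u u / 2 \<le> - f'' u u / 4" using t(1) by (simp only: mult_le_cancel_left_pos zero_less_power)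
    then show False using neg by simp
  qed
  have pos: "f'' u u > 0" if "u \<noteq> 0" for u
  proof (rule ccontr)
    assume "\<not> f'' u u > 0"
    then have z: "f'' u u = 0" using nonneg[of u] by simp
    \<comment> \<open>A null vector of a semidefinite symmetric form lies in the kernel: perturbing
      it by \<open>t *\<^sub>R v\<close> leaves a nonnegative quadratic in \<open>t\<close> without
      constant term.\<close>
    have "f'' u v = 0" for v
    proof (rule quadratic_nonneg_imp_zero)
      fix t
      have "0 \<le> f'' (u + t *\<^sub>R v) (u + t *\<^sub>R v)" by (rule nonneg)
      also have "\<dots> = t\<^sup>2 * f'' v v + 2 * t * f'' u v"
        using z second_derivative_symmetric[OF \<rho> f' f'', of v u]
        by (simp add: f''.add f''.scaleR blinfun.add_left blinfun.add_right blinfun.scaleR_left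
            blinfun.scaleR_right power2_eq_square algebra_simps)
      finally show "0 \<le> t\<^sup>2 * f'' v v + 2 * t * f'' u v" .
    qed
    then have "f'' u = 0" by (simp add: blinfun_eqI)
    then show False using inj that by blast
  qed
  obtain k where k: "k > 0" "\<And>u. k * (norm u)\<^sup>2 \<le> f'' u u"
  proof -
    let ?S = "sphere (0::'e) 1"
    have "continuous_on ?S (\<lambda>x. f'' x x)"
      by (intro continuous_intros f''.continuous_on)
    then have "\<exists>z\<in>?S. \<forall>x\<in>?S. f'' z z \<le> f'' x x"
      by (intro continuous_attains_inf) auto
    then obtain z where z: "z \<in> ?S" "\<And>x. x \<in> ?S \<Longrightarrow> f'' z z \<le> f'' x x" by blast
    have "f'' z z > 0" using z(1) by (intro pos) auto
    moreover have "f'' z z * (norm x)\<^sup>2 \<le> f'' x x" for x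
    proof (cases "x = 0")
      case False
      define y where "y = (1 / norm x) *\<^sub>R x"
      have y: "y \<in> ?S" "x = norm x *\<^sub>R y" using False by (auto simp: y_def)
      have "f'' x x = f'' y y * (norm x)\<^sup>2"
        by (subst (1 2) y(2)) (simp add: f''.scaleR blinfun.scaleR_left blinfun.scaleR_right power2_eq_square mult_ac)
      then show ?thesis using z(2)[OF y(1)] by (simp add: mult_right_mono)
    qed (simp add: f''.zero)
    ultimately show ?thesis by (rule that)
  qed
  obtain \<delta> where \<delta>: "\<delta> > 0" "\<delta> \<le> \<rho>" "\<And>u. norm u < \<delta> \<Longrightarrow> norm (f' u - f'' u) \<le> k / 4 * norm u"
    "\<And>u. norm u < \<delta> \<Longrightarrow> \<bar>f u - f 0 - f'' u u / 2\<bar> \<le> k / 4 * (norm u)\<^sup>2"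
    using approx[of "k / 4"] k(1) by (metis (no_types, lifting) divide_pos_pos zero_less_numeral)
  show ?thesis
  proof (rule that[of "k / 4" \<delta>])
    fix u :: 'e assume u: "norm u < \<delta>"
    show "f u \<ge> k / 4 * (norm u)\<^sup>2" using \<delta>(4)[OF u] k(2)[of u] min(1) by linarith
    have "\<bar>(f' u - f'' u) u\<bar> \<le> norm (f' u - f'' u) * norm u" using norm_blinfun[of "f' u - f'' u" u] by simp
    also have "\<dots> \<le> k / 4 * norm u * norm u" using \<delta>(3)[OF u] by (intro mult_right_mono) auto
    finally have "\<bar>f' u u - f'' u u\<bar> \<le> k / 4 * (norm u)\<^sup>2"
      by (simp add: blinfun.diff_left power2_eq_square)
    moreover have "0 \<le> k * (norm u)\<^sup>2" using k(1) by simp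
    ultimately show "f' u u \<ge> k / 4 * (norm u)\<^sup>2" using k(2)[of u] by linarith
  qed (use k \<delta> f'0 in auto)
qed

text \<open>Differentiability of \<open>F'\<close> at 0 yields a Lipschitz estimate centred at 0,
  which the mean value inequality integrates. The last bound concerns the radial derivative and
  serves \<open>\<zeta>_taylor\<close>.\<close>

lemma first_order_taylor_bounds:
  fixes F :: "'e::real_normed_vector \<Rightarrow> 'f::real_normed_vector" and F' :: "'e \<Rightarrow> 'e \<Rightarrow>\<^sub>L 'f"
  assumes \<rho>: "\<rho> > 0" and F': "\<And>x. norm x < \<rho> \<Longrightarrow> (F has_derivative blinfun_apply (F' x)) (at x)"
    and F'': "(F' has_derivative F'') (at 0)"
  obtains C \<delta> where "C > 0" "\<delta> > 0" "\<delta> \<le> \<rho>"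
    "\<And>u. norm u < \<delta> \<Longrightarrow> norm (F u - F 0) \<le> C * norm u"
    "\<And>u. norm u < \<delta> \<Longrightarrow> norm (F u - F 0 - F' 0 u) \<le> C * (norm u)\<^sup>2"
    "\<And>u. norm u < \<delta> \<Longrightarrow> norm (F' u u - F' 0 u) \<le> C * (norm u)\<^sup>2"
proof -
  obtain d where d: "d > 0" "\<And>h. norm h \<le> d \<Longrightarrow> norm (F' (0 + h) - F' 0 - F'' h) \<le> 1 * norm h"
    using has_derivative_approx[OF F'', of 1] by auto
  obtain K where K: "K > 0" "\<And>h. norm (F'' h) \<le> norm h * K"
    using bounded_linear.pos_bounded[OF has_derivative_bounded_linear[OF F'']] by blast
  define \<delta> where "\<delta> = min 1 (min d \<rho>)"
  define C where "C = (1 + K) + norm (F' 0)"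
  have lip: "norm (F' u - F' 0) \<le> (1 + K) * norm u" if "norm u < \<delta>" for u
  proof -
    have "norm (F' u - F' 0) \<le> norm (F' u - F' 0 - F'' u) + norm (F'' u)"
      using norm_triangle_ineq[of "F' u - F' 0 - F'' u" "F'' u"] by simp
    also have "\<dots> \<le> 1 * norm u + norm u * K"
      using d(2)[of u] K(2)[of u] that by (intro add_mono) (auto simp: \<delta>_def)
    finally show ?thesis by (simp add: algebra_simps)
  qed
  have C: "1 + K \<le> C" "C > 0" unfolding C_def using K(1) by (auto intro: add_pos_nonneg)
  have t1: "norm (F u - F 0 - F' 0 u) \<le> (1 + K) * (norm u)\<^sup>2" if u: "norm u < \<delta>" for u
  proof -
    have "norm (F u - F 0 - F' 0 (u - 0)) \<le> norm (u - 0) * ((1 + K) * norm u)"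
    proof (rule differentiable_bound_linearization[where S="cball 0 (norm u)" and f'="\<lambda>x. blinfun_apply (F' x)"])
      show "0 + t *\<^sub>R (u - 0) \<in> cball 0 (norm u)" if "t \<in> {0..1}" for t
        using that by (simp add: mult_left_le_one_le)
      fix x :: 'e assume x: "x \<in> cball 0 (norm u)"
      then have nx: "norm x < \<delta>" using u by simp
      show "(F has_derivative blinfun_apply (F' x)) (at x within cball 0 (norm u))"
        by (rule has_derivative_at_withinI, rule F') (use nx in \<open>simp add: \<delta>_def\<close>)
      have "norm (F' x - F' 0) \<le> (1 + K) * norm x" by (rule lip[OF nx])
      also have "\<dots> \<le> (1 + K) * norm u" using x K(1) by simp
      finally show "onorm (blinfun_apply (F' x) - blinfun_apply (F' 0)) \<le> (1 + K) * norm u"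
        unfolding norm_blinfun.rep_eq minus_blinfun.rep_eq fun_diff_def .
    qed simp
    then show ?thesis by (simp add: power2_eq_square mult_ac)
  qed
  show ?thesis
  proof (rule that[of C \<delta>])
    show "C > 0" "\<delta> > 0" "\<delta> \<le> \<rho>" using C d \<rho> by (auto simp: \<delta>_def)
    fix u :: 'e assume u: "norm u < \<delta>"
    show "norm (F u - F 0 - F' 0 u) \<le> C * (norm u)\<^sup>2"
      using t1[OF u] mult_right_mono[OF C(1), of "(norm u)\<^sup>2"] by simp
    have "norm (F u - F 0) \<le> norm (F u - F 0 - F' 0 u) + norm (F' 0 u)"
      using norm_triangle_ineq[of "F u - F 0 - F' 0 u" "F' 0 u"] by simp
    also have "\<dots> \<le> (1 + K) * (norm u)\<^sup>2 + norm (F' 0) * norm u"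
      by (intro add_mono t1[OF u] norm_blinfun)
    also have "\<dots> \<le> (1 + K) * norm u + norm (F' 0) * norm u"
    proof (intro add_right_mono mult_left_mono)
      show "(norm u)\<^sup>2 \<le> norm u" using u by (simp add: \<delta>_def power2_eq_square mult_left_le_one_le)
    qed (use K in auto)
    finally show "norm (F u - F 0) \<le> C * norm u" unfolding C_def by (simp add: algebra_simps)
    have "norm (F' u u - F' 0 u) \<le> norm (F' u - F' 0) * norm u"
      using norm_blinfun[of "F' u - F' 0" u] by (simp add: blinfun.diff_left)
    also have "\<dots> \<le> (1 + K) * norm u * norm u" by (intro mult_right_mono lip[OF u]) auto
    also have "\<dots> = (1 + K) * (norm u)\<^sup>2" by (simp add: power2_eq_square)
    also have "\<dots> \<le> C * (norm u)\<^sup>2" by (intro mult_right_mono C(1)) auto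
    finally show "norm (F' u u - F' 0 u) \<le> C * (norm u)\<^sup>2" .
  qed
qed

section \<open>First-order optimality and Riemannian gradients\<close>

lemma sum_UNIV_option: "(\<Sum>j\<in>UNIV. f j) = f None + (\<Sum>i\<in>UNIV. f (Some i))"
  for f :: "'i::finite option \<Rightarrow> 'b::comm_monoid_add"
  by (simp add: UNIV_option_conv sum.reindex)

lemma vec_integral_sparse_measure:
  fixes \<phi> :: "'a::topological_space \<Rightarrow> 'f::{real_inner,complete_space}"
  assumes "compact (UNIV :: 'a set)" "continuous_on UNIV \<phi>"
  shows "vec_integral (sparse_measure r p) \<phi> = (\<Sum>i\<in>UNIV. (r i)\<^sup>2 *\<^sub>R \<phi> (p i))"
proof -
  have "vec_integral (sparse_measure r p) \<phi> \<bullet> k = (\<Sum>i\<in>UNIV. (r i)\<^sup>2 *\<^sub>R \<phi> (p i)) \<bullet> k" for k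
  proof -
    have "continuous_on UNIV (\<lambda>x. \<phi> x \<bullet> k)" by (intro continuous_intros assms)
    then show ?thesis using vec_integral_inner[OF assms(1) sparse_measure(1) assms(2), of r p k]
      by (simp add: sparse_measure(3) inner_sum_left)
  qed
  then show ?thesis using vector_eq_rdot by blast
qed

lemma objective_sparse_measure:
  fixes \<phi> :: "'a::topological_space \<Rightarrow> 'f::{real_inner,complete_space}"
  assumes "compact (UNIV :: 'a set)" "continuous_on UNIV \<phi>"
  shows "objective \<phi> R lam (sparse_measure r p)
    = R (\<Sum>i\<in>UNIV. (r i)\<^sup>2 *\<^sub>R \<phi> (p i)) + lam * (\<Sum>i\<in>UNIV. (r i)\<^sup>2)"
  unfolding objective_def vec_integral_sparse_measure[OF assms] sparse_measure(2) ..

text \<open>Minimality against adding a small mass at \<open>q\<close>; the competitors are sparse measures indexed by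
  \<open>'m option\<close>.\<close>

lemma objective_deriv_nonneg:
  fixes \<phi> :: "'a::topological_space \<Rightarrow> 'f::{real_inner,complete_space}" and r :: "'m::finite \<Rightarrow> real"
  assumes cpt: "compact (UNIV :: 'a set)" and cont: "continuous_on UNIV \<phi>"
    and grad: "GDERIV R (\<Sum>i\<in>UNIV. (r i)\<^sup>2 *\<^sub>R \<phi> (p i)) :> g"
    and min: "\<And>\<nu>. \<nu> \<in> finite_borel_measures \<Longrightarrow> objective \<phi> R lam (sparse_measure r p) \<le> objective \<phi> R lam \<nu>"
  shows "\<phi> q \<bullet> g + lam \<ge> 0"
proof (rule ccontr)
  assume neg: "\<not> \<phi> q \<bullet> g + lam \<ge> 0"
  define fs where "fs = (\<Sum>i\<in>UNIV. (r i)\<^sup>2 *\<^sub>R \<phi> (p i))"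
  define h where "h t = R (fs + t *\<^sub>R \<phi> q) + lam * t" for t
  have "((\<lambda>t. fs + t *\<^sub>R \<phi> q) has_derivative (\<lambda>t. t *\<^sub>R \<phi> q)) (at 0)"
    by (auto intro!: derivative_eq_intros)
  then have "((R \<circ> (\<lambda>t. fs + t *\<^sub>R \<phi> q)) has_derivative ((\<lambda>h. h \<bullet> g) \<circ> (\<lambda>t. t *\<^sub>R \<phi> q))) (at 0)"
    by (rule diff_chain_at) (use grad in \<open>simp add: gderiv_def fs_def\<close>)
  then have "((\<lambda>t. R (fs + t *\<^sub>R \<phi> q)) has_real_derivative (\<phi> q \<bullet> g)) (at 0)"
    unfolding has_field_derivative_def comp_def by (simp add: mult_commute_abs)
  then have "(h has_real_derivative (\<phi> q \<bullet> g + lam)) (at 0)"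
    unfolding h_def by (auto intro!: derivative_eq_intros)
  then obtain d where d: "d > 0" "\<And>t. t > 0 \<Longrightarrow> t < d \<Longrightarrow> h (0 + t) < h 0"
    using DERIV_neg_dec_right[of h _ 0] neg by (auto simp: not_le)
  define t where "t = d / 2"
  have t: "t > 0" "t < d" using d(1) by (auto simp: t_def)
  \<comment> \<open>\<open>sparse_measure\<close> squares its weights, so the square root adds the
    mass \<open>t\<close> at \<open>q\<close>.\<close>
  define \<nu> where "\<nu> = sparse_measure (case_option (sqrt t) r) (case_option q p)"
  have "objective \<phi> R lam \<nu> = h t + lam * (\<Sum>i\<in>UNIV. (r i)\<^sup>2)"
    unfolding \<nu>_def objective_sparse_measure[OF cpt cont] sum_UNIV_option h_def fs_def
    using t(1) by (simp add: algebra_simps)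
  moreover have "objective \<phi> R lam (sparse_measure r p) = h 0 + lam * (\<Sum>i\<in>UNIV. (r i)\<^sup>2)"
    unfolding objective_sparse_measure[OF cpt cont] h_def fs_def by simp
  moreover have "\<nu> \<in> finite_borel_measures" unfolding \<nu>_def by (rule sparse_measure(1))
  ultimately show False using min[of \<nu>] d(2)[OF t] by simp
qed

text \<open>A nonzero kernel vector makes 0 a singular value, so the infimum could not be
  positive.\<close>

lemma sigma_min_pos_imp_inj:
  assumes "sigma_min B > 0" "B *v x = 0"
  shows "x = 0"
proof (rule ccontr)
  assume "x \<noteq> 0"
  moreover have "(transpose B ** B) *v x = 0"
    using assms(2) by (simp add: matrix_vector_mul_assoc[symmetric])
  ultimately have "0 \<in> singular_values B" unfolding singular_values_def by auto
  moreover have "bdd_below (singular_values B)" unfolding singular_values_def by (intro bdd_belowI[of _ 0]) auto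
  ultimately have "sigma_min B \<le> 0" unfolding sigma_min_def by (intro cInf_lower)
  then show False using assms(1) by simp
qed

lemma matrix_inv_inverse:
  fixes B :: "real^'n^'n"
  assumes "\<And>v. v \<noteq> 0 \<Longrightarrow> v \<bullet> (B *v v) > 0"
  shows "B *v (matrix_inv B *v v) = v" and "det B \<noteq> 0"
proof -
  have "x = 0" if "B *v x = 0" for x using assms[of x] that by force
  then obtain C where C: "C ** B = mat 1" using matrix_left_invertible_ker[of B] by blast
  then have "B ** C = mat 1" using matrix_left_right_inverse by blast
  then have "\<exists>C. B ** C = mat 1 \<and> C ** B = mat 1" using C by blast
  then have "B ** matrix_inv B = mat 1" unfolding matrix_inv_def by (rule someI2_ex) simp
  then show "B *v (matrix_inv B *v v) = v" by (simp add: matrix_vector_mul_assoc)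
  show "det B \<noteq> 0" using C invertible_det_nz invertible_def \<open>B ** C = mat 1\<close> by blast
qed

lemma continuous_on_det:
  fixes M :: "'a::topological_space \<Rightarrow> real^'n^'n"
  assumes "\<And>i j. continuous_on S (\<lambda>x. M x $ i $ j)"
  shows "continuous_on S (\<lambda>x. det (M x))"
  unfolding det_def by (intro continuous_intros assms)

section \<open>Charts, differentials and Riemannian gradients\<close>

lemma is_chartD:
  assumes "is_chart c"
  shows "open (fst c)" "open (snd c ` fst c)" "continuous_on (fst c) (snd c)"
    "p \<in> fst c \<Longrightarrow> inv_into (fst c) (snd c) (snd c p) = p"
    "open U \<Longrightarrow> open (snd c ` (fst c \<inter> U))"
proof -
  let ?g = "inv_into (fst c) (snd c)"
  have h: "homeomorphism (fst c) (snd c ` fst c) (snd c) ?g"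
    and o: "open (fst c)" "open (snd c ` fst c)"
    using assms unfolding is_chart_def by auto
  show "open (fst c)" "open (snd c ` fst c)" by (fact o)+
  show "continuous_on (fst c) (snd c)" using h by (simp add: homeomorphism_def)
  show "?g (snd c p) = p" if "p \<in> fst c" using h that by (simp add: homeomorphism_def)
  show "open (snd c ` (fst c \<inter> U))" if "open U"
  proof -
    have "openin (top_of_set (fst c)) (fst c \<inter> U)" using that by (simp add: openin_open_Int)
    then have "openin (top_of_set (snd c ` fst c)) (snd c ` (fst c \<inter> U))"
      by (rule homeomorphism_imp_open_map[OF h])
    then show ?thesis using o(2) openin_open_eq by blast
  qed
qed

text \<open>The differential as a coordinate vector, before the metric turns it into the Riemannian
  gradient.\<close>

definition coord_grad :: "('a, 'd::finite) chart \<Rightarrow> ('a \<Rightarrow> real) \<Rightarrow> 'a \<Rightarrow> real^'d" where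
  "coord_grad c f p = (\<chi> j. partial j (in_chart c f) (snd c p))"

lemma linear_eq_sum_axis:
  fixes B :: "real^'d \<Rightarrow> 'b::real_vector"
  assumes "linear B"
  shows "B x = (\<Sum>j\<in>UNIV. x $ j *\<^sub>R B (axis j 1))"
proof -
  have "x = (\<Sum>j\<in>UNIV. x $ j *\<^sub>R axis j 1)"
    using basis_expansion[of x] by (simp add: scalar_mult_eq_scaleR)
  then have "B x = B (\<Sum>j\<in>UNIV. x $ j *\<^sub>R axis j 1)" by simp
  then show ?thesis by (simp add: linear_sum[OF assms] linear_scale[OF assms])
qed

lemma coord_grad_inner:
  assumes "(in_chart c f has_derivative B) (at (snd c p))"
  shows "coord_grad c f p \<bullet> x = B x"
proof -
  have "frechet_derivative (in_chart c f) (at (snd c p)) = B"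
    using frechet_derivative_at[OF assms] by simp
  then have "coord_grad c f p $ j = B (axis j 1)" for j by (simp add: coord_grad_def partial_def)
  then show ?thesis
    using linear_eq_sum_axis[OF has_derivative_linear[OF assms], of x] by (simp add: inner_vec_def mult.commute)
qed

lemma riem_gradD:
  assumes "riemannian_metric A G" "c \<in> A" "p \<in> fst c"
  shows "G c p *v riem_grad G c f p = coord_grad c f p"
    and "transpose (G c p) = G c p" and "v \<noteq> 0 \<Longrightarrow> v \<bullet> (G c p *v v) > 0" and "det (G c p) \<noteq> 0"
    and "v \<bullet> (G c p *v v) \<ge> 0"
proof -
  show p: "v \<bullet> (G c p *v v) > 0" if "v \<noteq> 0" for v
    using assms that unfolding riemannian_metric_def by blast
  show "transpose (G c p) = G c p" using assms unfolding riemannian_metric_def by blast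
  show "G c p *v riem_grad G c f p = coord_grad c f p" "det (G c p) \<noteq> 0"
    using matrix_inv_inverse[OF p] unfolding riem_grad_def coord_grad_def by auto
  show "v \<bullet> (G c p *v v) \<ge> 0" using p[of v] by (cases "v = 0") auto
qed

text \<open>Each gradient represents the differential of \<open>f\<close> in its own Gram matrix,
  and the transition derivative \<open>T\<close> is an isometry between the two inner products.
  Hence \<open>T\<close> maps one gradient to the other.\<close>

lemma riem_grad_norm_chart_independent:
  fixes c c' :: "('a::topological_space, 'd::finite) chart"
  assumes M: "riemannian_manifold A G" and c: "c \<in> A" "c' \<in> A" and p: "p \<in> fst c" "p \<in> fst c'"
    and B: "(in_chart c' f has_derivative B) (at (snd c' p))"
  shows "riem_grad G c f p \<bullet> (G c p *v riem_grad G c f p) = riem_grad G c' f p \<bullet> (G c' p *v riem_grad G c' f p)"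
proof -
  have met: "riemannian_metric A G" and ch: "is_chart c" "is_chart c'" and comp: "compatible c c'"
    using M c unfolding riemannian_manifold_def smooth_structure_def by auto
  define \<tau> where "\<tau> = in_chart c (snd c')"
  let ?O = "snd c ` (fst c \<inter> fst c')"
  have O: "open ?O" "snd c p \<in> ?O" using is_chartD[OF ch(1)] is_chartD(1)[OF ch(2)] p by auto
  have "Ck_on 1 ?O \<tau>" using comp unfolding compatible_def smooth_on_def \<tau>_def by blast
  then have "\<tau> differentiable (at (snd c p))" using O(2) by auto
  then obtain T where T: "(\<tau> has_derivative T) (at (snd c p))" unfolding differentiable_def by blast
  have \<tau>p: "\<tau> (snd c p) = snd c' p" unfolding \<tau>_def in_chart_def using is_chartD(4)[OF ch(1) p(1)] by simp
  have "(in_chart c' f \<circ> \<tau> has_derivative B \<circ> T) (at (snd c p))"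
    using T B by (intro diff_chain_at) (simp_all add: \<tau>p)
  then have BT: "(in_chart c f has_derivative B \<circ> T) (at (snd c p))"
  proof (rule has_derivative_transform_within_open[OF _ O])
    fix y assume "y \<in> ?O"
    then show "(in_chart c' f \<circ> \<tau>) y = in_chart c f y"
      using is_chartD(4)[OF ch(1)] is_chartD(4)[OF ch(2)] by (auto simp: in_chart_def \<tau>_def)
  qed
  define D where "D = matrix T"
  have lT: "linear T" using T has_derivative_linear by blast
  have D: "D *v x = T x" for x unfolding D_def using matrix_vector_mul(2)[OF lT] by metis
  have "D = matrix (frechet_derivative (in_chart c (snd c')) (at (snd c p)))"
    unfolding D_def \<tau>_def[symmetric] using frechet_derivative_at[OF T] by simp
  then have GD: "G c p = transpose D ** G c' p ** D"
    using met c p unfolding riemannian_metric_def Let_def by blast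
  define y where "y = riem_grad G c f p"
  define y' where "y' = riem_grad G c' f p"
  have y: "(G c p *v y) \<bullet> x = B (T x)" for x
    unfolding y_def riem_gradD(1)[OF met c(1) p(1)] using coord_grad_inner[OF BT] by simp
  have y': "(G c' p *v y') \<bullet> x = B x" for x
    unfolding y'_def riem_gradD(1)[OF met c(2) p(2)] by (rule coord_grad_inner[OF B])
  have Gx: "(G c p *v z) \<bullet> x = (G c' p *v T z) \<bullet> T x" for x z
    unfolding GD D[symmetric] by (simp only: matrix_vector_mul_assoc[symmetric] transpose_matrix_vector dot_lmul_matrix)
  have "x = 0" if "T x = 0" for x
    using Gx[of x x] riem_gradD(3)[OF met c(1) p(1), of x] that by (force simp: inner_commute)
  then have "inj T" using linear_injective_0[OF lT] by blast
  then have "surj T" using linear_injective_imp_surjective[OF lT] by blast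
  \<comment> \<open>Surjectivity of \<open>T\<close> allows the difference of the two gradients to
    be paired with itself.\<close>
  then obtain x where x: "T x = T y - y'" by (metis surjD)
  have "(G c' p *v (T y - y')) \<bullet> T x = 0"
    using Gx[of y x] y[of x] y'[of "T x"] by (simp add: matrix_vector_mult_diff_distrib inner_diff_left)
  then have "T y - y' = 0"
    using riem_gradD(3)[OF met c(2) p(2), of "T y - y'"] unfolding x by (force simp: inner_commute)
  then have "T y = y'" by simp
  then show ?thesis using y[of y] y'[of y'] unfolding y_def[symmetric] y'_def[symmetric] by (simp add: inner_commute)
qed

text \<open>By Cramer's rule the components of the Riemannian gradient are quotients of determinants.\<close>

lemma continuous_on_riem_grad:
  assumes M: "riemannian_manifold A G" and c: "c \<in> A"
    and v: "continuous_on (fst c) (coord_grad c f)"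
  shows "continuous_on (fst c) (riem_grad G c f)"
proof -
  have met: "riemannian_metric A G" and ch: "is_chart c"
    using M c unfolding riemannian_manifold_def smooth_structure_def by auto
  have "Ck_on 0 (snd c ` fst c) (in_chart c (G c))"
    using met c unfolding riemannian_metric_def smooth_on_def by blast
  then have "continuous_on (fst c) (in_chart c (G c) \<circ> snd c)"
    using is_chartD(3)[OF ch] by (intro continuous_on_compose) auto
  then have G: "continuous_on (fst c) (G c)"
    by (rule continuous_on_eq) (use is_chartD(4)[OF ch] in \<open>simp add: in_chart_def\<close>)
  have "riem_grad G c f p = (\<chi> k. det (\<chi> i j. if j = k then coord_grad c f p $ i else G c p $ i $ j) / det (G c p))"
    if "p \<in> fst c" for p
    by (rule iffD1[OF cramer[OF riem_gradD(4)[OF met c that]] riem_gradD(1)[OF met c that]])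
  moreover have "continuous_on (fst c) (\<lambda>p. \<chi> k. det (\<chi> i j. if j = k then coord_grad c f p $ i else G c p $ i $ j) / det (G c p))"
  proof (intro continuous_on_vec_lambda continuous_on_divide continuous_on_det)
    fix k i j
    show "continuous_on (fst c) (\<lambda>p. (\<chi> i j. if j = k then coord_grad c f p $ i else G c p $ i $ j) $ i $ j)"
      by (cases "j = k") (auto intro!: continuous_intros v G)
    show "continuous_on (fst c) (\<lambda>p. G c p $ i $ j)" by (intro continuous_intros G)
  qed (use riem_gradD(4)[OF met c] in auto)
  ultimately show ?thesis by (simp cong: continuous_on_cong)
qed

text \<open>The definition picks its chart by \<open>SOME\<close>; chart independence lets any chart
  around \<open>p\<close> replace it.\<close>

lemma riem_grad_norm_sq_eq:
  assumes M: "riemannian_manifold A G" and c: "c \<in> A" and p: "p \<in> fst c"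
    and B: "(in_chart c f has_derivative B) (at (snd c p))"
  shows "riem_grad_norm_sq A G f p = riem_grad G c f p \<bullet> coord_grad c f p"
proof -
  have met: "riemannian_metric A G" using M unfolding riemannian_manifold_def by auto
  define c0 where "c0 = (SOME c. c \<in> A \<and> p \<in> fst c)"
  have c0: "c0 \<in> A \<and> p \<in> fst c0" unfolding c0_def by (rule someI[of _ c]) (use c p in auto)
  show ?thesis unfolding riem_grad_norm_sq_def Let_def c0_def[symmetric]
    using riem_grad_norm_chart_independent[OF M _ c _ p B] c0 riem_gradD(1)[OF met c p] by metis
qed

lemma continuous_on_riem_grad_norm_sq:
  fixes A :: "('a::topological_space, 'd::finite) chart set"
  assumes M: "riemannian_manifold A G"
    and diff: "\<And>c p. c \<in> A \<Longrightarrow> p \<in> fst c \<Longrightarrow> in_chart c f differentiable (at (snd c p))"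
    and v: "\<And>c. c \<in> A \<Longrightarrow> continuous_on (fst c) (coord_grad c f)"
  shows "continuous_on UNIV (riem_grad_norm_sq A G f)"
proof -
  have cov: "(\<Union>c\<in>A. fst c) = UNIV" and ch: "\<And>c. c \<in> A \<Longrightarrow> is_chart c"
    using M unfolding riemannian_manifold_def smooth_structure_def by (blast, blast)
  have "continuous_on (\<Union>c\<in>A. fst c) (riem_grad_norm_sq A G f)"
  proof (rule continuous_on_open_UN)
    fix c assume c: "c \<in> A"
    show "open (fst c)" using is_chartD(1)[OF ch[OF c]] .
    have "continuous_on (fst c) (\<lambda>p. riem_grad G c f p \<bullet> coord_grad c f p)"
      by (intro continuous_intros continuous_on_riem_grad[OF M c] v c)
    moreover have "riem_grad G c f p \<bullet> coord_grad c f p = riem_grad_norm_sq A G f p" if p: "p \<in> fst c" for p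
      using diff[OF c p] riem_grad_norm_sq_eq[OF M c p] unfolding differentiable_def by metis
    ultimately show "continuous_on (fst c) (riem_grad_norm_sq A G f)" using continuous_on_eq by blast
  qed
  then show ?thesis by (simp add: cov)
qed

text \<open>Expanding the metric square of \<open>m *\<^sub>R y - x\<close>, for \<open>y\<close>
  the gradient, gives the inequality, because pairing \<open>y\<close> with \<open>x\<close> in the
  metric is \<open>B x\<close>.\<close>

lemma riem_grad_norm_sq_young:
  assumes M: "riemannian_manifold A G" and c: "c \<in> A" and p: "p \<in> fst c"
    and B: "(in_chart c f has_derivative B) (at (snd c p))" and m: "m > 0"
  shows "B x \<le> m / 2 * riem_grad_norm_sq A G f p + 1 / (2 * m) * (x \<bullet> (G c p *v x))"
    and "riem_grad_norm_sq A G f p \<ge> 0"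
proof -
  have met: "riemannian_metric A G" using M unfolding riemannian_manifold_def by auto
  note rg = riem_gradD[OF met c p]
  define y where "y = riem_grad G c f p"
  have n: "riem_grad_norm_sq A G f p = y \<bullet> (G c p *v y)"
    unfolding riem_grad_norm_sq_eq[OF M c p B] y_def rg(1) ..
  show "riem_grad_norm_sq A G f p \<ge> 0" unfolding n by (rule rg(5))
  have Bx: "B x = x \<bullet> (G c p *v y)"
    using coord_grad_inner[OF B, of x] unfolding y_def rg(1) by (simp add: inner_commute)
  have sym: "y \<bullet> (G c p *v x) = x \<bullet> (G c p *v y)"
    by (metis dot_lmul_matrix inner_commute rg(2) vector_transpose_matrix)
  have "0 \<le> (m *\<^sub>R y - x) \<bullet> (G c p *v (m *\<^sub>R y - x)) / (2 * m)"
    using rg(5) m by (intro divide_nonneg_pos) auto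
  also have "\<dots> = m / 2 * (y \<bullet> (G c p *v y)) + 1 / (2 * m) * (x \<bullet> (G c p *v x)) - x \<bullet> (G c p *v y)"
    using m sym by (simp add: matrix_vector_mult_diff_distrib matrix_vector_mult_scaleR inner_diff_left inner_diff_right field_simps)
  finally show "B x \<le> m / 2 * riem_grad_norm_sq A G f p + 1 / (2 * m) * (x \<bullet> (G c p *v x))"
    unfolding n Bx by simp
qed

section \<open>Charts around the minimizer\<close>

lemma has_derivative_inner_blinfun:
  fixes F :: "'e::real_normed_vector \<Rightarrow> 'f::real_inner" and F' :: "'e \<Rightarrow> 'e \<Rightarrow>\<^sub>L 'f"
  assumes "(F has_derivative blinfun_apply (F' x)) (at x)"
  shows "((\<lambda>u. F u \<bullet> g + lam) has_derivative blinfun_apply (blinfun_inner_left g o\<^sub>L F' x)) (at x)"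
proof -
  have "((\<lambda>u. F u \<bullet> g + lam) has_derivative (\<lambda>h. F' x h \<bullet> g)) (at x)"
    by (auto intro!: derivative_eq_intros assms)
  moreover have "blinfun_apply (blinfun_inner_left g o\<^sub>L F' x) = (\<lambda>h. F' x h \<bullet> g)" by auto
  ultimately show ?thesis by simp
qed

lemma has_second_derivative_inner_blinfun:
  fixes F' :: "'e::real_normed_vector \<Rightarrow> 'e \<Rightarrow>\<^sub>L 'f::real_inner"
  assumes "(F' has_derivative F'') (at x)"
  shows "((\<lambda>x. blinfun_inner_left g o\<^sub>L F' x) has_derivative (\<lambda>h. blinfun_inner_left g o\<^sub>L F'' h)) (at x)"
  using bounded_linear.has_derivative[OF bounded_bilinear.bounded_linear_right[OF bounded_bilinear_blinfun_compose] assms] .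

text \<open>The matrix entries are \<open>f''\<close> on pairs of basis vectors, and symmetry turns
  a row applied to \<open>u\<close> into a component of \<open>f'' u\<close>. A kernel vector of
  \<open>f''\<close> would thus be one of the matrix.\<close>

lemma hessian_matrix_inj:
  fixes f :: "'a \<Rightarrow> real" and f' :: "real^'d::finite \<Rightarrow> (real^'d) \<Rightarrow>\<^sub>L real"
  assumes sig: "sigma_min (b *\<^sub>R hessian_matrix c f p) > 0"
    and p: "snd c p = 0" and \<rho>: "\<rho> > 0"
    and f': "\<And>x. norm x < \<rho> \<Longrightarrow> (in_chart c f has_derivative blinfun_apply (f' x)) (at x)"
    and f'': "(f' has_derivative f'') (at 0)" and u: "u \<noteq> 0"
  shows "f'' u \<noteq> 0"
proof
  assume z: "f'' u = 0"
  interpret f'': bounded_linear f'' using f'' has_derivative_bounded_linear by blast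
  have part: "partial j (partial k (in_chart c f)) 0 = f'' (axis j 1) (axis k 1)" for j k
  proof -
    have "((\<lambda>x. f' x (axis k 1)) has_derivative (\<lambda>h. f'' h (axis k 1))) (at 0)"
      using bounded_linear.has_derivative[OF blinfun.bounded_linear_left f''] .
    then have "(partial k (in_chart c f) has_derivative (\<lambda>h. f'' h (axis k 1))) (at 0)"
    proof (rule has_derivative_transform_within_open)
      show "open (ball (0::real^'d) \<rho>)" "0 \<in> ball (0::real^'d) \<rho>" using \<rho> by auto
      fix x :: "real^'d" assume "x \<in> ball 0 \<rho>"
      then have "frechet_derivative (in_chart c f) (at x) = blinfun_apply (f' x)"
        using frechet_derivative_at[OF f'[of x]] by simp
      then show "f' x (axis k 1) = partial k (in_chart c f) x" by (simp add: partial_def)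
    qed
    then have "frechet_derivative (partial k (in_chart c f)) (at 0) = (\<lambda>h. f'' h (axis k 1))"
      using frechet_derivative_at by metis
    then show ?thesis by (subst partial_def) simp
  qed
  have "(hessian_matrix c f p *v u) $ j = 0" for j
  proof -
    have "(hessian_matrix c f p *v u) $ j = (\<Sum>k\<in>UNIV. u $ k * f'' (axis j 1) (axis k 1))"
      unfolding hessian_matrix_def matrix_vector_mult_def p by (simp add: part mult.commute)
    also have "\<dots> = f'' (axis j 1) u"
      using linear_eq_sum_axis[OF bounded_linear.linear[OF blinfun.bounded_linear_right], of "f'' (axis j 1)" u] by simp
    also have "\<dots> = f'' u (axis j 1)" by (rule second_derivative_symmetric[OF \<rho> f' f''])
    finally show ?thesis by (simp add: z)
  qed
  then have "hessian_matrix c f p *v u = 0" by (simp add: vec_eq_iff)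
  then have "(b *\<^sub>R hessian_matrix c f p) *v u = 0" by (simp add: scaleR_matrix_vector_assoc[symmetric])
  then show False using sigma_min_pos_imp_inj[OF sig] u by blast
qed

text \<open>The kernel matrix is the Gram matrix of the scaled conic gradients in the form given by
  the Hessian of \<open>R\<close>; a linear relation among these vectors gives a kernel
  vector.\<close>

lemma kernel_matrix_independent:
  fixes \<phi> :: "'a \<Rightarrow> 'f::real_inner" and L :: "'m::finite \<Rightarrow> real^'d::finite \<Rightarrow> 'f"
  assumes sig: "sigma_min (kernel_matrix \<alpha> \<beta> c \<phi> R f r p) > 0"
    and pos: "\<alpha> > 0" "\<beta> > 0" "\<And>i. r i > 0"
    and H: "linear (hessian_op R f)"
    and L: "\<And>i. (in_chart (c i) \<phi> has_derivative L i) (at (snd (c i) (p i)))"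
    and zero: "(\<Sum>i\<in>UNIV. a i *\<^sub>R \<phi> (p i) + L i (b i)) = 0"
  shows "\<forall>i. a i = 0 \<and> b i = 0"
proof -
  \<comment> \<open>The denominators undo the factors \<open>r i\<close>,
    \<open>2 * \<alpha>\<close> and \<open>\<beta>\<close>, so that \<open>v\<close> combines the
    vectors \<open>\<psi>\<close> into the given relation.\<close>
  define v :: "real^('m \<times> 'd option)" where
    "v = (\<chi> k. case k of (i, None) \<Rightarrow> a i / (r i * (2 * \<alpha>)) | (i, Some j) \<Rightarrow> b i $ j / (r i * \<beta>))"
  define \<psi> where "\<psi> k = (case k of (i, j) \<Rightarrow> r i *\<^sub>R conic_gradient \<alpha> \<beta> (c i) \<phi> (p i) j)" for k
  have par: "partial j (in_chart (c i) \<phi>) (snd (c i) (p i)) = L i (axis j 1)" for i j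
    unfolding partial_def using frechet_derivative_at[OF L[of i]] by metis
  have "(\<Sum>k\<in>UNIV. v $ k *\<^sub>R \<psi> k) = (\<Sum>i\<in>UNIV. \<Sum>j\<in>UNIV. v $ (i, j) *\<^sub>R \<psi> (i, j))"
    by (simp add: sum.cartesian_product flip: UNIV_Times_UNIV)
  also have "\<dots> = (\<Sum>i\<in>UNIV. a i *\<^sub>R \<phi> (p i) + L i (b i))"
  proof (rule sum.cong[OF refl])
    fix i
    have ri: "r i \<noteq> 0" using pos(3)[of i] by simp
    have "(\<Sum>j\<in>UNIV. v $ (i, j) *\<^sub>R \<psi> (i, j)) = a i *\<^sub>R \<phi> (p i) + (\<Sum>j\<in>UNIV. b i $ j *\<^sub>R L i (axis j 1))"
      unfolding sum_UNIV_option using pos(1,2) ri by (simp add: v_def \<psi>_def conic_gradient_def par)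
    then show "(\<Sum>j\<in>UNIV. v $ (i, j) *\<^sub>R \<psi> (i, j)) = a i *\<^sub>R \<phi> (p i) + L i (b i)"
      using linear_eq_sum_axis[OF has_derivative_linear[OF L[of i]], of "b i"] by simp
  qed
  finally have comb: "(\<Sum>k\<in>UNIV. v $ k *\<^sub>R \<psi> k) = 0" using zero by simp
  have "(kernel_matrix \<alpha> \<beta> c \<phi> R f r p *v v) $ k = 0" for k
  proof -
    have "(kernel_matrix \<alpha> \<beta> c \<phi> R f r p *v v) $ k = (\<Sum>l\<in>UNIV. (\<psi> k \<bullet> hessian_op R f (\<psi> l)) * v $ l)"
      unfolding matrix_vector_mult_def kernel_matrix_def \<psi>_def by (auto intro!: sum.cong split: prod.splits)
    also have "\<dots> = \<psi> k \<bullet> hessian_op R f (\<Sum>l\<in>UNIV. v $ l *\<^sub>R \<psi> l)"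
      by (simp add: linear_sum[OF H] linear_scale[OF H] inner_sum_right mult.commute)
    finally show ?thesis by (simp add: comb linear_0[OF H])
  qed
  then have "kernel_matrix \<alpha> \<beta> c \<phi> R f r p *v v = 0" by (simp add: vec_eq_iff)
  then have v0: "v = 0" using sigma_min_pos_imp_inj[OF sig] by blast
  have "a i = 0" for i
  proof -
    have "v $ (i, None) = 0" using v0 by simp
    then show ?thesis using pos(1) pos(3)[of i] by (simp add: v_def)
  qed
  moreover have "b i $ j = 0" for i j
  proof -
    have "v $ (i, Some j) = 0" using v0 by simp
    then show ?thesis using pos(2) pos(3)[of i] by (simp add: v_def)
  qed
  ultimately show ?thesis by (simp add: vec_eq_iff)
qed

lemma inner_matrix_vector_le:
  fixes B :: "real^'n^'n"
  shows "x \<bullet> (B *v x) \<le> real CARD('n) * norm B * (norm x)\<^sup>2"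
proof -
  have "norm (B *v x) \<le> (\<Sum>k\<in>UNIV. \<bar>(B *v x) $ k\<bar>)" by (rule norm_le_l1_cart)
  also have "\<dots> \<le> (\<Sum>k\<in>(UNIV :: 'n set). norm B * norm x)"
  proof (rule sum_mono)
    fix k
    have "\<bar>(B *v x) $ k\<bar> \<le> norm (B $ k) * norm x"
      using Cauchy_Schwarz_ineq2[of "B $ k" x] by (simp add: matrix_vector_mult_def inner_vec_def)
    also have "\<dots> \<le> norm B * norm x" by (intro mult_right_mono Finite_Cartesian_Product.norm_nth_le) auto
    finally show "\<bar>(B *v x) $ k\<bar> \<le> norm B * norm x" .
  qed
  finally have "norm (B *v x) \<le> real CARD('n) * (norm B * norm x)" by simp
  then have "norm x * norm (B *v x) \<le> norm x * (real CARD('n) * (norm B * norm x))" by (rule mult_left_mono) simp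
  then show ?thesis using norm_cauchy_schwarz[of x "B *v x"] by (simp add: power2_eq_square mult_ac)
qed

lemma in_chart_apply: "is_chart c \<Longrightarrow> p \<in> fst c \<Longrightarrow> in_chart c h (snd c p) = h p"
  by (simp add: in_chart_def is_chartD(4))

text \<open>Gathers, for one atom, the estimates that \<open>sparse_landscape\<close> asks for near
  it: the Taylor bounds for \<phi>, two-sided quadratic bounds for the derivative of the objective,
  radial growth, and a bound for the metric.\<close>

lemma local_model_near_minimum:
  fixes c :: "('a::topological_space, 'd::finite) chart" and \<phi> :: "'a \<Rightarrow> 'f::real_inner"
    and F' :: "real^'d \<Rightarrow> (real^'d) \<Rightarrow>\<^sub>L 'f"
  assumes M: "riemannian_manifold A G" and c: "c \<in> A" and p0: "p0 \<in> fst c" "snd c p0 = 0"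
    and F': "\<And>x. x \<in> snd c ` fst c \<Longrightarrow> (in_chart c \<phi> has_derivative blinfun_apply (F' x)) (at x)"
    and F'': "(F' has_derivative F'') (at 0)"
    and min: "\<And>p. \<phi> p \<bullet> g + lam \<ge> 0" "\<phi> p0 \<bullet> g + lam = 0"
    and sig: "sigma_min (b *\<^sub>R hessian_matrix c (\<lambda>p. \<phi> p \<bullet> g + lam) p0) > 0"
    and U: "open U" "p0 \<in> U"
  shows "\<exists>\<rho> C k \<Lambda>. 0 < \<rho> \<and> \<rho> \<le> 1 \<and> 0 < C \<and> 0 < k \<and> 0 < \<Lambda> \<and> (\<forall>p\<in>fst c. norm (snd c p) < \<rho> \<longrightarrow>
      p \<in> U \<and>
      norm (\<phi> p - \<phi> p0) \<le> C * norm (snd c p) \<and>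
      norm (\<phi> p - \<phi> p0 - F' 0 (snd c p)) \<le> C * (norm (snd c p))\<^sup>2 \<and>
      norm (F' (snd c p) (snd c p) - F' 0 (snd c p)) \<le> C * (norm (snd c p))\<^sup>2 \<and>
      k * (norm (snd c p))\<^sup>2 \<le> \<phi> p \<bullet> g + lam \<and>
      \<phi> p \<bullet> g + lam \<le> C * (norm (snd c p))\<^sup>2 \<and>
      k * (norm (snd c p))\<^sup>2 \<le> F' (snd c p) (snd c p) \<bullet> g \<and>
      snd c p \<bullet> (G c p *v snd c p) \<le> \<Lambda> * (norm (snd c p))\<^sup>2)"
proof -
  have met: "riemannian_metric A G" and ch: "is_chart c"
    using M c unfolding riemannian_manifold_def smooth_structure_def by auto
  note chD = is_chartD[OF ch]
  have "open (snd c ` (fst c \<inter> U))" "0 \<in> snd c ` (fst c \<inter> U)"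
    using chD(5)[OF U(1)] p0 U(2) by (blast, metis IntI imageI)
  then obtain \<rho>0 where \<rho>0: "\<rho>0 > 0" "ball 0 \<rho>0 \<subseteq> snd c ` (fst c \<inter> U)"
    using open_contains_ball by blast
  have in_im: "x \<in> snd c ` fst c" if "norm x < \<rho>0" for x
  proof -
    have "x \<in> snd c ` (fst c \<inter> U)" using \<rho>0(2) that by auto
    then show ?thesis by blast
  qed
  \<comment> \<open>Small coordinates are attained inside \<open>U\<close>, and injectivity of the
    chart excludes any other point with the same coordinates.\<close>
  have pU: "p \<in> U" if "p \<in> fst c" "norm (snd c p) < \<rho>0" for p
  proof -
    have "snd c p \<in> snd c ` (fst c \<inter> U)" using \<rho>0(2) that(2) by auto
    then obtain q where q: "q \<in> fst c" "q \<in> U" "snd c p = snd c q" by blast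
    have "p = q" by (rule trans[OF chD(4)[OF that(1), symmetric], unfolded q(3), OF chD(4)[OF q(1)]])
    then show ?thesis using q(2) by simp
  qed
  note at = in_chart_apply[OF ch]
  note at0 = in_chart_apply[OF ch p0(1), unfolded p0(2)]
  define f' where "f' x = blinfun_inner_left g o\<^sub>L F' x" for x
  define f'' where "f'' h = blinfun_inner_left g o\<^sub>L F'' h" for h
  let ?f = "in_chart c (\<lambda>p. \<phi> p \<bullet> g + lam)"
  have feq: "?f = (\<lambda>u. in_chart c \<phi> u \<bullet> g + lam)" by (auto simp: in_chart_def)
  have df: "(?f has_derivative blinfun_apply (f' x)) (at x)" if "norm x < \<rho>0" for x
    unfolding feq f'_def by (rule has_derivative_inner_blinfun[where F'=F', OF F'[OF in_im[OF that]]])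
  have ddf: "(f' has_derivative f'') (at 0)"
    unfolding f'_def[abs_def] f''_def[abs_def] by (rule has_second_derivative_inner_blinfun[OF F''])
  have inj: "f'' u \<noteq> 0" if "u \<noteq> 0" for u
    by (rule hessian_matrix_inj[OF sig p0(2) \<rho>0(1) df ddf that])
  have f0: "?f 0 = 0" using at0[of "\<lambda>p. \<phi> p \<bullet> g + lam"] min(2) by simp
  have fpos: "?f x \<ge> 0" for x using min(1) by (simp add: in_chart_def)
  obtain k \<delta>1 where k: "k > 0" "\<delta>1 > 0" "\<delta>1 \<le> \<rho>0" "f' 0 = 0"
    "\<And>u. norm u < \<delta>1 \<Longrightarrow> ?f u \<ge> k * (norm u)\<^sup>2"
    "\<And>u. norm u < \<delta>1 \<Longrightarrow> f' u u \<ge> k * (norm u)\<^sup>2"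
    using nondegenerate_minimum[OF \<rho>0(1) df ddf f0 fpos inj] by metis
  obtain C0 \<delta>2 where C0: "C0 > 0" "\<delta>2 > 0" "\<delta>2 \<le> \<rho>0"
    "\<And>u. norm u < \<delta>2 \<Longrightarrow> norm (in_chart c \<phi> u - in_chart c \<phi> 0) \<le> C0 * norm u"
    "\<And>u. norm u < \<delta>2 \<Longrightarrow> norm (in_chart c \<phi> u - in_chart c \<phi> 0 - F' 0 u) \<le> C0 * (norm u)\<^sup>2"
    "\<And>u. norm u < \<delta>2 \<Longrightarrow> norm (F' u u - F' 0 u) \<le> C0 * (norm u)\<^sup>2"
    using first_order_taylor_bounds[OF \<rho>0(1) F'[OF in_im] F''] by metis
  \<comment> \<open>Continuity of the Gram matrix at the centre bounds the metric nearby, which is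
    the source of \<open>\<Lambda>\<close>.\<close>
  have "Ck_on 0 (snd c ` fst c) (in_chart c (G c))"
    using met c unfolding riemannian_metric_def smooth_on_def by blast
  then have "isCont (in_chart c (G c)) 0"
    using continuous_on_eq_continuous_at[OF chD(2)] in_im[of 0] \<rho>0(1) by (metis Ck_on.simps(1) norm_zero)
  then have "eventually (\<lambda>u. norm (in_chart c (G c) u) < norm (in_chart c (G c) 0) + 1) (nhds 0)"
    by (intro order_tendstoD(2)[where y="norm (in_chart c (G c) 0)"])
       (auto simp: isCont_def tendsto_nhds_iff intro: tendsto_norm)
  then obtain \<delta>3 where \<delta>3: "\<delta>3 > 0" "\<And>u. norm u < \<delta>3 \<Longrightarrow> norm (in_chart c (G c) u) < norm (in_chart c (G c) 0) + 1"
    unfolding eventually_nhds_metric by (auto simp: dist_norm)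
  define \<rho> where "\<rho> = min (min 1 \<delta>1) (min \<delta>2 \<delta>3)"
  define \<Lambda> where "\<Lambda> = real CARD('d) * (norm (in_chart c (G c) 0) + 1)"
  \<comment> \<open>The factor involving \<open>norm g\<close> pays for pairing the Taylor remainder
    with \<open>g\<close> in the upper quadratic bound.\<close>
  define C where "C = C0 * (1 + norm g)"
  have C: "C0 \<le> C" "C > 0" "C0 * norm g \<le> C"
    unfolding C_def using C0(1) by (auto simp: distrib_left intro: add_pos_nonneg)
  have \<Lambda>: "\<Lambda> > 0" unfolding \<Lambda>_def by (intro mult_pos_pos add_nonneg_pos) auto
  show ?thesis
  proof (rule exI[of _ \<rho>], rule exI[of _ C], rule exI[of _ k], rule exI[of _ \<Lambda>], intro conjI ballI impI)
    show "0 < \<rho>" "\<rho> \<le> 1" unfolding \<rho>_def using k C0 \<delta>3 by auto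
    fix p assume p: "p \<in> fst c" and u: "norm (snd c p) < \<rho>"
    let ?u = "snd c p"
    have u': "norm ?u < \<delta>1" "norm ?u < \<delta>2" "norm ?u < \<delta>3" "norm ?u < \<rho>0"
      using u k(3) unfolding \<rho>_def by auto
    show "p \<in> U" by (rule pU[OF p u'(4)])
    have le: "C0 * x \<le> C * x" if "x \<ge> 0" for x using C(1) that by (rule mult_right_mono)
    show "norm (\<phi> p - \<phi> p0) \<le> C * norm ?u"
      using C0(4)[OF u'(2)] le[of "norm ?u"] by (simp add: at[OF p] at0)
    have t: "norm (\<phi> p - \<phi> p0 - F' 0 ?u) \<le> C0 * (norm ?u)\<^sup>2"
      using C0(5)[OF u'(2)] by (simp add: at[OF p] at0)
    then show "norm (\<phi> p - \<phi> p0 - F' 0 ?u) \<le> C * (norm ?u)\<^sup>2"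
      using le[of "(norm ?u)\<^sup>2"] by simp
    show "norm (F' ?u ?u - F' 0 ?u) \<le> C * (norm ?u)\<^sup>2"
      using C0(6)[OF u'(2)] le[of "(norm ?u)\<^sup>2"] by simp
    show "k * (norm ?u)\<^sup>2 \<le> \<phi> p \<bullet> g + lam" using k(5)[OF u'(1)] by (simp add: at[OF p])
    show "k * (norm ?u)\<^sup>2 \<le> F' ?u ?u \<bullet> g" using k(6)[OF u'(1)] by (simp add: f'_def)
    \<comment> \<open>The centre is a critical point, so only the second-order remainder
      contributes.\<close>
    have "F' 0 ?u \<bullet> g = 0"
    proof -
      have "blinfun_apply (f' 0) ?u = 0" using k(4) by simp
      then show ?thesis by (simp add: f'_def)
    qed
    then have "\<phi> p \<bullet> g + lam = (\<phi> p - \<phi> p0 - F' 0 ?u) \<bullet> g"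
      using min(2) by (simp add: inner_diff_left)
    also have "\<dots> \<le> norm (\<phi> p - \<phi> p0 - F' 0 ?u) * norm g" by (rule norm_cauchy_schwarz)
    also have "\<dots> \<le> (C0 * (norm ?u)\<^sup>2) * norm g" by (intro mult_right_mono t) auto
    also have "\<dots> = (C0 * norm g) * (norm ?u)\<^sup>2" by simp
    also have "\<dots> \<le> C * (norm ?u)\<^sup>2" by (intro mult_right_mono C(3)) auto
    finally show "\<phi> p \<bullet> g + lam \<le> C * (norm ?u)\<^sup>2" .
    have "?u \<bullet> (G c p *v ?u) \<le> real CARD('d) * norm (G c p) * (norm ?u)\<^sup>2" by (rule inner_matrix_vector_le)
    also have "\<dots> \<le> \<Lambda> * (norm ?u)\<^sup>2" unfolding \<Lambda>_def
      using \<delta>3(2)[OF u'(3)] by (intro mult_right_mono mult_left_mono) (auto simp: at[OF p])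
    finally show "?u \<bullet> (G c p *v ?u) \<le> \<Lambda> * (norm ?u)\<^sup>2" .
  qed (use k C \<Lambda> in auto)
qed

lemma separating_neighbourhoods:
  fixes p :: "'m::finite \<Rightarrow> 'a::t2_space"
  assumes "inj p"
  obtains U where "\<And>i. open (U i)" "\<And>i. p i \<in> U i" "\<And>i j. i \<noteq> j \<Longrightarrow> U i \<inter> U j = {}"
proof -
  have "\<forall>i j. \<exists>V W. i \<noteq> j \<longrightarrow> open V \<and> open W \<and> p i \<in> V \<and> p j \<in> W \<and> V \<inter> W = {}"
    using assms by (metis hausdorff injD)
  then obtain V W where VW: "\<And>i j. i \<noteq> j \<Longrightarrow> open (V i j) \<and> open (W i j) \<and> p i \<in> V i j \<and> p j \<in> W i j \<and> V i j \<inter> W i j = {}"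
    by metis
  define U where "U i = (\<Inter>j\<in>-{i}. V i j \<inter> W j i)" for i
  show ?thesis
  proof (rule that[of U])
    show "open (U i)" for i unfolding U_def using VW by (intro open_INT) auto
    show "p i \<in> U i" for i unfolding U_def using VW by auto
    show "U i \<inter> U j = {}" if "i \<noteq> j" for i j
      using VW[OF that] that unfolding U_def by blast
  qed
qed

theorem theorem3p3:
  fixes A :: "('a::{t2_space, second_countable_topology}, 'd::finite) chart set"
    and G :: "('a, 'd) chart \<Rightarrow> 'a \<Rightarrow> real^'d^'d"
    and \<phi> :: "'a \<Rightarrow> 'f::{real_inner, complete_space}"
    and R :: "'f \<Rightarrow> real"
    and lam :: real
    and r :: "'m::finite \<Rightarrow> real"
    and \<theta> :: "'m \<Rightarrow> 'a"
    and c :: "'m \<Rightarrow> ('a, 'd) chart"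
    and \<alpha>\<^sub>0 \<beta>\<^sub>0 :: real
  assumes "compact (UNIV :: 'a set)"
    and "riemannian_manifold A G"
    and "lam > 0"
    and "\<forall>c\<in>A. twice_diff_loc_lipschitz_on (snd c ` fst c) (in_chart c \<phi>)"
    and "\<forall>f. R f \<ge> 0"
    and "twice_diff_loc_lipschitz_on UNIV R"
    and "\<forall>b. bounded (gradient R ` {f. R f \<le> b})"
    and "convex_on UNIV R"
    and "unique_minimizer_on (objective \<phi> R lam) finite_borel_measures (sparse_measure r \<theta>)"
    and "measure (sparse_measure r \<theta>) UNIV > 0"
    and "\<forall>i. r i > 0"
    and "inj \<theta>"
    and "\<forall>i. normal_coordinates A G (\<theta> i) (c i)"
    and "\<alpha>\<^sub>0 > 0" and "\<beta>\<^sub>0 > 0"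
    and "nondegenerate \<alpha>\<^sub>0 \<beta>\<^sub>0 c \<phi> R lam r \<theta>"
  shows "\<exists>J\<^sub>0 \<kappa>\<^sub>0. J\<^sub>0 > objective_inf \<phi> R lam \<and> \<kappa>\<^sub>0 > 0 \<and>
    (\<forall>\<nu>\<in>finite_borel_measures. objective \<phi> R lam \<nu> \<le> J\<^sub>0 \<longrightarrow>
      (\<forall>\<alpha>>0. \<forall>\<beta>>0.
        1 / 2 * grad_norm_sq A G \<phi> R lam \<alpha> \<beta> \<nu>
          \<ge> \<kappa>\<^sub>0 * min \<alpha> \<beta> * (objective \<phi> R lam \<nu> - objective_inf \<phi> R lam)))"
proof -
  note cpt = assms(1) and M = assms(2) and conv = assms(8) and r_pos = assms(11)
  have met: "riemannian_metric A G" and str: "smooth_structure A"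
    using M unfolding riemannian_manifold_def by auto
  have ch: "is_chart c" if "c \<in> A" for c using str that unfolding smooth_structure_def by blast
  have cov: "(\<Union>c\<in>A. fst c) = UNIV" using str unfolding smooth_structure_def by blast
  have "\<forall>c\<in>A. \<exists>F' F''. \<forall>x\<in>snd c ` fst c. (in_chart c \<phi> has_derivative blinfun_apply (F' x)) (at x) \<and>
      (F' has_derivative blinfun_apply (F'' x)) (at x)"
    using assms(4) unfolding twice_diff_loc_lipschitz_on_def by blast
  then obtain F1 :: "('a, 'd) chart \<Rightarrow> real^'d \<Rightarrow> (real^'d) \<Rightarrow>\<^sub>L 'f" and F2
    where F: "\<And>c x. c \<in> A \<Longrightarrow> x \<in> snd c ` fst c \<Longrightarrow> (in_chart c \<phi> has_derivative blinfun_apply (F1 c x)) (at x)"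
      "\<And>c x. c \<in> A \<Longrightarrow> x \<in> snd c ` fst c \<Longrightarrow> (F1 c has_derivative blinfun_apply (F2 c x)) (at x)"
    by metis
  have cont: "continuous_on UNIV \<phi>"
  proof -
    have "continuous_on (\<Union>c\<in>A. fst c) \<phi>"
    proof (rule continuous_on_open_UN)
      fix c assume c: "c \<in> A"
      show "open (fst c)" by (rule is_chartD(1)[OF ch[OF c]])
      have "continuous_on (snd c ` fst c) (in_chart c \<phi>)"
        using F(1)[OF c] has_derivative_continuous by (intro continuous_at_imp_continuous_on) blast
      then have "continuous_on (fst c) (in_chart c \<phi> \<circ> snd c)"
        using is_chartD(3)[OF ch[OF c]] by (intro continuous_on_compose)
      then show "continuous_on (fst c) \<phi>"
        by (rule continuous_on_eq) (simp add: in_chart_apply[OF ch[OF c]])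
    qed
    then show ?thesis by (simp add: cov)
  qed
  define fs where "fs = vec_integral (sparse_measure r \<theta>) \<phi>"
  have fs: "fs = (\<Sum>i\<in>UNIV. (r i)\<^sup>2 *\<^sub>R \<phi> (\<theta> i))"
    unfolding fs_def by (rule vec_integral_sparse_measure[OF cpt cont])
  note gR = twice_diff_gradient[OF assms(6)]
  define g where "g = gradient R fs"
  define f where "f h p = \<phi> p \<bullet> h + lam" for h p
  have J': "objective_deriv \<phi> R lam (sparse_measure r \<theta>) = f g"
    unfolding objective_deriv_def fs_def[symmetric] g_def[symmetric] f_def by simp
  note nd = assms(16)[unfolded nondegenerate_def Let_def J' fs_def[symmetric]]
  have minm: "objective \<phi> R lam (sparse_measure r \<theta>) \<le> objective \<phi> R lam \<nu>" if "\<nu> \<in> finite_borel_measures" for \<nu>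
    using assms(9) that unfolding unique_minimizer_on_def by blast
  have fg_nonneg: "f g p \<ge> 0" for p
    unfolding f_def by (rule objective_deriv_nonneg[OF cpt cont _ minm]) (use gR(1) in \<open>simp add: g_def fs\<close>)
  have fg_zero: "f g p = 0 \<longleftrightarrow> p \<in> range \<theta>" for p using nd by auto
  have c: "c i \<in> A" "\<theta> i \<in> fst (c i)" "snd (c i) (\<theta> i) = 0" for i
    using assms(13) unfolding normal_coordinates_def by auto
  have im0: "0 \<in> snd (c i) ` fst (c i)" for i using c[of i] by (metis imageI)
  have sigH: "sigma_min (\<beta>\<^sub>0\<^sup>2 *\<^sub>R hessian_matrix (c i) (\<lambda>p. \<phi> p \<bullet> g + lam) (\<theta> i)) > 0" for i
  proof -
    have "(MIN i. sigma_min (\<beta>\<^sub>0\<^sup>2 *\<^sub>R hessian_matrix (c i) (f g) (\<theta> i))) > 0" using nd by blast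
    then have "sigma_min (\<beta>\<^sub>0\<^sup>2 *\<^sub>R hessian_matrix (c i) (f g) (\<theta> i)) > 0" by (subst (asm) Min_gr_iff) auto
    then show ?thesis unfolding f_def .
  qed
  obtain U where U: "\<And>i. open (U i)" "\<And>i. \<theta> i \<in> U i" "\<And>i j. i \<noteq> j \<Longrightarrow> U i \<inter> U j = {}"
    using separating_neighbourhoods[OF assms(12)] by metis
  \<comment> \<open>The bounds survive a smaller \<open>\<rho>\<close> or \<open>k\<close> and a
    larger \<open>C\<close> or \<open>\<Lambda>\<close>, so the constants of the finitely many atoms
    can be made common.\<close>
  define Q where "Q i \<rho> C k \<Lambda> \<longleftrightarrow> (\<forall>p\<in>fst (c i). norm (snd (c i) p) < \<rho> \<longrightarrow>
      p \<in> U i \<and>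
      norm (\<phi> p - \<phi> (\<theta> i)) \<le> C * norm (snd (c i) p) \<and>
      norm (\<phi> p - \<phi> (\<theta> i) - F1 (c i) 0 (snd (c i) p)) \<le> C * (norm (snd (c i) p))\<^sup>2 \<and>
      norm (F1 (c i) (snd (c i) p) (snd (c i) p) - F1 (c i) 0 (snd (c i) p)) \<le> C * (norm (snd (c i) p))\<^sup>2 \<and>
      k * (norm (snd (c i) p))\<^sup>2 \<le> \<phi> p \<bullet> g + lam \<and>
      \<phi> p \<bullet> g + lam \<le> C * (norm (snd (c i) p))\<^sup>2 \<and>
      k * (norm (snd (c i) p))\<^sup>2 \<le> F1 (c i) (snd (c i) p) (snd (c i) p) \<bullet> g \<and>
      snd (c i) p \<bullet> (G (c i) p *v snd (c i) p) \<le> \<Lambda> * (norm (snd (c i) p))\<^sup>2)" for i \<rho> C k \<Lambda>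
  have "\<exists>\<rho> C k \<Lambda>. 0 < \<rho> \<and> \<rho> \<le> 1 \<and> 0 < C \<and> 0 < k \<and> 0 < \<Lambda> \<and> Q i \<rho> C k \<Lambda>" for i
    unfolding Q_def
  proof (rule local_model_near_minimum[OF M c(1-3)])
    show "(in_chart (c i) \<phi> has_derivative blinfun_apply (F1 (c i) x)) (at x)" if "x \<in> snd (c i) ` fst (c i)" for x
      by (rule F(1)[OF c(1) that])
    show "(F1 (c i) has_derivative blinfun_apply (F2 (c i) 0)) (at 0)" by (rule F(2)[OF c(1) im0])
    show "\<phi> p \<bullet> g + lam \<ge> 0" for p using fg_nonneg[of p] by (simp add: f_def)
    show "\<phi> (\<theta> i) \<bullet> g + lam = 0" using fg_zero[of "\<theta> i"] by (simp add: f_def)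
  qed (use sigH U in auto)
  then obtain \<rho>' C' k' \<Lambda>' where Q': "\<And>i. 0 < \<rho>' i \<and> \<rho>' i \<le> 1 \<and> 0 < C' i \<and> 0 < k' i \<and> 0 < \<Lambda>' i \<and> Q i (\<rho>' i) (C' i) (k' i) (\<Lambda>' i)"
    by metis
  define \<rho> where "\<rho> = Min (range \<rho>')"
  have \<rho>: "\<rho> > 0" "\<And>i. \<rho> \<le> \<rho>' i" unfolding \<rho>_def using Q' by auto
  define N where "N i = {p \<in> fst (c i). norm (snd (c i) p) < \<rho>}" for i
  have N_open: "open (N i)" for i
  proof -
    have "open (fst (c i) \<inter> snd (c i) -` ball 0 \<rho>)"
      using is_chartD(1,3)[OF ch[OF c(1)]] by (intro continuous_open_preimage) auto
    moreover have "fst (c i) \<inter> snd (c i) -` ball 0 \<rho> = N i" by (auto simp: N_def)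
    ultimately show ?thesis by simp
  qed
  have \<theta>_N: "\<theta> i \<in> N i" for i using c[of i] \<rho> by (simp add: N_def)
  \<comment> \<open>The complement of the neighbourhoods is compact and free of zeros of
    \<open>f g\<close>, which are exactly the atoms; if it is empty, any positive constant
    works.\<close>
  obtain k0 where k0: "k0 > 0" "\<And>p. p \<notin> (\<Union>i. N i) \<Longrightarrow> k0 \<le> f g p"
  proof (cases "- (\<Union>i. N i) = {}")
    case True
    then show ?thesis using that[of 1] by auto
  next
    case False
    have "compact (UNIV \<inter> - (\<Union>i. N i))"
      using N_open by (intro compact_Int_closed[OF cpt]) (auto simp: closed_def)
    then have "\<exists>x\<in>- (\<Union>i. N i). \<forall>y\<in>- (\<Union>i. N i). f g x \<le> f g y"
      using False unfolding f_def
      by (intro continuous_attains_inf) (auto intro!: continuous_intros continuous_on_subset[OF cont])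
    then obtain x where x: "x \<in> - (\<Union>i. N i)" "\<And>y. y \<in> - (\<Union>i. N i) \<Longrightarrow> f g x \<le> f g y" by blast
    have "f g x \<noteq> 0" using x(1) \<theta>_N fg_zero[of x] by auto
    then have "f g x > 0" using fg_nonneg[of x] by simp
    then show ?thesis using that x(2) by blast
  qed
  obtain B1 where B1: "\<And>p. norm (\<phi> p) \<le> B1"
    using compact_imp_bounded[OF compact_continuous_image[OF cont cpt]] by (auto simp: bounded_iff)
  have cont_f: "continuous_on UNIV (f h)" for h unfolding f_def by (intro continuous_intros cont)
  obtain B2 where B2: "\<And>p. norm (f g p) \<le> B2"
    using compact_imp_bounded[OF compact_continuous_image[OF cont_f cpt]] by (auto simp: bounded_iff)
  define C where "C = Max (insert B1 (insert B2 (range C')))"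
  have C: "B1 \<le> C" "B2 \<le> C" "\<And>i. C' i \<le> C" unfolding C_def by (auto intro!: Max_ge simp del: Max_insert)
  define k where "k = Min (insert k0 (range k'))"
  have k: "k > 0" "k \<le> k0" "\<And>i. k \<le> k' i" 
    unfolding k_def using k0(1) Q' by (auto intro!: Min_le simp: Min_gr_iff simp del: Min_insert)
  define \<Lambda> where "\<Lambda> = Max (range \<Lambda>')"
  have \<Lambda>: "\<And>i. \<Lambda>' i \<le> \<Lambda>" unfolding \<Lambda>_def by auto
  have Q: "Q i \<rho> C k \<Lambda>" for i
  proof -
    have mono: "a * (norm x)\<^sup>2 \<le> b * (norm x)\<^sup>2" if "a \<le> b" for a b :: real and x :: "real^'d"
      using that by (rule mult_right_mono) simp
    have mono1: "C' i * norm x \<le> C * norm x" for x :: "real^'d"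
      using C(3) by (rule mult_right_mono) simp
    have "Q i (\<rho>' i) (C' i) (k' i) (\<Lambda>' i)" using Q' by blast
    then show ?thesis unfolding Q_def
      using \<rho>(2)[of i] mono[OF C(3)[of i]] mono1 mono[OF k(3)[of i]] mono[OF \<Lambda>[of i]]
      by (meson less_le_trans order_trans)
  qed
  have chart_f: "(in_chart c (f h) has_derivative (\<lambda>x. F1 c (snd c p) x \<bullet> h)) (at (snd c p))"
    if "c \<in> A" "p \<in> fst c" for c p h
  proof -
    have "in_chart c (f h) = (\<lambda>u. in_chart c \<phi> u \<bullet> h + lam)" by (auto simp: in_chart_def f_def)
    then show ?thesis using that by (auto intro!: derivative_eq_intros F(1))
  qed
  define S where "S h = riem_grad_norm_sq A G (f h)" for h
  have S_cont: "continuous_on UNIV (S h)" for h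
    unfolding S_def
  proof (rule continuous_on_riem_grad_norm_sq[OF M])
    show "in_chart c (f h) differentiable (at (snd c p))" if "c \<in> A" "p \<in> fst c" for c p
      using chart_f[OF that] unfolding differentiable_def by blast
    fix c assume c: "c \<in> A"
    have "continuous_on (snd c ` fst c) (F1 c)"
      using F(2)[OF c] has_derivative_continuous by (intro continuous_at_imp_continuous_on) blast
    then have F1: "continuous_on (fst c) (\<lambda>p. F1 c (snd c p))"
      using is_chartD(3)[OF ch[OF c]] continuous_on_compose2 by blast
    have "continuous_on (fst c) (\<lambda>p. \<chi> j. F1 c (snd c p) (axis j 1) \<bullet> h)"
      by (intro continuous_on_vec_lambda continuous_intros F1)
    moreover have "(\<chi> j. F1 c (snd c p) (axis j 1) \<bullet> h) = coord_grad c (f h) p" if "p \<in> fst c" for p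
      using coord_grad_inner[OF chart_f[OF c that, of h]] by (simp add: vec_eq_iff cart_eq_inner_axis[of "coord_grad c (f h) p"])
    ultimately show "continuous_on (fst c) (coord_grad c (f h))" by (rule continuous_on_eq)
  qed
  have S_nonneg: "S h p \<ge> 0" for h p
  proof -
    obtain c where "c \<in> A" "p \<in> fst c" using cov by blast
    then show ?thesis unfolding S_def
      using riem_grad_norm_sq_young(2)[OF M _ _ chart_f zero_less_one] by blast
  qed
  have H: "(gradient R has_derivative hessian_op R fs) (at fs)" by (rule gR(2))
  have L0: "(in_chart (c i) \<phi> has_derivative blinfun_apply (F1 (c i) 0)) (at (snd (c i) (\<theta> i)))" for i
    unfolding c(3) by (rule F(1)[OF c(1) im0])
  interpret sparse_landscape \<phi> R "gradient R" "hessian_op R fs" lam r N "\<lambda>i. snd (c i)" "\<lambda>i. \<phi> (\<theta> i)"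
    "\<lambda>i. blinfun_apply (F1 (c i) 0)" "\<lambda>i p. F1 (c i) (snd (c i) p) (snd (c i) p)" S C k \<Lambda> fs
  proof (rule sparse_landscape.intro)
    show "compact (UNIV :: 'a set)" "continuous_on UNIV \<phi>" "convex_on UNIV R" by (fact cpt cont conv)+
    show "r i > 0" for i using r_pos by blast
    show "C > 0" using C(3) Q' by (meson less_le_trans)
    show "k > 0" by (fact k(1))
    show "\<Lambda> > 0" using \<Lambda> Q' by (meson less_le_trans)
    show "N i \<in> sets borel" for i using N_open by simp
    show "N i \<inter> N j = {}" if "i \<noteq> j" for i j
    proof -
      have "N i \<subseteq> U i" for i using Q[of i] unfolding N_def Q_def by blast
      then show ?thesis using U(3)[OF that] by blast
    qed
    show "(\<lambda>p. indicator (N i) p *\<^sub>R snd (c i) p) \<in> borel_measurable borel" for i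
      using is_chartD(3)[OF ch[OF c(1)]] N_open
      by (intro borel_measurable_continuous_on_indicator) (auto intro: continuous_on_subset simp: N_def)
    show "norm (snd (c i) p) \<le> 1" if "p \<in> N i" for i p
      using that \<rho>(2)[of i] Q'[of i] unfolding N_def by auto
    show "linear (blinfun_apply (F1 (c i) 0))" for i
      by (rule bounded_linear.linear[OF blinfun.bounded_linear_right])
    show "norm (\<phi> p) \<le> C" for p using B1[of p] C(1) by linarith
    show "\<phi> p \<bullet> gradient R fs + lam \<le> C" for p
      using B2[of p] C(2) unfolding f_def g_def[symmetric] by auto
    show "fs = (\<Sum>i\<in>UNIV. (r i)\<^sup>2 *\<^sub>R \<phi> (\<theta> i))" by (fact fs)
    show "GDERIV R x :> gradient R x" for x by (fact gR(1))
    show "(gradient R has_derivative hessian_op R fs) (at fs)" by (fact H)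
    show "h \<noteq> 0 \<Longrightarrow> h \<bullet> hessian_op R fs h > 0" for h using nd by blast
    show "(\<Sum>i\<in>UNIV. a i *\<^sub>R \<phi> (\<theta> i) + F1 (c i) 0 (b i)) = 0 \<Longrightarrow> \<forall>i. a i = 0 \<and> b i = 0" for a b
      by (rule kernel_matrix_independent[OF _ assms(14,15) _ has_derivative_linear[OF H] L0]) (use nd r_pos in auto)
    show "\<phi> (\<theta> i) \<bullet> gradient R fs + lam = 0" for i
      using fg_zero[of "\<theta> i"] unfolding f_def g_def by simp
    show "k \<le> \<phi> p \<bullet> gradient R fs + lam" if "p \<notin> (\<Union>i. N i)" for p
      using k0(2)[OF that] k(2) unfolding f_def g_def by linarith
    show "continuous_on UNIV (S h)" for h by (fact S_cont)
    show "S h p \<ge> 0" for h p by (fact S_nonneg)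
    fix i p assume p: "p \<in> N i"
    then have pc: "p \<in> fst (c i)" and q: "norm (snd (c i) p) < \<rho>" by (auto simp: N_def)
    note Qp = Q[of i, unfolded Q_def g_def, rule_format, OF pc q]
    show "norm (\<phi> p - \<phi> (\<theta> i)) \<le> C * norm (snd (c i) p)"
      "norm (\<phi> p - \<phi> (\<theta> i) - F1 (c i) 0 (snd (c i) p)) \<le> C * (norm (snd (c i) p))\<^sup>2"
      "norm (F1 (c i) (snd (c i) p) (snd (c i) p) - F1 (c i) 0 (snd (c i) p)) \<le> C * (norm (snd (c i) p))\<^sup>2"
      "k * (norm (snd (c i) p))\<^sup>2 \<le> \<phi> p \<bullet> gradient R fs + lam"
      "\<phi> p \<bullet> gradient R fs + lam \<le> C * (norm (snd (c i) p))\<^sup>2"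
      "k * (norm (snd (c i) p))\<^sup>2 \<le> F1 (c i) (snd (c i) p) (snd (c i) p) \<bullet> gradient R fs"
      using Qp by blast+
    show "F1 (c i) (snd (c i) p) (snd (c i) p) \<bullet> h \<le> m / 2 * S h p + \<Lambda> / (2 * m) * (norm (snd (c i) p))\<^sup>2"
      if m: "m > 0" for h m
    proof -
      have "1 / (2 * m) * (snd (c i) p \<bullet> (G (c i) p *v snd (c i) p)) \<le> 1 / (2 * m) * (\<Lambda> * (norm (snd (c i) p))\<^sup>2)"
        using Qp m by (intro mult_left_mono) auto
      then show ?thesis
        using riem_grad_norm_sq_young(1)[OF M c(1) pc chart_f[OF c(1) pc, of h] m, of "snd (c i) p"]
        unfolding S_def by simp
    qed
  qed
  obtain \<delta> \<kappa> where \<delta>: "\<delta> > 0" and \<kappa>: "\<kappa> > 0"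
    and dom: "\<And>\<nu>. \<nu> \<in> finite_borel_measures \<Longrightarrow> gap \<nu> \<le> \<delta> \<Longrightarrow> \<kappa> * gap \<nu> \<le> energy \<nu>"
    using gradient_domination by blast
  have inf: "objective_inf \<phi> R lam = R fs + lam * (\<Sum>i\<in>UNIV. (r i)\<^sup>2)"
  proof -
    have "objective_inf \<phi> R lam = objective \<phi> R lam (sparse_measure r \<theta>)"
      unfolding objective_inf_def by (rule cInf_eq_minimum) (use minm sparse_measure(1) in auto)
    then show ?thesis unfolding objective_sparse_measure[OF cpt cont] fs .
  qed
  have gap: "gap \<nu> = objective \<phi> R lam \<nu> - objective_inf \<phi> R lam" for \<nu>
    unfolding gap_def inf ..
  \<comment> \<open>Integrating the pointwise comparison with the case \<alpha> = \<beta> = 1 gives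
    the factor \<open>min \<alpha> \<beta>\<close>; \<open>\<kappa> / 2\<close> matches the
    \<open>1 / 2\<close> on the left.\<close>
  have "1 / 2 * grad_norm_sq A G \<phi> R lam \<alpha> \<beta> \<nu> \<ge> \<kappa> / 2 * min \<alpha> \<beta> * (objective \<phi> R lam \<nu> - objective_inf \<phi> R lam)"
    if \<nu>: "\<nu> \<in> finite_borel_measures" and J: "objective \<phi> R lam \<nu> \<le> objective_inf \<phi> R lam + \<delta>"
      and pos: "\<alpha> > 0" "\<beta> > 0" for \<nu> \<alpha> \<beta>
  proof -
    define h where "h = gradient R (vec_integral \<nu> \<phi>)"
    have J'\<nu>: "objective_deriv \<phi> R lam \<nu> = f h"
      unfolding objective_deriv_def h_def f_def by simp
    have int: "integrable \<nu> (\<lambda>p. a * \<bar>f h p\<bar>\<^sup>2 + b * S h p)" for a b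
      by (intro integrable_continuous_compact[OF cpt \<nu>] continuous_intros cont_f S_cont)
    have "min \<alpha> \<beta> * energy \<nu> = (\<integral>p. min \<alpha> \<beta> * (4 * \<bar>f h p\<bar>\<^sup>2 + S h p) \<partial>\<nu>)"
      unfolding energy_def J'\<nu> h_def[symmetric] by simp
    also have "\<dots> \<le> (\<integral>p. 4 * \<alpha> * \<bar>f h p\<bar>\<^sup>2 + \<beta> * S h p \<partial>\<nu>)"
    proof (rule integral_mono)
      show "integrable \<nu> (\<lambda>p. min \<alpha> \<beta> * (4 * \<bar>f h p\<bar>\<^sup>2 + S h p))"
        using int[of "min \<alpha> \<beta> * 4" "min \<alpha> \<beta>"] by (simp add: distrib_left mult.assoc)
      show "integrable \<nu> (\<lambda>p. 4 * \<alpha> * \<bar>f h p\<bar>\<^sup>2 + \<beta> * S h p)" by (rule int)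
      fix p
      have "min \<alpha> \<beta> * (4 * \<bar>f h p\<bar>\<^sup>2) \<le> \<alpha> * (4 * \<bar>f h p\<bar>\<^sup>2)" "min \<alpha> \<beta> * S h p \<le> \<beta> * S h p"
        using S_nonneg[of h p] by (auto intro!: mult_right_mono)
      then show "min \<alpha> \<beta> * (4 * \<bar>f h p\<bar>\<^sup>2 + S h p) \<le> 4 * \<alpha> * \<bar>f h p\<bar>\<^sup>2 + \<beta> * S h p"
        unfolding distrib_left by linarith
    qed
    also have "\<dots> = grad_norm_sq A G \<phi> R lam \<alpha> \<beta> \<nu>"
      unfolding grad_norm_sq_def J'\<nu> S_def ..
    finally have le: "min \<alpha> \<beta> * energy \<nu> \<le> grad_norm_sq A G \<phi> R lam \<alpha> \<beta> \<nu>" .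
    have "\<kappa> * gap \<nu> \<le> energy \<nu>" using dom[OF \<nu>] J unfolding gap by simp
    then have "min \<alpha> \<beta> * (\<kappa> * gap \<nu>) \<le> min \<alpha> \<beta> * energy \<nu>" using pos by (intro mult_left_mono) auto
    then have "min \<alpha> \<beta> * (\<kappa> * gap \<nu>) \<le> grad_norm_sq A G \<phi> R lam \<alpha> \<beta> \<nu>" using le by linarith
    then show ?thesis unfolding gap[symmetric] by (simp add: mult_ac)
  qed
  then show ?thesis
    by (intro exI[of _ "objective_inf \<phi> R lam + \<delta>"] exI[of _ "\<kappa> / 2"]) (use \<delta> \<kappa> in auto)
qed

end
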